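(* Let $\mathcal F\in\{A\mathrm J,B\mathrm J,A\mathrm M,B\mathrm M\}$ be any of the four families of interpolation polynomials and let $\lambda,\mu\in\mathcal P_n$. Then $\binom{\lambda}{\mu}\in\mathbb F_{>0}$ if and only if $\lambda\supseteq\mu$.
   Context: Fix $n\geqslant1$. $\mathcal P_n=\{\lambda\in\mathbb Z^n:\lambda_1\geqslant\cdots\geqslant\lambda_n\geqslant0\}$, $|\lambda|=\lambda_1+\dots+\lambda_n$; $\lambda\supseteq\mu$ means $\lambda_i\geqslant\mu_i$ for all $i$. The four families $\mathcal F$ have the following data (base field $\mathbb F$, ring $\Lambda$, shifting map $\mathcal P_n\to\mathbb F^n$, $\lambda\mapsto\overline\lambda$), with indeterminate parameters: - $A\mathrm J$: $\mathbb F=\mathbb Q(\tau)$; $\Lambda=\mathbb F[x_1,\dots,x_n]^{S_n}$; $\overline\lambda_i=\lambda_i+(n-i)\tau$. - $B\mathrm J$: $\mathbb F=\mathbb Q(\tau,\alpha)$; $\Lambda=\mathbb F[x_1^2,\dots,x_n^2]^{S_n}$; $\overline\lambda_i=\lambda_i+(n-i)\tau+\alpha$. - $A\mathrm M$: $\mathbb F=\mathbb Q(q,t)$; $\Lambda=\mathbb F[x_1,\dots,x_n]^{S_n}$; $\overline\lambda_i=q^{\lambda_i}t^{n-i}$. - $B\mathrm M$: $\mathbb F=\mathbb Q(q,t,a)$; $\Lambda=\mathbb F[x_1+x_1^{-1},\dots,x_n+x_n^{-1}]^{S_n}$; $\overline\lambda_i=aq^{\lambda_i}t^{n-i}$. The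 degree of a Laurent polynomial is the maximum of $|\alpha_1|+\dots+|\alpha_n|$ over monomials $x^\alpha$ occurring in it. For $\mu\in\mathcal P_n$, the (unital) interpolation polynomial $h_\mu$ is the unique element of $\Lambda$ of degree at most $|\mu|$ (at most $2|\mu|$ when $\mathcal F=B\mathrm J$) with $h_\mu(\overline\lambda)=\delta_{\lambda\mu}$ for all $\lambda\in\mathcal P_n$ with $|\lambda|\leqslant|\mu|$ (existence and uniqueness are known). The binomial coefficients are $\binom{\lambda}{\mu}=h_\mu(\overline\lambda)\in\mathbb F$. Cones of positivity: for $A\mathrm J$, $\mathbb F_{\geqslant0}=\{f/g:f,g\in\mathbb Z_{\geqslant0}[\tau],g\ne0\}$; for $B\mathrm J$, $\mathbb F_{\geqslant0}=\{f/g:f,g\in\mathbb Z_{\geqslant0}[\tau,\alpha],g\neq0\}$; for $A\mathrm M$, $\mathbb F_{\geqslant0}$ is the set of $f\in\mathbb Q(q,t)$ with $f(q,t)\geqslant0$ for all $q,t\in(0,1)$; for $B\mathrm M$, $\mathbb F_{\geqslant0}$ is the set of $f\in\mathbb Q(q,t,a)$ with $f(q,t,a)\geqslant0$ for all $q,t,a\in(0,1)$ (in the last two cases $f$ is a function from $(0,1)^2$, resp. $(0,1)^3$, to $[0,\infty)$). In all cases $\mathbb F_{>0}=\mathbb F_{\geqslant0}\setminus\{0\}$. *)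

theory Defs
  imports
    Complex_Main
    "HOL-Library.Poly_Mapping"
    "HOL-Computational_Algebra.Polynomial"
    "HOL-Computational_Algebra.Fraction_Field"
    "HOL-Combinatorics.Permutations"
begin

section \<open>Partitions\<close>

text \<open>
  A partition of length at most \<open>n\<close> is a function on the indices \<open>1, ..., n\<close>, extended by \<open>0\<close>
  to all other indices so that equality of functions is equality in \<open>\<int>\<^sup>n\<close>.
\<close>

definition partitions :: "nat \<Rightarrow> (nat \<Rightarrow> nat) set" where
  "partitions n = {lam. (\<forall>i\<in>{1..n}. \<forall>j\<in>{1..n}. i \<le> j \<longrightarrow> lam j \<le> lam i) \<and>
                        (\<forall>i. i \<notin> {1..n} \<longrightarrow> lam i = 0)}"

definition psize :: "nat \<Rightarrow> (nat \<Rightarrow> nat) \<Rightarrow> nat" where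
  "psize n lam = (\<Sum>i\<in>{1..n}. lam i)"

definition contains :: "nat \<Rightarrow> (nat \<Rightarrow> nat) \<Rightarrow> (nat \<Rightarrow> nat) \<Rightarrow> bool" where
  "contains n lam mu \<longleftrightarrow> (\<forall>i\<in>{1..n}. mu i \<le> lam i)"


section \<open>Laurent polynomials\<close>

text \<open>
  Laurent polynomials in the variables \<open>x\<^sub>i\<close> (\<open>i\<close> a natural number): finitely supported maps from
  exponent vectors (finitely supported \<open>nat \<Rightarrow> int\<close>) to coefficients, with convolution product.
\<close>

type_synonym 'a laurent = "(nat \<Rightarrow>\<^sub>0 int) \<Rightarrow>\<^sub>0 'a"

definition X :: "nat \<Rightarrow> 'a::comm_ring_1 laurent" where
  "X i = Poly_Mapping.single (Poly_Mapping.single i 1) 1"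

definition X_inv :: "nat \<Rightarrow> 'a::comm_ring_1 laurent" where
  "X_inv i = Poly_Mapping.single (Poly_Mapping.single i (-1)) 1"

definition laurent_eval :: "'a::field laurent \<Rightarrow> (nat \<Rightarrow> 'a) \<Rightarrow> 'a" where
  "laurent_eval f x =
     (\<Sum>\<alpha>\<in>Poly_Mapping.keys f. Poly_Mapping.lookup f \<alpha> *
        (\<Prod>i\<in>Poly_Mapping.keys \<alpha>. x i powi Poly_Mapping.lookup \<alpha> i))"

text \<open>The degree of the zero polynomial is \<open>0\<close> by convention.\<close>

definition laurent_degree :: "'a::zero laurent \<Rightarrow> nat" where
  "laurent_degree f =
     Max (insert 0 ((\<lambda>\<alpha>. \<Sum>i\<in>Poly_Mapping.keys \<alpha>. nat \<bar>Poly_Mapping.lookup \<alpha> i\<bar>) ` Poly_Mapping.keys f))"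

definition symmetric :: "nat \<Rightarrow> 'a::zero laurent \<Rightarrow> bool" where
  "symmetric n f \<longleftrightarrow>
     (\<forall>\<pi> \<alpha>. \<pi> permutes {1..n} \<longrightarrow>
        Poly_Mapping.lookup f (Poly_Mapping.map_key \<pi> \<alpha>) = Poly_Mapping.lookup f \<alpha>)"

inductive_set generated_algebra :: "'a::comm_ring_1 laurent set \<Rightarrow> 'a laurent set"
  for G :: "'a laurent set" where
  const: "Poly_Mapping.single 0 c \<in> generated_algebra G"
| gen: "g \<in> G \<Longrightarrow> g \<in> generated_algebra G"
| add: "f \<in> generated_algebra G \<Longrightarrow> g \<in> generated_algebra G \<Longrightarrow> f + g \<in> generated_algebra G"
| mult: "f \<in> generated_algebra G \<Longrightarrow> g \<in> generated_algebra G \<Longrightarrow> f * g \<in> generated_algebra G"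

text \<open>\<open>symmetric_algebra n y\<close> is \<open>\<bbbF>[y\<^sub>1, ..., y\<^sub>n]\<^bsup>S\<^sub>n\<^esup>\<close>, the symmetric group permuting the \<open>x\<^sub>i\<close>.\<close>

definition symmetric_algebra :: "nat \<Rightarrow> (nat \<Rightarrow> 'a::comm_ring_1 laurent) \<Rightarrow> 'a laurent set" where
  "symmetric_algebra n y = {f \<in> generated_algebra (y ` {1..n}). symmetric n f}"


section \<open>Interpolation polynomials and binomial coefficients\<close>

text \<open>
  A family is given by the algebra generators \<open>y\<close>, the factor \<open>c\<close> in the degree bound
  (\<open>2\<close> for type BJ and \<open>1\<close> otherwise) and the shifting map \<open>bar\<close>.
\<close>

definition interpolation_poly ::
  "nat \<Rightarrow> (nat \<Rightarrow> 'a::field laurent) \<Rightarrow> nat \<Rightarrow> ((nat \<Rightarrow> nat) \<Rightarrow> nat \<Rightarrow> 'a) \<Rightarrow> (nat \<Rightarrow> nat) \<Rightarrow> 'a laurent" where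
  "interpolation_poly n y c bar mu =
     (THE h. h \<in> symmetric_algebra n y \<and>
             laurent_degree h \<le> c * psize n mu \<and>
             (\<forall>lam\<in>partitions n. psize n lam \<le> psize n mu \<longrightarrow>
                laurent_eval h (bar lam) = (if lam = mu then 1 else 0)))"

definition interpolation_binomial ::
  "nat \<Rightarrow> (nat \<Rightarrow> 'a::field laurent) \<Rightarrow> nat \<Rightarrow> ((nat \<Rightarrow> nat) \<Rightarrow> nat \<Rightarrow> 'a) \<Rightarrow>
     (nat \<Rightarrow> nat) \<Rightarrow> (nat \<Rightarrow> nat) \<Rightarrow> 'a" where
  "interpolation_binomial n y c bar lam mu = laurent_eval (interpolation_poly n y c bar mu) (bar lam)"


section \<open>The four families\<close>

text \<open>
  The base fields are realised as fraction fields of iterated polynomial rings, the first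
  parameter being the innermost variable: \<open>\<rat>(\<tau>)\<close>, \<open>\<rat>(\<tau>,\<alpha>)\<close>, \<open>\<rat>(q,t)\<close>, \<open>\<rat>(q,t,a)\<close>.
\<close>

type_synonym field1 = "rat poly fract"
type_synonym field2 = "rat poly poly fract"
type_synonym field3 = "rat poly poly poly fract"

definition tau_AJ :: field1 where "tau_AJ = Fraction_Field.Fract [:0, 1:] 1"

definition tau_BJ :: field2 where "tau_BJ = Fraction_Field.Fract [:[:0, 1:]:] 1"
definition alpha_BJ :: field2 where "alpha_BJ = Fraction_Field.Fract [:0, 1:] 1"

definition q_AM :: field2 where "q_AM = Fraction_Field.Fract [:[:0, 1:]:] 1"
definition t_AM :: field2 where "t_AM = Fraction_Field.Fract [:0, 1:] 1"

definition q_BM :: field3 where "q_BM = Fraction_Field.Fract [:[:[:0, 1:]:]:] 1"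
definition t_BM :: field3 where "t_BM = Fraction_Field.Fract [:[:0, 1:]:] 1"
definition a_BM :: field3 where "a_BM = Fraction_Field.Fract [:0, 1:] 1"

definition shift_AJ :: "nat \<Rightarrow> (nat \<Rightarrow> nat) \<Rightarrow> nat \<Rightarrow> field1" where
  "shift_AJ n lam i = of_nat (lam i) + of_nat (n - i) * tau_AJ"

definition shift_BJ :: "nat \<Rightarrow> (nat \<Rightarrow> nat) \<Rightarrow> nat \<Rightarrow> field2" where
  "shift_BJ n lam i = of_nat (lam i) + of_nat (n - i) * tau_BJ + alpha_BJ"

definition shift_AM :: "nat \<Rightarrow> (nat \<Rightarrow> nat) \<Rightarrow> nat \<Rightarrow> field2" where
  "shift_AM n lam i = q_AM ^ lam i * t_AM ^ (n - i)"

definition shift_BM :: "nat \<Rightarrow> (nat \<Rightarrow> nat) \<Rightarrow> nat \<Rightarrow> field3" where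
  "shift_BM n lam i = a_BM * q_BM ^ lam i * t_BM ^ (n - i)"

definition binomial_AJ :: "nat \<Rightarrow> (nat \<Rightarrow> nat) \<Rightarrow> (nat \<Rightarrow> nat) \<Rightarrow> field1" where
  "binomial_AJ n = interpolation_binomial n X 1 (shift_AJ n)"

definition binomial_BJ :: "nat \<Rightarrow> (nat \<Rightarrow> nat) \<Rightarrow> (nat \<Rightarrow> nat) \<Rightarrow> field2" where
  "binomial_BJ n = interpolation_binomial n (\<lambda>i. X i ^ 2) 2 (shift_BJ n)"

definition binomial_AM :: "nat \<Rightarrow> (nat \<Rightarrow> nat) \<Rightarrow> (nat \<Rightarrow> nat) \<Rightarrow> field2" where
  "binomial_AM n = interpolation_binomial n X 1 (shift_AM n)"

definition binomial_BM :: "nat \<Rightarrow> (nat \<Rightarrow> nat) \<Rightarrow> (nat \<Rightarrow> nat) \<Rightarrow> field3" where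
  "binomial_BM n = interpolation_binomial n (\<lambda>i. X i + X_inv i) 1 (shift_BM n)"


section \<open>Cones of positivity\<close>

definition nonneg_int_poly1 :: "rat poly set" where
  "nonneg_int_poly1 = {p. \<forall>i. coeff p i \<in> \<nat>}"

definition nonneg_int_poly2 :: "rat poly poly set" where
  "nonneg_int_poly2 = {p. \<forall>i j. coeff (coeff p i) j \<in> \<nat>}"

definition nonneg_AJ :: "field1 set" where
  "nonneg_AJ = {Fraction_Field.Fract f g | f g. f \<in> nonneg_int_poly1 \<and> g \<in> nonneg_int_poly1 \<and> g \<noteq> 0}"

definition nonneg_BJ :: "field2 set" where
  "nonneg_BJ = {Fraction_Field.Fract f g | f g. f \<in> nonneg_int_poly2 \<and> g \<in> nonneg_int_poly2 \<and> g \<noteq> 0}"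

definition eval1 :: "real \<Rightarrow> rat poly \<Rightarrow> real" where
  "eval1 q p = poly (map_poly of_rat p) q"

definition eval2 :: "real \<Rightarrow> real \<Rightarrow> rat poly poly \<Rightarrow> real" where
  "eval2 q t p = poly (map_poly (eval1 q) p) t"

definition eval3 :: "real \<Rightarrow> real \<Rightarrow> real \<Rightarrow> rat poly poly poly \<Rightarrow> real" where
  "eval3 q t a p = poly (map_poly (eval2 q t) p) a"

text \<open>
  For an evaluation homomorphism \<open>ev\<close>, \<open>nonneg_at ev f\<close> says that the rational function \<open>f\<close> is
  defined at the point in question (some representing fraction has non-vanishing denominator there)
  and that its value, which does not depend on the fraction, is nonnegative.
\<close>

definition nonneg_at :: "('p::idom \<Rightarrow> real) \<Rightarrow> 'p fract \<Rightarrow> bool" where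
  "nonneg_at ev f \<longleftrightarrow> (\<exists>p g. f = Fraction_Field.Fract p g \<and> ev g \<noteq> 0 \<and> ev p / ev g \<ge> 0)"

definition nonneg_AM :: "field2 set" where
  "nonneg_AM = {f. \<forall>q\<in>{0<..<1}. \<forall>t\<in>{0<..<1}. nonneg_at (eval2 q t) f}"

definition nonneg_BM :: "field3 set" where
  "nonneg_BM = {f. \<forall>q\<in>{0<..<1}. \<forall>t\<in>{0<..<1}. \<forall>a\<in>{0<..<1}. nonneg_at (eval3 q t a) f}"

definition pos_AJ :: "field1 set" where "pos_AJ = nonneg_AJ - {0}"
definition pos_BJ :: "field2 set" where "pos_BJ = nonneg_BJ - {0}"
definition pos_AM :: "field2 set" where "pos_AM = nonneg_AM - {0}"
definition pos_BM :: "field3 set" where "pos_BM = nonneg_BM - {0}"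

end

theory Submission
  imports Defs "HOL-Computational_Algebra.Polynomial_Factorial"
begin

text \<open>
  Interpolation polynomials are studied through difference operators that preserve symmetric
  polynomials and whose coefficients vanish when a shifted point is not a partition. For \<open>AJ\<close> and
  \<open>AM\<close> there is such an operator of degree \<open>0\<close> that only removes boxes. The polynomial \<open>h\<^sub>\<mu>\<close> is
  an eigenfunction, and the eigenvalue equation at \<open>\<lambda>\<close> is a recursion for the binomial
  coefficients with positive coefficients.

  For \<open>BJ\<close> and \<open>BM\<close> the operators of Koornwinder's type also add boxes, but with a
  two-dimensional space of them the degree (in the \<open>y\<^sub>i\<close>) drops by one. Thus \<open>h\<^sub>\<mu>\<close> is mapped to an explicit
  combination of the \<open>h\<^sub>\<nu>\<close> for \<open>\<nu>\<close> obtained from \<open>\<mu>\<close> by removing a box. Choosing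
  the operator so that one coefficient vanishes gives \<open>h\<^sub>\<mu>(\<lambda>) = 0\<close> unless \<open>\<lambda> \<supseteq> \<mu>\<close>, and
  positivity when \<open>\<lambda>\<close> has exactly one box more than \<open>\<mu>\<close>. The general case follows from the Pieri
  rule, that is, from expanding \<open>(\<Sum>\<^sub>i y\<^sub>i - \<Sum>\<^sub>i y\<^sub>i(\<mu>)) h\<^sub>\<mu>\<close> in the \<open>h\<^sub>\<nu>\<close> of degree \<open>|\<mu>| + 1\<close>.
\<close>

text \<open>In the coordinates y_i = x_i, x_i^2 or x_i + 1/x_i all four families become one problem
  about symmetric polynomial functions on a grid, and only the grid function \<open>c\<close>
  differs. The Laurent polynomials of the definition are reached by a dimension count. In type A all
  terms of the recursion have the same sign. In type B the coefficients that add and those that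
  remove a box have opposite signs, so a recursion alone says nothing about positivity; the freedom
  in the operator serves to isolate single terms. Equations are divided by their coefficients, which
  calls for a cone closed under inverses. Functions that are nonnegative on an open cube do not form
  one, since they may vanish somewhere. For AM and BM the argument therefore runs in a smaller cone,
  whose elements are at each point a quotient of positive numbers. The converse direction holds
  because without containment the coefficient is exactly 0.\<close>

declare One_nat_def [simp del]

section \<open>Symmetric polynomial functions\<close>

text \<open>These are the elementary symmetric polynomials up to the sign \<open>(-1)\<^sup>k\<close>.\<close>

definition ec :: "'i set \<Rightarrow> nat \<Rightarrow> ('i \<Rightarrow> 'a::comm_ring_1) \<Rightarrow> 'a" where
  "ec A k y = coeff (\<Prod>i\<in>A. [:1, - y i:]) k"

lemma ec_cong: "(\<And>i. i \<in> A \<Longrightarrow> y i = z i) \<Longrightarrow> ec A k y = ec A k z"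
  unfolding ec_def by (simp cong: prod.cong)

lemma ec_0 [simp]: "ec A 0 y = 1"
  by (cases "finite A", induction A rule: finite_induct) (auto simp: ec_def)

lemma ec_insert:
  assumes "finite A" "i \<notin> A"
  shows "ec (insert i A) (Suc k) y = ec A (Suc k) y - y i * ec A k y"
  using assms by (simp add: ec_def)

lemma ec_gt_card: "finite A \<Longrightarrow> card A < k \<Longrightarrow> ec A k y = 0"
proof (induction A arbitrary: k rule: finite_induct)
  case empty
  then show ?case by (simp add: ec_def)
next
  case (insert i A)
  then show ?case by (cases k) (auto simp: ec_insert)
qed

lemma prod_diff_eq_sum_ec:
  assumes "finite A"
  shows "(\<Prod>i\<in>A. w - y i) = (\<Sum>k\<le>card A. ec A k y * w ^ (card A - k))"
  using assms
proof (induction A rule: finite_induct)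
  case empty
  then show ?case by simp
next
  case (insert i A)
  let ?n = "card A"
  have "(\<Sum>k\<le>Suc ?n. ec (insert i A) k y * w ^ (Suc ?n - k))
      = w ^ Suc ?n + (\<Sum>k\<le>?n. (ec A (Suc k) y - y i * ec A k y) * w ^ (?n - k))"
    using insert by (simp add: sum.atMost_Suc_shift ec_insert del: sum.atMost_Suc)
  also have "\<dots> = (\<Sum>k\<le>Suc ?n. ec A k y * w ^ (Suc ?n - k)) - y i * (\<Sum>k\<le>?n. ec A k y * w ^ (?n - k))"
    by (simp add: sum.atMost_Suc_shift sum_subtractf sum_distrib_left algebra_simps del: sum.atMost_Suc)
  also have "(\<Sum>k\<le>Suc ?n. ec A k y * w ^ (Suc ?n - k)) = w * (\<Sum>k\<le>?n. ec A k y * w ^ (?n - k))"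
    using insert by (simp add: ec_gt_card sum_distrib_left Suc_diff_le algebra_simps)
  finally show ?case using insert by (simp add: algebra_simps)
qed

text \<open>Dividing the generating polynomial by \<open>1 - y i T\<close> multiplies it by a
  geometric series. Symmetric polynomials in the variables other than \<open>y i\<close> thus become
  polynomials in \<open>y i\<close> with fully symmetric coefficients, by one formula for all
  \<open>i\<close>.\<close>

lemma ec_remove:
  assumes "finite A" "i \<in> A"
  shows "ec (A - {i}) k y = (\<Sum>l\<le>k. y i ^ l * ec A (k - l) y)"
proof (induction k)
  case 0
  then show ?case by simp
next
  case (Suc k)
  have "ec A (Suc k) y = ec (A - {i}) (Suc k) y - y i * ec (A - {i}) k y"
    using ec_insert[of "A - {i}" i k y] assms by (simp add: insert_absorb)
  then show ?case
    using Suc by (simp add: sum.atMost_Suc_shift sum_distrib_left algebra_simps del: sum.atMost_Suc)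
qed

text \<open>Functions are used instead of formal polynomials because all later arguments compare
  values on a grid. The upper bound \<open>d\<close> for the degree is part of the predicate, as a
  function alone need not determine a degree.\<close>

inductive sympoly :: "nat \<Rightarrow> nat \<Rightarrow> ((nat \<Rightarrow> 'a::comm_ring_1) \<Rightarrow> 'a) \<Rightarrow> bool" for n :: nat where
  const: "sympoly n d (\<lambda>_. c)"
| elem: "k \<le> d \<Longrightarrow> sympoly n d (ec {1..n} k)"
| add: "sympoly n d f \<Longrightarrow> sympoly n d g \<Longrightarrow> sympoly n d (\<lambda>y. f y + g y)"
| mult: "sympoly n d f \<Longrightarrow> sympoly n e g \<Longrightarrow> sympoly n (d + e) (\<lambda>y. f y * g y)"

lemma sympoly_mono: "sympoly n d f \<Longrightarrow> d \<le> d' \<Longrightarrow> sympoly n d' f"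
proof (induction arbitrary: d' rule: sympoly.induct)
  case (mult d f e g)
  then have "sympoly n (d' - e) f" by simp
  then have "sympoly n (d' - e + e) (\<lambda>y. f y * g y)"
    using mult by (intro sympoly.mult) auto
  then show ?case using mult.prems by simp
qed (auto intro: sympoly.intros)

lemma sympoly_mult_le:
  "sympoly n d f \<Longrightarrow> sympoly n e g \<Longrightarrow> d + e \<le> d' \<Longrightarrow> sympoly n d' (\<lambda>y. f y * g y)"
  using sympoly.mult sympoly_mono by blast

lemma sympoly_cmult: "sympoly n d f \<Longrightarrow> sympoly n d (\<lambda>y. c * f y)"
  using sympoly.mult[OF sympoly.const[of n 0 c]] by simp

lemma sympoly_diff: "sympoly n d f \<Longrightarrow> sympoly n d g \<Longrightarrow> sympoly n d (\<lambda>y. f y - g y)"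
  using sympoly.add[OF _ sympoly_cmult[of n d g "-1"]] by simp

lemma sympoly_sum:
  "(\<And>i. i \<in> A \<Longrightarrow> sympoly n d (f i)) \<Longrightarrow> sympoly n d (\<lambda>y. \<Sum>i\<in>A. f i y)"
proof (induction A rule: infinite_finite_induct)
  case (insert x F)
  then show ?case by (simp add: sympoly.add)
qed (simp_all add: sympoly.const)

lemma sympoly_cong:
  assumes "sympoly n d f" "\<And>i. i \<in> {1..n} \<Longrightarrow> y i = z i"
  shows "f y = f z"
  using assms by (induction rule: sympoly.induct) (auto intro!: ec_cong arg_cong2[where f="(+)"] arg_cong2[where f="(*)"])

lemma sympoly_prod_diff: "sympoly n n (\<lambda>y. \<Prod>i\<in>{1..n}. w - y i)"
proof -
  have "sympoly n n (\<lambda>y. \<Sum>k\<le>n. ec {1..n} k y * w ^ (n - k))"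
    by (intro sympoly_sum sympoly_mult_le[OF sympoly.elem[of _ n] sympoly.const[of _ 0]]) auto
  then show ?thesis by (simp add: prod_diff_eq_sum_ec)
qed

lemma ec_1: "finite A \<Longrightarrow> ec A 1 y = - (\<Sum>i\<in>A. y i)"
proof (induction A rule: finite_induct)
  case empty
  then show ?case by (simp add: ec_def One_nat_def)
next
  case (insert i A)
  then show ?case using ec_insert[of A i 0 y] by (simp add: One_nat_def)
qed

lemma sympoly_sum_coords: "sympoly n 1 (\<lambda>y. \<Sum>i\<in>{1..n}. y i)"
  using sympoly_cmult[OF sympoly.elem[of 1 1 n], of "-1"] by (simp add: ec_1)

lemma sympoly_0_const: 
  assumes "sympoly n d f" "d = 0"
  obtains c where "\<And>y. f y = c"
  using assms
proof (induction arbitrary: thesis rule: sympoly.induct)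
  case (add d f g)
  obtain a where a: "\<And>y. f y = a" using add by blast
  obtain b where b: "\<And>y. g y = b" using add by blast
  show ?case by (rule add(5)[of "a + b"]) (simp add: a b)
next
  case (mult d f e g)
  obtain a where a: "\<And>y. f y = a" using mult by auto
  obtain b where b: "\<And>y. g y = b" using mult by auto
  show ?case by (rule mult(5)[of "a * b"]) (simp add: a b)
qed auto

text \<open>Serves to compute the eigenvalues in type A, where a degree bound of 1 leaves two
  constants to be determined.\<close>

lemma sympoly_1_affine: 
  assumes "sympoly n d f" "d = 1"
  obtains b c where "\<And>y. f y = b + c * (\<Sum>i\<in>{1..n}. y i)"
  using assms
proof (induction arbitrary: thesis rule: sympoly.induct)
  case (const d k)
  show ?case by (rule const(1)[of k 0]) simp
next
  case (elem k d)
  show ?case 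
  proof (cases k)
    case 0
    show ?thesis by (rule elem(2)[of 1 0]) (simp add: 0)
  next
    case (Suc l)
    then have "k = 1" using elem by simp
    then show ?thesis by (intro elem(2)[of 0 "-1"]) (simp add: ec_1)
  qed
next
  case (add d f g)
  obtain b c where 1: "\<And>y. f y = b + c * (\<Sum>i\<in>{1..n}. y i)" using add by blast
  obtain b' c' where 2: "\<And>y. g y = b' + c' * (\<Sum>i\<in>{1..n}. y i)" using add by blast
  show ?case by (rule add(5)[of "b + b'" "c + c'"]) (simp add: 1 2 algebra_simps)
next
  case (mult d f e g)
  consider "d = 0" "e = 1" | "d = 1" "e = 0" using mult by linarith
  then show ?case
  proof cases
    case 1
    obtain k where k: "\<And>y. f y = k" using sympoly_0_const mult(1) 1 by blast
    obtain b c where 2: "\<And>y. g y = b + c * (\<Sum>i\<in>{1..n}. y i)" using mult 1 by blast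
    show ?thesis by (rule mult(5)[of "k * b" "k * c"]) (simp add: k 2 algebra_simps)
  next
    case 2
    obtain k where k: "\<And>y. g y = k" using sympoly_0_const mult(2) 2 by blast
    obtain b c where 2: "\<And>y. f y = b + c * (\<Sum>i\<in>{1..n}. y i)" using mult 2 by blast
    show ?thesis by (rule mult(5)[of "k * b" "k * c"]) (simp add: k 2 algebra_simps)
  qed
qed

text \<open>In \<open>F y w z\<close> the argument \<open>w\<close> is the new and \<open>z\<close> the old value of the coordinate that is replaced.\<close>

inductive subst_poly :: "nat \<Rightarrow> nat \<Rightarrow> ((nat \<Rightarrow> 'a::comm_ring_1) \<Rightarrow> 'a \<Rightarrow> 'a \<Rightarrow> 'a) \<Rightarrow> bool" for n d :: nat where
  mono: "sympoly n e s \<Longrightarrow> a + b + e \<le> d \<Longrightarrow> subst_poly n d (\<lambda>y w z. w ^ a * z ^ b * s y)"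
| add: "subst_poly n d F \<Longrightarrow> subst_poly n d G \<Longrightarrow> subst_poly n d (\<lambda>y w z. F y w z + G y w z)"

lemma subst_poly_sympoly: "sympoly n e s \<Longrightarrow> e \<le> d \<Longrightarrow> subst_poly n d (\<lambda>y w z. s y)"
  using subst_poly.mono[of n e s 0 0 d] by simp

lemma subst_poly_sum:
  "(\<And>i. i \<in> A \<Longrightarrow> subst_poly n d (F i)) \<Longrightarrow> subst_poly n d (\<lambda>y w z. \<Sum>i\<in>A. F i y w z)"
proof (induction A rule: infinite_finite_induct)
  case (insert x F)
  then show ?case by (simp add: subst_poly.add)
qed (simp_all add: subst_poly_sympoly[OF sympoly.const[of _ 0]])

lemma subst_poly_mult:
  assumes "subst_poly n d F" "subst_poly n d' G"
  shows "subst_poly n (d + d') (\<lambda>y w z. F y w z * G y w z)"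
  using assms
proof (induction F rule: subst_poly.induct)
  case (mono e s a b)
  from mono(3) show ?case
  proof (induction G rule: subst_poly.induct)
    case (mono e' s' a' b')
    have "subst_poly n (d + d') (\<lambda>y w z. w ^ (a + a') * z ^ (b + b') * (s y * s' y))"
      using \<open>sympoly n e s\<close> \<open>a + b + e \<le> d\<close> mono
      by (intro subst_poly.mono[of n "e + e'"] sympoly.mult) auto
    then show ?case by (simp add: power_add algebra_simps)
  next
    case (add F G)
    then show ?case by (simp add: distrib_left subst_poly.add)
  qed
next
  case (add F G)
  then show ?case by (simp add: distrib_right subst_poly.add)
qed

lemma subst_poly_ec_remove:
  "k \<le> d \<Longrightarrow> subst_poly n d (\<lambda>y w z. \<Sum>l\<le>k. z ^ l * ec {1..n} (k - l) y)"
proof (intro subst_poly_sum)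
  fix l assume "k \<le> d" "l \<in> {..k}"
  then show "subst_poly n d (\<lambda>y w z. z ^ l * ec {1..n} (k - l) y)"
    using subst_poly.mono[of n "k - l" "ec {1..n} (k - l)" 0 l d] by (simp add: sympoly.elem)
qed

text \<open>Replacing \<open>y i\<close> by \<open>w\<close> removes one factor of the generating
  polynomial and inserts another. The point is that one \<open>F\<close> serves all
  \<open>i\<close>, so that sums over \<open>i\<close> can be recognised as Lagrange sums.\<close>

lemma sympoly_update:
  assumes "sympoly n d f"
  shows "\<exists>F. subst_poly n d F \<and> (\<forall>y. \<forall>i\<in>{1..n}. \<forall>w. f (y(i := w)) = F y w (y i))"
  using assms
proof (induction rule: sympoly.induct)
  case (const d c)
  then show ?case using subst_poly_sympoly[OF sympoly.const[of n 0 c], of d] by auto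
next
  case (elem k d)
  show ?case
  proof (cases k)
    case 0
    then show ?thesis using subst_poly_sympoly[OF sympoly.const[of n 0 1], of d] by auto
  next
    case (Suc l)
    define F where "F = (\<lambda>(y :: nat \<Rightarrow> 'a) w z. (\<Sum>l\<le>k. z ^ l * ec {1..n} (k - l) y)
        + (- w) * (\<Sum>l'\<le>l. z ^ l' * ec {1..n} (l - l') y))"
    have w: "subst_poly n 1 (\<lambda>(y :: nat \<Rightarrow> 'a) w z. - w)"
      using subst_poly.mono[OF sympoly.const[of n 0 "-1"], of 1 0 1] by simp
    have "subst_poly n (1 + (d - 1)) (\<lambda>(y :: nat \<Rightarrow> 'a) w z. (- w) * (\<Sum>l'\<le>l. z ^ l' * ec {1..n} (l - l') y))"
      using elem Suc by (intro subst_poly_mult[OF w] subst_poly_ec_remove) auto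
    then have "subst_poly n d F"
      unfolding F_def using elem Suc by (intro subst_poly.add subst_poly_ec_remove) auto
    moreover have "ec {1..n} k (y(i := w)) = F y w (y i)" if "i \<in> {1..n}" for y :: "nat \<Rightarrow> 'a" and i w
    proof -
      have "ec {1..n} k (y(i := w)) = ec (insert i ({1..n} - {i})) (Suc l) (y(i := w))"
        using that Suc by (simp add: insert_absorb)
      also have "\<dots> = ec ({1..n} - {i}) k (y(i := w)) - w * ec ({1..n} - {i}) l (y(i := w))"
        by (subst ec_insert) (auto simp: Suc)
      also have "\<dots> = ec ({1..n} - {i}) k y - w * ec ({1..n} - {i}) l y"
        using ec_cong[of "{1..n} - {i}" "y(i := w)" y] by simp
      also have "\<dots> = F y w (y i)" using that by (simp add: ec_remove F_def)
      finally show ?thesis .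
    qed
    ultimately show ?thesis by blast
  qed
next
  case (add d f g)
  then obtain F G where "subst_poly n d F" "\<forall>y. \<forall>i\<in>{1..n}. \<forall>w. f (y(i := w)) = F y w (y i)"
    "subst_poly n d G" "\<forall>y. \<forall>i\<in>{1..n}. \<forall>w. g (y(i := w)) = G y w (y i)" by blast
  then show ?case by (intro exI[of _ "\<lambda>y w z. F y w z + G y w z"]) (simp add: subst_poly.add del: fun_upd_apply)
next
  case (mult d f e g)
  then obtain F G where "subst_poly n d F" "\<forall>y. \<forall>i\<in>{1..n}. \<forall>w. f (y(i := w)) = F y w (y i)"
    "subst_poly n e G" "\<forall>y. \<forall>i\<in>{1..n}. \<forall>w. g (y(i := w)) = G y w (y i)" by blast
  then show ?case by (intro exI[of _ "\<lambda>y w z. F y w z * G y w z"]) (simp add: subst_poly_mult del: fun_upd_apply)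
qed

text \<open>With \<open>w\<close> the shifted coordinate this is the numerator of
  \<open>shift_coeff\<close>. Its degree \<open>n - 1\<close> is what the division by the
  differences \<open>y i - y j\<close> takes away again.\<close>

lemma subst_poly_prod_diff:
  assumes "n \<ge> 1"
  shows "\<exists>Q. subst_poly n (n - 1) Q \<and>
    (\<forall>y. \<forall>i\<in>{1..n}. \<forall>w::'a::comm_ring_1. (\<Prod>j\<in>{1..n} - {i}. w - y j) = Q y w (y i))"
proof -
  define Q where "Q = (\<lambda>(y :: nat \<Rightarrow> 'a) w z. \<Sum>k\<le>n - 1. (\<Sum>l\<le>k. z ^ l * ec {1..n} (k - l) y) * w ^ (n - 1 - k))"
  have "subst_poly n (n - 1) (\<lambda>(y :: nat \<Rightarrow> 'a) w z. (\<Sum>l\<le>k. z ^ l * ec {1..n} (k - l) y) * w ^ (n - 1 - k))"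
    if "k \<le> n - 1" for k
  proof -
    have "subst_poly n (n - 1 - k) (\<lambda>(y :: nat \<Rightarrow> 'a) w z. w ^ (n - 1 - k))"
      using subst_poly.mono[OF sympoly.const[of n 0 1], of "n - 1 - k" 0 "n - 1 - k"] by simp
    from subst_poly_mult[OF subst_poly_ec_remove[OF order.refl, of n k] this]
    moreover have "k + (n - 1 - k) = n - 1" using that by simp
    ultimately show ?thesis by simp
  qed
  then have "subst_poly n (n - 1) Q" unfolding Q_def by (intro subst_poly_sum) auto
  moreover have "(\<Prod>j\<in>{1..n} - {i}. w - y j) = Q y w (y i)" if "i \<in> {1..n}" for i y and w :: 'a
    using that by (subst prod_diff_eq_sum_ec) (auto simp: Q_def ec_remove)
  ultimately show ?thesis by blast
qed

section \<open>Lagrange sums are symmetric polynomials\<close>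

lemma coeff_prod_linear: 
  "finite A \<Longrightarrow> coeff (\<Prod>j\<in>A. [:- y j, 1:] :: 'a::field poly) (card A) = 1"
proof (induction A rule: finite_induct)
  case (insert x F)
  have "degree (\<Prod>j\<in>F. [:- y j, 1:]) = card F"
    by (subst degree_prod_eq_sum_degree) (auto simp: One_nat_def)
  then have "coeff (\<Prod>j\<in>F. [:- y j, 1:]) (Suc (card F)) = 0" by (intro coeff_eq_0) simp
  then show ?case using insert by simp
qed simp

text \<open>The divided difference of \<open>r\<close> at \<open>y 1, ..., y n\<close>. For
  \<open>r = x ^ m\<close> with \<open>m \<ge> n - 1\<close> it is the complete homogeneous
  symmetric polynomial of degree \<open>m - (n - 1)\<close>.\<close>

definition lagrange_sum :: "nat \<Rightarrow> (nat \<Rightarrow> 'a::field) \<Rightarrow> ('a \<Rightarrow> 'a) \<Rightarrow> 'a" where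
  "lagrange_sum n y r = (\<Sum>i\<in>{1..n}. r (y i) / (\<Prod>j\<in>{1..n} - {i}. y i - y j))"

text \<open>For \<open>m < n\<close> the polynomial \<open>x ^ m\<close> equals its Lagrange
  interpolant \<open>Q\<close> at \<open>n\<close> distinct points, and the sum is the coefficient
  of \<open>Q\<close> at \<open>x ^ (n - 1)\<close>.\<close>

lemma lagrange_sum_power_small:
  assumes inj: "inj_on y {1..n}" and m: "m < n"
  shows "lagrange_sum n y (\<lambda>x. x ^ m) = (if m = n - 1 then 1 else 0)"
proof -
  define D where "D i = (\<Prod>j\<in>{1..n} - {i}. y i - y j)" for i
  define B where "B i = (\<Prod>j\<in>{1..n} - {i}. [:- y j, 1:])" for i
  define Q where "Q = (\<Sum>i\<in>{1..n}. smult (y i ^ m / D i) (B i))"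
  have degB: "degree (B i) = n - 1" if "i \<in> {1..n}" for i
    unfolding B_def using that by (subst degree_prod_eq_sum_degree) auto
  have lead: "coeff (B i) (n - 1) = 1" if "i \<in> {1..n}" for i
    using coeff_prod_linear[of "{1..n} - {i}" y] that by (simp add: B_def)
  have D0: "D i \<noteq> 0" if "i \<in> {1..n}" for i
  proof -
    have "y i - y j \<noteq> 0" if "j \<in> {1..n} - {i}" for j
      using inj_onD[OF inj, of i j] that \<open>i \<in> {1..n}\<close> by auto
    then show ?thesis unfolding D_def by (subst prod_zero_iff) auto
  qed
  have BD: "poly (B i) (y i) = D i" for i
    by (simp add: B_def D_def poly_prod)
  have B0: "poly (B i) (y k) = 0" if "k \<in> {1..n}" "i \<noteq> k" for i k
    using that by (auto simp: B_def poly_prod intro!: bexI[of _ k])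
  have Qy: "poly Q (y k) = y k ^ m" if k: "k \<in> {1..n}" for k
  proof -
    have "poly Q (y k) = (\<Sum>i\<in>{1..n}. if i = k then y k ^ m else 0)"
      unfolding Q_def poly_sum using D0 k
      by (intro sum.cong) (auto simp: BD B0)
    then show ?thesis using k by simp
  qed
  have degQ: "degree Q \<le> n - 1"
    unfolding Q_def by (intro degree_sum_le) (auto intro: order.trans[OF degree_smult_le] simp: degB)
  have "Q - monom 1 m = 0"
  proof (rule ccontr)
    assume nz: "Q - monom 1 m \<noteq> 0"
    have "degree (Q - monom 1 m) \<le> n - 1"
      using degQ m by (intro degree_diff_le) (auto intro: order.trans[OF degree_monom_le])
    moreover have "y ` {1..n} \<subseteq> {x. poly (Q - monom 1 m) x = 0}"
      by (auto simp: Qy poly_monom)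
    then have "card (y ` {1..n}) \<le> card {x. poly (Q - monom 1 m) x = 0}"
      by (intro card_mono poly_roots_finite nz)
    then have "n \<le> degree (Q - monom 1 m)"
      using card_image[OF inj] card_poly_roots_bound[OF nz] by simp
    ultimately show False using m by simp
  qed
  then have "coeff Q (n - 1) = (if m = n - 1 then 1 else 0)" by auto
  moreover have "coeff Q (n - 1) = lagrange_sum n y (\<lambda>x. x ^ m)"
    unfolding Q_def coeff_sum lagrange_sum_def D_def by (intro sum.cong) (auto simp: lead)
  ultimately show ?thesis by simp
qed

text \<open>Each \<open>y i\<close> is a root of the product of all \<open>x - y j\<close>, so for
  \<open>m \<ge> n\<close> the power \<open>y i ^ m\<close> is a combination of lower powers with
  symmetric coefficients. As \<open>m - (n - 1)\<close> is truncated, the vanishing for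
  \<open>m < n - 1\<close> is recorded separately: otherwise a symmetric factor in front of the sum
  could exceed the degree bounds of the operators.\<close>

lemma lagrange_sum_power:
  assumes n: "n \<ge> 1"
  shows "\<exists>g. sympoly n (m - (n - 1)) g \<and> (m < n - 1 \<longrightarrow> g = (\<lambda>_. 0)) \<and>
    (\<forall>y. inj_on y {1..n} \<longrightarrow> lagrange_sum n y (\<lambda>x. x ^ m) = g (y :: nat \<Rightarrow> 'a::field))"
proof (induction m rule: less_induct)
  case (less m)
  show ?case
  proof (cases "m < n")
    case True
    then show ?thesis
      by (intro exI[of _ "\<lambda>_. if m = n - 1 then 1 else 0"]) (auto simp: sympoly.const lagrange_sum_power_small)
  next
    case False
    define good where "good m' g \<longleftrightarrow> sympoly n (m' - (n - 1)) g \<and> (m' < n - 1 \<longrightarrow> g = (\<lambda>_. 0)) \<and>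
      (\<forall>y. inj_on y {1..n} \<longrightarrow> lagrange_sum n y (\<lambda>x. x ^ m') = g (y :: nat \<Rightarrow> 'a))" for m' g
    have "\<forall>m'. \<exists>g. m' < m \<longrightarrow> good m' g" using less.IH unfolding good_def by blast
    then obtain G where "\<forall>m'. m' < m \<longrightarrow> good m' (G m')" unfolding choice_iff by blast
    then have G: "\<And>m'. m' < m \<Longrightarrow> sympoly n (m' - (n - 1)) (G m')"
      "\<And>m'. m' < m \<Longrightarrow> m' < n - 1 \<Longrightarrow> G m' = (\<lambda>_. 0)"
      "\<And>m' y. m' < m \<Longrightarrow> inj_on y {1..n} \<Longrightarrow> lagrange_sum n y (\<lambda>x. x ^ m') = G m' y"
      unfolding good_def by blast+
    define g where "g = (\<lambda>y. - (\<Sum>k\<in>{1..n}. ec {1..n} k y * G (m - k) y))"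
    have "sympoly n (m - (n - 1)) (\<lambda>y. ec {1..n} k y * G (m - k) y)" if "k \<in> {1..n}" for k
    proof (cases "m - k < n - 1")
      case True
      then show ?thesis using G(2)[of "m - k"] that False by (auto simp: sympoly.const)
    next
      case nl: False
      show ?thesis using that False nl
        by (intro sympoly_mult_le[OF sympoly.elem[of k k] G(1)[of "m - k"]]) auto
    qed
    then have "sympoly n (m - (n - 1)) g"
      unfolding g_def
      using sympoly_cmult[OF sympoly_sum, of "{1..n}" n "m - (n - 1)" "\<lambda>k y. ec {1..n} k y * G (m - k) y" "-1"]
      by simp
    moreover have "lagrange_sum n y (\<lambda>x. x ^ m) = g y" if inj: "inj_on y {1..n}" for y :: "nat \<Rightarrow> 'a"
    proof -
      have red: "y i ^ m = - (\<Sum>k\<in>{1..n}. ec {1..n} k y * y i ^ (m - k))" if i: "i \<in> {1..n}" for i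
      proof -
        have "(\<Prod>j\<in>{1..n}. y i - y j) = 0" using i by (intro prod_zero) auto
        then have "(\<Sum>k\<le>n. ec {1..n} k y * y i ^ (n - k)) = 0"
          by (simp add: prod_diff_eq_sum_ec)
        then have "0 = y i ^ (m - n) * (\<Sum>k\<le>n. ec {1..n} k y * y i ^ (n - k))"
          by (simp only: mult_zero_right)
        also have "\<dots> = (\<Sum>k\<le>n. ec {1..n} k y * y i ^ (m - k))"
          unfolding sum_distrib_left
        proof (intro sum.cong refl)
          fix k assume "k \<in> {..n}"
          then have "m - k = (m - n) + (n - k)" using False by simp
          then show "y i ^ (m - n) * (ec {1..n} k y * y i ^ (n - k)) = ec {1..n} k y * y i ^ (m - k)"
            by (simp add: power_add)
        qed
        also have "{..n} = insert 0 {1..n}" by auto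
        finally have "y i ^ m + (\<Sum>k\<in>{1..n}. ec {1..n} k y * y i ^ (m - k)) = 0" by simp
        then show ?thesis by (simp only: eq_neg_iff_add_eq_0)
      qed
      have "lagrange_sum n y (\<lambda>x. x ^ m) = (\<Sum>i\<in>{1..n}. - (\<Sum>k\<in>{1..n}. ec {1..n} k y * y i ^ (m - k)) / (\<Prod>j\<in>{1..n} - {i}. y i - y j))"
        unfolding lagrange_sum_def by (intro sum.cong) (auto simp: red)
      also have "\<dots> = - (\<Sum>k\<in>{1..n}. ec {1..n} k y * lagrange_sum n y (\<lambda>x. x ^ (m - k)))"
        unfolding lagrange_sum_def sum_distrib_left
        by (subst sum.swap) (simp add: sum_negf sum_divide_distrib)
      also have "\<dots> = g y"
        unfolding g_def using inj False by (auto intro!: sum.cong simp: G(3))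
      finally show ?thesis .
    qed
    ultimately show ?thesis using False by (intro exI[of _ g]) auto
  qed
qed

lemma lagrange_sum_poly:
  fixes R :: "'a::field poly"
  assumes n: "n \<ge> 1" and deg: "degree R \<le> D" 
  shows "\<exists>g. sympoly n (D - (n - 1)) g \<and> (D < n - 1 \<longrightarrow> g = (\<lambda>_. 0)) \<and>
    (\<forall>y. inj_on y {1..n} \<longrightarrow> lagrange_sum n y (poly R) = g y)"
proof -
  define good where "good m g \<longleftrightarrow> sympoly n (m - (n - 1)) g \<and> (m < n - 1 \<longrightarrow> g = (\<lambda>_. 0)) \<and>
    (\<forall>y. inj_on y {1..n} \<longrightarrow> lagrange_sum n y (\<lambda>x. x ^ m) = g (y :: nat \<Rightarrow> 'a))" for m g
  have "\<forall>m. \<exists>g. good m g" using lagrange_sum_power[OF n] unfolding good_def by blast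
  then obtain G where "\<forall>m. good m (G m)" unfolding choice_iff by blast
  then have G: "\<And>m. sympoly n (m - (n - 1)) (G m)"
    "\<And>m. m < n - 1 \<Longrightarrow> G m = (\<lambda>_. 0)"
    "\<And>m y. inj_on y {1..n} \<Longrightarrow> lagrange_sum n y (\<lambda>x. x ^ m) = G m y"
    unfolding good_def by blast+
  define g where "g = (\<lambda>y. \<Sum>m\<le>D. coeff R m * G m y)"
  have "sympoly n (D - (n - 1)) g"
    unfolding g_def by (intro sympoly_sum sympoly_cmult sympoly_mono[OF G(1)]) auto
  moreover have "lagrange_sum n y (poly R) = g y" if "inj_on y {1..n}" for y
  proof -
    have "poly R x = (\<Sum>m\<le>D. coeff R m * x ^ m)" for x
      unfolding poly_altdef using deg by (intro sum.mono_neutral_left) (auto simp: coeff_eq_0)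
    then show ?thesis
      unfolding g_def lagrange_sum_def 
      by (simp add: sum_divide_distrib, subst sum.swap)
         (simp add: G(3)[OF that, symmetric] lagrange_sum_def sum_distrib_left)
  qed
  ultimately show ?thesis using G(2) by (intro exI[of _ g]) (auto simp: g_def)
qed

section \<open>Difference operators and interpolation\<close>

text \<open>The number \<open>c m j\<close> is the coordinate \<open>y\<^sub>i\<close> at a partition with \<open>\<lambda>\<^sub>i = m\<close> and \<open>n - i = j\<close>. The
  arguments are integers because the operators also involve \<open>m - 1\<close> and \<open>j - 1\<close>.\<close>

definition grid_point :: "nat \<Rightarrow> (int \<Rightarrow> int \<Rightarrow> 'a) \<Rightarrow> (nat \<Rightarrow> nat) \<Rightarrow> nat \<Rightarrow> 'a" where
  "grid_point n c lam i = c (int (lam i)) (int n - int i)"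

text \<open>Going down the rows of a partition both \<open>lam i\<close> and \<open>n - i\<close>
  weakly decrease, so the coordinates to be separated always sit at comparable positions.\<close>

definition distinct_grid :: "(int \<Rightarrow> int \<Rightarrow> 'a) \<Rightarrow> bool" where
  "distinct_grid c \<longleftrightarrow> (\<forall>m m' j j'. 0 \<le> m' \<longrightarrow> m' \<le> m \<longrightarrow> 0 \<le> j' \<longrightarrow> j' \<le> j \<longrightarrow>
     (m, j) \<noteq> (m', j') \<longrightarrow> c m j \<noteq> c m' j')"

text \<open>On the grid \<open>c m j = q^m t^j\<close> the factors are
  \<open>(t^s x_i - x_j) / (x_i - x_j)\<close>, as in Macdonald's operators. The value
  \<open>s = 1\<close> goes with adding a box to row \<open>i\<close> and \<open>s = -1\<close> with
  removing one: the shifted numerator vanishes when the neighbouring row has the same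
  length.\<close>

definition shift_coeff :: "nat \<Rightarrow> (int \<Rightarrow> int \<Rightarrow> 'a::field) \<Rightarrow> (int \<Rightarrow> int \<Rightarrow> 'a) \<Rightarrow> int \<Rightarrow> (nat \<Rightarrow> nat) \<Rightarrow> nat \<Rightarrow> 'a" where
  "shift_coeff n c r s lam i = r (int (lam i)) (int n - int i) *
     (\<Prod>j\<in>{1..n} - {i}. (c (int (lam i)) (int n - int i + s) - grid_point n c lam j) /
        (grid_point n c lam i - grid_point n c lam j))"

lemma partitionsD:
  assumes "lam \<in> partitions n"
  shows "1 \<le> i \<Longrightarrow> i \<le> j \<Longrightarrow> j \<le> n \<Longrightarrow> lam j \<le> lam i" "i = 0 \<or> i > n \<Longrightarrow> lam i = 0"
  using assms unfolding partitions_def by auto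

lemma partitionsI:
  assumes "\<And>i j. 1 \<le> i \<Longrightarrow> i \<le> j \<Longrightarrow> j \<le> n \<Longrightarrow> lam j \<le> lam i" "\<And>i. i = 0 \<or> i > n \<Longrightarrow> lam i = 0"
  shows "lam \<in> partitions n"
  unfolding partitions_def using assms by auto

lemma inj_on_grid_point:
  assumes "distinct_grid c" "lam \<in> partitions n"
  shows "inj_on (grid_point n c lam) {1..n}"
proof (rule linorder_inj_onI)
  fix i k assume "i < k" "i \<in> {1..n}" "k \<in> {1..n}"
  moreover from this have "lam k \<le> lam i" using partitionsD(1)[OF assms(2)] by simp
  ultimately show "grid_point n c lam i \<noteq> grid_point n c lam k"
    using assms(1)[unfolded distinct_grid_def, rule_format, of "int (lam k)" "int (lam i)" "int n - int k" "int n - int i"]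
    unfolding grid_point_def by auto
qed auto

text \<open>With the numerators expressed by \<open>Q\<close>, each monomial contributes a symmetric
  factor times a Lagrange sum. \<open>A\<close> and \<open>B\<close> may have denominators; only the
  combination of both shifts has to be polynomial in \<open>c m j\<close>. The degree
  \<open>n - 1\<close> of \<open>Q\<close> is lost in the Lagrange sum, which leaves
  \<open>D\<close>.\<close>

lemma shift_coeff_sum:
  fixes c :: "int \<Rightarrow> int \<Rightarrow> 'a::field"
  assumes n: "n \<ge> 1" and dist: "distinct_grid c"
    and R: "\<And>k. \<exists>R. degree R \<le> D + k \<and>
      (\<forall>m\<ge>0. \<forall>j\<ge>0. A m j * c m (j + 1) ^ k + B m j * c m (j - 1) ^ k = poly R (c m j))"
  shows "\<exists>g. sympoly n D g \<and> (\<forall>lam\<in>partitions n.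
     (\<Sum>i\<in>{1..n}. shift_coeff n c A 1 lam i + shift_coeff n c B (-1) lam i) = g (grid_point n c lam))"
proof -
  define a where "a lam i = A (int (lam i)) (int n - int i)" for lam i
  define b where "b lam i = B (int (lam i)) (int n - int i)" for lam i
  define u where "u lam i = c (int (lam i)) (int n - int i + 1)" for lam i
  define v where "v lam i = c (int (lam i)) (int n - int i - 1)" for lam i
  define y where "y = grid_point n c"
  define P where "P lam i = (\<Prod>j\<in>{1..n} - {i}. y lam i - y lam j)" for lam i
  obtain Q where Q: "subst_poly n (n - 1) Q"
    and QP: "\<And>y i w. i \<in> {1..n} \<Longrightarrow> (\<Prod>j\<in>{1..n} - {i}. w - y j) = Q y (w :: 'a) (y i)"
    using subst_poly_prod_diff[OF n] by blast
  have "\<exists>g. sympoly n D g \<and> (\<forall>lam\<in>partitions n.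
     (\<Sum>i\<in>{1..n}. (a lam i * Q (y lam) (u lam i) (y lam i) + b lam i * Q (y lam) (v lam i) (y lam i)) / P lam i)
       = g (y lam))"
    using Q
  proof (induction Q rule: subst_poly.induct)
    case (mono e s k l)
    obtain R where R: "degree R \<le> D + k" and 
      Rp: "\<forall>m\<ge>0. \<forall>j\<ge>0. A m j * c m (j + 1) ^ k + B m j * c m (j - 1) ^ k = poly R (c m j)"
      using R by blast
    have Ry: "a lam i * u lam i ^ k + b lam i * v lam i ^ k = poly R (y lam i)" if "i \<in> {1..n}" for lam i
      using that Rp unfolding a_def b_def u_def v_def y_def grid_point_def by auto
    have "degree (R * monom 1 l) \<le> D + k + l"
      using R by (intro order.trans[OF degree_mult_le] add_mono) (auto intro: degree_monom_le)
    from lagrange_sum_poly[OF n this] obtain g where g: "sympoly n (D + k + l - (n - 1)) g"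
      "D + k + l < n - 1 \<Longrightarrow> g = (\<lambda>_. 0)"
      "\<And>z. inj_on z {1..n} \<Longrightarrow> lagrange_sum n z (poly (R * monom 1 l)) = g z" by blast
    have "sympoly n D (\<lambda>y. s y * g y)"
    proof (cases "D + k + l < n - 1")
      case True
      then show ?thesis using g(2) by (simp add: sympoly.const)
    next
      case False
      then show ?thesis using mono by (intro sympoly_mult_le[OF mono(1) g(1)]) auto
    qed
    moreover have "(\<Sum>i\<in>{1..n}. (a lam i * (u lam i ^ k * y lam i ^ l * s (y lam)) +
        b lam i * (v lam i ^ k * y lam i ^ l * s (y lam))) / P lam i) = s (y lam) * g (y lam)"
      if lam: "lam \<in> partitions n" for lam
    proof -
      have "g (y lam) = (\<Sum>i\<in>{1..n}. poly R (y lam i) * y lam i ^ l / P lam i)"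
        using g(3)[of "y lam"] inj_on_grid_point[OF dist lam]
        unfolding y_def[symmetric] by (simp add: lagrange_sum_def P_def poly_monom)
      then have "s (y lam) * g (y lam) = (\<Sum>i\<in>{1..n}. s (y lam) * (poly R (y lam i) * y lam i ^ l / P lam i))"
        by (simp only: sum_distrib_left)
      also have "\<dots> = (\<Sum>i\<in>{1..n}. (a lam i * (u lam i ^ k * y lam i ^ l * s (y lam)) +
        b lam i * (v lam i ^ k * y lam i ^ l * s (y lam))) / P lam i)"
        by (intro sum.cong refl) (simp add: Ry[symmetric] algebra_simps add_divide_distrib)
      finally show ?thesis by simp
    qed
    ultimately show ?case by (intro exI[of _ "\<lambda>y. s y * g y"]) auto
  next
    case (add F G)
    then obtain f g where f: "sympoly n D f" "\<forall>lam\<in>partitions n.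
     (\<Sum>i\<in>{1..n}. (a lam i * F (y lam) (u lam i) (y lam i) + b lam i * F (y lam) (v lam i) (y lam i)) / P lam i) = f (y lam)"
    and g: "sympoly n D g" "\<forall>lam\<in>partitions n.
     (\<Sum>i\<in>{1..n}. (a lam i * G (y lam) (u lam i) (y lam i) + b lam i * G (y lam) (v lam i) (y lam i)) / P lam i) = g (y lam)"
      by blast
    show ?case
      by (intro exI[of _ "\<lambda>y. f y + g y"] conjI sympoly.add f(1) g(1) ballI)
         (simp add: f(2)[rule_format, symmetric] g(2)[rule_format, symmetric] sum.distrib[symmetric] add_divide_distrib algebra_simps)
  qed
  then obtain g where g: "sympoly n D g" "\<And>lam. lam\<in>partitions n \<Longrightarrow>
     (\<Sum>i\<in>{1..n}. (a lam i * Q (y lam) (u lam i) (y lam i) + b lam i * Q (y lam) (v lam i) (y lam i)) / P lam i)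
       = g (y lam)" by blast
  have "(\<Sum>i\<in>{1..n}. shift_coeff n c A 1 lam i + shift_coeff n c B (-1) lam i) = g (y lam)" if "lam\<in>partitions n" for lam
    unfolding g(2)[OF that, symmetric]
    by (intro sum.cong refl)
       (simp add: shift_coeff_def prod_dividef QP[symmetric] a_def b_def u_def v_def y_def P_def add_divide_distrib)
  then show ?thesis using g(1) unfolding y_def by blast
qed

text \<open>The number \<open>e\<close> is the degree of the operator of lemma \<open>shift_operator\<close>, plus one.\<close>

definition polynomial_shift :: "nat \<Rightarrow> (int \<Rightarrow> int \<Rightarrow> 'a::field) \<Rightarrow> (int \<Rightarrow> int \<Rightarrow> 'a) \<Rightarrow> (int \<Rightarrow> int \<Rightarrow> 'a) \<Rightarrow> bool" where
  "polynomial_shift e c r r' \<longleftrightarrow> (\<forall>a k. \<exists>R. degree R \<le> a + e + k \<and> (\<forall>m\<ge>0. \<forall>j\<ge>0.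
     r m j * (c (m + 1) j ^ Suc a - c m j ^ Suc a) * c m (j + 1) ^ k +
     r' m j * (c (m - 1) j ^ Suc a - c m j ^ Suc a) * c m (j - 1) ^ k = poly R (c m j)))"

text \<open>In a monomial \<open>w ^ a * z ^ b * s y\<close> only \<open>w ^ a\<close> changes. The
  difference is 0 for \<open>a = 0\<close> and otherwise contains \<open>w ^ a - z ^ a\<close>,
  which is absorbed into the coefficients before \<open>shift_coeff_sum\<close> is applied.\<close>

lemma shift_operator:
  fixes c :: "int \<Rightarrow> int \<Rightarrow> 'a::field"
  assumes n: "n \<ge> 1" and dist: "distinct_grid c" and sh: "polynomial_shift e c r r'"
    and f: "sympoly n d f"
  shows "\<exists>g. sympoly n (d - 1 + e) g \<and> (\<forall>lam\<in>partitions n.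
     (\<Sum>i\<in>{1..n}. shift_coeff n c r 1 lam i *
          (f ((grid_point n c lam)(i := c (int (lam i) + 1) (int n - int i))) - f (grid_point n c lam)) +
        shift_coeff n c r' (-1) lam i *
          (f ((grid_point n c lam)(i := c (int (lam i) - 1) (int n - int i))) - f (grid_point n c lam)))
     = g (grid_point n c lam))"
proof -
  define y where "y = grid_point n c"
  define u where "u lam i = c (int (lam i) + 1) (int n - int i)" for lam i
  define v where "v lam i = c (int (lam i) - 1) (int n - int i)" for lam i
  obtain F where F: "subst_poly n d F" "\<And>y i w. i \<in> {1..n} \<Longrightarrow> f (y(i := w)) = F y w (y i)"
    using sympoly_update[OF f] by blast
  have F0: "f y = F y (y i) (y i)" if "i \<in> {1..n}" for y i
    using F(2)[OF that, of y "y i"] by simp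
  have "\<exists>g. sympoly n (d - 1 + e) g \<and> (\<forall>lam\<in>partitions n.
     (\<Sum>i\<in>{1..n}. shift_coeff n c r 1 lam i * (F (y lam) (u lam i) (y lam i) - F (y lam) (y lam i) (y lam i)) +
        shift_coeff n c r' (-1) lam i * (F (y lam) (v lam i) (y lam i) - F (y lam) (y lam i) (y lam i)))
      = g (y lam))"
    using F(1)
  proof (induction F rule: subst_poly.induct)
    case (mono e' s a b)
    show ?case
    proof (cases a)
      case 0
      then show ?thesis by (intro exI[of _ "\<lambda>_. 0"]) (simp add: sympoly.const)
    next
      case (Suc a')
      define A where "A m j = r m j * (c (m + 1) j ^ a - c m j ^ a) * c m j ^ b" for m j
      define B where "B m j = r' m j * (c (m - 1) j ^ a - c m j ^ a) * c m j ^ b" for m j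
      have "\<exists>R. degree R \<le> a' + e + b + k \<and>
        (\<forall>m\<ge>0. \<forall>j\<ge>0. A m j * c m (j + 1) ^ k + B m j * c m (j - 1) ^ k = poly R (c m j))" for k
      proof -
        obtain R where R: "degree R \<le> a' + e + k" "\<And>m j. m \<ge> 0 \<Longrightarrow> j \<ge> 0 \<Longrightarrow>
           r m j * (c (m + 1) j ^ a - c m j ^ a) * c m (j + 1) ^ k +
           r' m j * (c (m - 1) j ^ a - c m j ^ a) * c m (j - 1) ^ k = poly R (c m j)"
          using sh unfolding polynomial_shift_def Suc by blast
        have "degree (R * monom 1 b) \<le> a' + e + k + b"
          using R(1) by (intro order.trans[OF degree_mult_le] add_mono) (auto intro: degree_monom_le)
        then show ?thesis
          by (intro exI[of _ "R * monom 1 b"])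
             (auto simp: R(2)[symmetric] A_def B_def poly_monom algebra_simps)
      qed
      from shift_coeff_sum[OF n dist this] obtain g where g: "sympoly n (a' + e + b) g"
        "\<And>lam. lam \<in> partitions n \<Longrightarrow> 
        (\<Sum>i\<in>{1..n}. shift_coeff n c A 1 lam i + shift_coeff n c B (-1) lam i) = g (grid_point n c lam)"
        by blast
      have "sympoly n (d - 1 + e) (\<lambda>y. s y * g y)"
        using mono Suc by (intro sympoly_mult_le[OF mono(1) g(1)]) auto
      moreover have "(\<Sum>i\<in>{1..n}. shift_coeff n c r 1 lam i *
           (u lam i ^ a * y lam i ^ b * s (y lam) - y lam i ^ a * y lam i ^ b * s (y lam)) +
        shift_coeff n c r' (-1) lam i *
           (v lam i ^ a * y lam i ^ b * s (y lam) - y lam i ^ a * y lam i ^ b * s (y lam)))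
      = s (y lam) * g (y lam)" if lam: "lam \<in> partitions n" for lam
        unfolding y_def g(2)[OF lam, symmetric] sum_distrib_left
      proof (intro sum.cong refl)
        fix i assume "i \<in> {1..n}"
        have 1: "shift_coeff n c A 1 lam i = shift_coeff n c r 1 lam i * (u lam i ^ a - y lam i ^ a) * y lam i ^ b"
          unfolding shift_coeff_def A_def u_def y_def grid_point_def[of _ _ _ i] by (simp only: mult_ac)
        have 2: "shift_coeff n c B (-1) lam i = shift_coeff n c r' (-1) lam i * (v lam i ^ a - y lam i ^ a) * y lam i ^ b"
          unfolding shift_coeff_def B_def v_def y_def grid_point_def[of _ _ _ i] by (simp only: mult_ac)
        show "shift_coeff n c r 1 lam i *
           (u lam i ^ a * grid_point n c lam i ^ b * s (grid_point n c lam) - grid_point n c lam i ^ a * grid_point n c lam i ^ b * s (grid_point n c lam)) +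
          shift_coeff n c r' (-1) lam i *
           (v lam i ^ a * grid_point n c lam i ^ b * s (grid_point n c lam) - grid_point n c lam i ^ a * grid_point n c lam i ^ b * s (grid_point n c lam))
          = s (grid_point n c lam) * (shift_coeff n c A 1 lam i + shift_coeff n c B (-1) lam i)"
          unfolding 1 2 y_def by (simp add: algebra_simps)
      qed
      ultimately show ?thesis by (intro exI[of _ "\<lambda>y. s y * g y"]) auto
    qed
  next
    case (add F G)
    then obtain f g where f: "sympoly n (d - 1 + e) f" "\<forall>lam\<in>partitions n.
     (\<Sum>i\<in>{1..n}. shift_coeff n c r 1 lam i * (F (y lam) (u lam i) (y lam i) - F (y lam) (y lam i) (y lam i)) +
        shift_coeff n c r' (-1) lam i * (F (y lam) (v lam i) (y lam i) - F (y lam) (y lam i) (y lam i)))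
      = f (y lam)"
    and g: "sympoly n (d - 1 + e) g" "\<forall>lam\<in>partitions n.
     (\<Sum>i\<in>{1..n}. shift_coeff n c r 1 lam i * (G (y lam) (u lam i) (y lam i) - G (y lam) (y lam i) (y lam i)) +
        shift_coeff n c r' (-1) lam i * (G (y lam) (v lam i) (y lam i) - G (y lam) (y lam i) (y lam i)))
      = g (y lam)"
      by blast
    show ?case
      by (intro exI[of _ "\<lambda>y. f y + g y"] conjI sympoly.add f(1) g(1) ballI)
         (simp add: f(2)[rule_format, symmetric] g(2)[rule_format, symmetric] sum.distrib[symmetric] algebra_simps)
  qed
  then obtain g where g: "sympoly n (d - 1 + e) g" "\<forall>lam\<in>partitions n.
     (\<Sum>i\<in>{1..n}. shift_coeff n c r 1 lam i * (F (y lam) (u lam i) (y lam i) - F (y lam) (y lam i) (y lam i)) +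
        shift_coeff n c r' (-1) lam i * (F (y lam) (v lam i) (y lam i) - F (y lam) (y lam i) (y lam i)))
      = g (y lam)" by blast
  show ?thesis
  proof (intro exI[of _ g] conjI g(1) ballI)
    fix lam assume lam: "lam \<in> partitions n"
    show "(\<Sum>i\<in>{1..n}. shift_coeff n c r 1 lam i *
          (f ((grid_point n c lam)(i := c (int (lam i) + 1) (int n - int i))) - f (grid_point n c lam)) +
        shift_coeff n c r' (-1) lam i *
          (f ((grid_point n c lam)(i := c (int (lam i) - 1) (int n - int i))) - f (grid_point n c lam)))
     = g (grid_point n c lam)"
      unfolding g(2)[rule_format, OF lam, unfolded y_def, symmetric]
      by (intro sum.cong refl) (simp add: F(2) F0[symmetric] u_def v_def del: fun_upd_apply)
  qed
qed

text \<open>When the last coordinate is a constant \<open>b\<close>, the recursion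
  \<open>ec_insert\<close> can be solved for the elementary symmetric polynomials in
  \<open>n\<close> variables. In the application \<open>b\<close> is \<open>c 0 0\<close>, the last
  coordinate of a partition with last part 0.\<close>

lemma sympoly_lift:
  assumes "sympoly n d g"
  shows "\<exists>f. sympoly (Suc n) d f \<and> (\<forall>y. y (Suc n) = b \<longrightarrow> f y = g y)"
  using assms
proof (induction rule: sympoly.induct)
  case (const d c)
  then show ?case using sympoly.const by blast
next
  case (elem k d)
  have "\<exists>f. sympoly (Suc n) k f \<and> (\<forall>y. y (Suc n) = b \<longrightarrow> f y = ec {1..n} k y)"
  proof (induction k)
    case 0
    then show ?case by (intro exI[of _ "\<lambda>_. 1"]) (auto simp: sympoly.const)
  next
    case (Suc k)
    then obtain f where f: "sympoly (Suc n) k f" "\<forall>y. y (Suc n) = b \<longrightarrow> f y = ec {1..n} k y" by blast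
    have "ec {1..n} (Suc k) y = ec {1..Suc n} (Suc k) y + y (Suc n) * ec {1..n} k y" for y :: "nat \<Rightarrow> 'a"
      using ec_insert[of "{1..n}" "Suc n" k y] by (simp add: atLeastAtMostSuc_conv)
    moreover have "sympoly (Suc n) (Suc k) (\<lambda>y. ec {1..Suc n} (Suc k) y + b * f y)"
      by (intro sympoly.add sympoly.elem sympoly_cmult sympoly_mono[OF f(1)]) auto
    ultimately show ?case using f(2) by (intro exI[of _ "\<lambda>y. ec {1..Suc n} (Suc k) y + b * f y"]) auto
  qed
  then show ?case using elem sympoly_mono by blast
next
  case (add d f g)
  then obtain F G where "sympoly (Suc n) d F" "\<forall>y. y (Suc n) = b \<longrightarrow> F y = f y"
    "sympoly (Suc n) d G" "\<forall>y. y (Suc n) = b \<longrightarrow> G y = g y" by blast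
  then show ?case by (intro exI[of _ "\<lambda>y. F y + G y"]) (simp add: sympoly.add)
next
  case (mult d f e g)
  then obtain F G where "sympoly (Suc n) d F" "\<forall>y. y (Suc n) = b \<longrightarrow> F y = f y"
    "sympoly (Suc n) e G" "\<forall>y. y (Suc n) = b \<longrightarrow> G y = g y" by blast
  then show ?case by (intro exI[of _ "\<lambda>y. F y * G y"]) (simp add: sympoly.mult)
qed

lemma sympoly_restrict:
  assumes "sympoly (Suc n) d f"
  shows "\<exists>g. sympoly n d g \<and> (\<forall>y. y (Suc n) = b \<longrightarrow> f y = g y)"
  using assms
proof (induction rule: sympoly.induct)
  case (const d c)
  then show ?case using sympoly.const by blast
next
  case (elem k d)
  show ?case
  proof (cases k)
    case 0
    then show ?thesis by (intro exI[of _ "\<lambda>_. 1"]) (auto simp: sympoly.const)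
  next
    case (Suc l)
    have "ec {1..Suc n} k y = ec {1..n} k y - y (Suc n) * ec {1..n} l y" for y :: "nat \<Rightarrow> 'a"
      using ec_insert[of "{1..n}" "Suc n" l y] by (simp add: atLeastAtMostSuc_conv Suc)
    moreover have "sympoly n d (\<lambda>y. ec {1..n} k y - b * ec {1..n} l y)"
      using elem Suc by (intro sympoly_diff sympoly.elem sympoly_cmult) auto
    ultimately show ?thesis by (intro exI[of _ "\<lambda>y. ec {1..n} k y - b * ec {1..n} l y"]) auto
  qed
next
  case (add d f g)
  then obtain F G where "sympoly n d F" "\<forall>y. y (Suc n) = b \<longrightarrow> f y = F y"
    "sympoly n d G" "\<forall>y. y (Suc n) = b \<longrightarrow> g y = G y" by blast
  then show ?case by (intro exI[of _ "\<lambda>y. F y + G y"]) (simp add: sympoly.add)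
next
  case (mult d f e g)
  then obtain F G where "sympoly n d F" "\<forall>y. y (Suc n) = b \<longrightarrow> f y = F y"
    "sympoly n e G" "\<forall>y. y (Suc n) = b \<longrightarrow> g y = G y" by blast
  then show ?case by (intro exI[of _ "\<lambda>y. F y * G y"]) (simp add: sympoly.mult)
qed

lemma partitions_Suc_zero:
  assumes "lam (Suc n) = 0"
  shows "lam \<in> partitions (Suc n) \<longleftrightarrow> lam \<in> partitions n"
proof
  assume a: "lam \<in> partitions (Suc n)"
  show "lam \<in> partitions n"
  proof (rule partitionsI)
    fix i assume "i = 0 \<or> i > n"
    then show "lam i = 0" using partitionsD(2)[OF a, of i] assms by (cases "i = Suc n") auto
  next
    fix i j assume "1 \<le> i" "i \<le> j" "j \<le> n"
    then show "lam j \<le> lam i" by (intro partitionsD(1)[OF a]) auto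
  qed
next
  assume a: "lam \<in> partitions n"
  show "lam \<in> partitions (Suc n)"
  proof (rule partitionsI)
    fix i j assume "1 \<le> i" "i \<le> j" "j \<le> Suc n"
    then show "lam j \<le> lam i" using partitionsD(1)[OF a, of i j] assms by (cases "j = Suc n") auto
  next
    fix i assume "i = 0 \<or> i > Suc n"
    then show "lam i = 0" by (intro partitionsD(2)[OF a]) auto
  qed
qed

lemma grid_point_Suc: "grid_point (Suc n) c lam = grid_point n (\<lambda>m j. c m (j + 1)) lam"
  by (auto simp: grid_point_def fun_eq_iff algebra_simps)

lemma psize_Suc: "psize (Suc n) lam = psize n lam + lam (Suc n)"
  by (simp add: psize_def)

lemma distinct_grid_shift:
  assumes "distinct_grid c" "a \<ge> 0" "b \<ge> 0"
  shows "distinct_grid (\<lambda>m j. c (m + a) (j + b))"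
  unfolding distinct_grid_def
proof (intro allI impI)
  fix m m' j j' :: int
  assume "0 \<le> m'" "m' \<le> m" "0 \<le> j'" "j' \<le> j" "(m, j) \<noteq> (m', j')"
  then show "c (m + a) (j + b) \<noteq> c (m' + a) (j' + b)"
    using assms(1)[unfolded distinct_grid_def, rule_format, of "m' + a" "m + a" "j' + b" "j + b"] assms(2,3) by auto
qed

text \<open>An interpolant for the partitions with \<open>\<lambda>\<^sub>n = 0\<close> is lifted from \<open>n - 1\<close> variables and corrected on
  those with \<open>\<lambda>\<^sub>n \<ge> 1\<close> by a multiple of \<open>\<Prod>\<^sub>i (c 0 0 - y\<^sub>i)\<close>.\<close>

lemma interpolation_exists:
  fixes c :: "int \<Rightarrow> int \<Rightarrow> 'a::field"
  assumes "distinct_grid c"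
  shows "\<exists>f. sympoly n d f \<and> (\<forall>lam\<in>partitions n. psize n lam \<le> d \<longrightarrow> f (grid_point n c lam) = v lam)"
  using assms
proof (induction n arbitrary: c d v)
  case 0
  have "lam = (\<lambda>_. 0)" if "lam \<in> partitions 0" for lam
    using partitionsD(2)[OF that] by auto
  then show ?case by (intro exI[of _ "\<lambda>_. v (\<lambda>_. 0)"]) (auto simp: sympoly.const)
next
  case (Suc n)
  note IHn = Suc.IH
  show ?case using Suc.prems
  proof (induction d arbitrary: c v rule: less_induct)
    case (less d)
    define b where "b = c 0 0"
    have "distinct_grid (\<lambda>m j. c m (j + 1))" using distinct_grid_shift[OF less.prems, of 0 1] by simp
    from IHn[OF this, of d v] obtain g where g: "sympoly n d g"
      "\<And>lam. lam \<in> partitions n \<Longrightarrow> psize n lam \<le> d \<Longrightarrow> g (grid_point n (\<lambda>m j. c m (j + 1)) lam) = v lam" by blast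
    obtain f where f: "sympoly (Suc n) d f" "\<And>y. y (Suc n) = b \<Longrightarrow> f y = g y"
      using sympoly_lift[OF g(1), of b] by blast
    have f0: "f (grid_point (Suc n) c lam) = v lam"
      if "lam \<in> partitions (Suc n)" "psize (Suc n) lam \<le> d" "lam (Suc n) = 0" for lam
    proof -
      have "f (grid_point (Suc n) c lam) = g (grid_point (Suc n) c lam)"
        using that by (intro f(2)) (simp add: grid_point_def b_def)
      also have "\<dots> = v lam"
        using that partitions_Suc_zero[of lam n] by (simp add: grid_point_Suc psize_Suc g(2))
      finally show ?thesis .
    qed
    define dec where "dec lam = (\<lambda>i. lam i - 1)" for lam :: "nat \<Rightarrow> nat"
    define inc where "inc lam = (\<lambda>i. if i \<in> {1..Suc n} then Suc (lam i) else 0)" for lam :: "nat \<Rightarrow> nat"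
    have ge1: "lam i \<ge> 1" if "lam \<in> partitions (Suc n)" "lam (Suc n) \<noteq> 0" "i \<in> {1..Suc n}" for lam i
      using partitionsD(1)[OF that(1), of i "Suc n"] that by auto
    have incdec: "inc (dec lam) = lam" if "lam \<in> partitions (Suc n)" "lam (Suc n) \<noteq> 0" for lam
    proof
      fix i show "inc (dec lam) i = lam i"
        using ge1[OF that, of i] partitionsD(2)[OF that(1), of i] by (auto simp: inc_def dec_def)
    qed
    have dec_part: "dec lam \<in> partitions (Suc n)" if "lam \<in> partitions (Suc n)" for lam
      using partitionsD[OF that] by (intro partitionsI) (auto simp: dec_def diff_le_mono)
    have size_dec: "psize (Suc n) lam = psize (Suc n) (dec lam) + Suc n"
      if "lam \<in> partitions (Suc n)" "lam (Suc n) \<noteq> 0" for lam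
    proof -
      have "psize (Suc n) lam = (\<Sum>i\<in>{1..Suc n}. dec lam i + 1)"
        unfolding psize_def using ge1[OF that] by (intro sum.cong) (auto simp: dec_def)
      then show ?thesis by (simp add: psize_def sum.distrib)
    qed
    show ?case
    proof (cases "d < Suc n")
      case True
      have "lam (Suc n) = 0" if "lam \<in> partitions (Suc n)" "psize (Suc n) lam \<le> d" for lam
        using size_dec[of lam] that True by fastforce
      then show ?thesis using f f0 by blast
    next
      case False
      \<comment> \<open>The product vanishes once the last part is 0, so a multiple of it keeps the
        values already reached. The other partitions lose their first column: \<open>Suc n\<close>
        boxes, matched by the degree of the product, and a shift in the first argument of
        \<open>c\<close>.\<close>
      define w where "w lam = (\<Prod>i\<in>{1..Suc n}. b - grid_point (Suc n) c lam i)" for lam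
      have "distinct_grid (\<lambda>m j. c (m + 1) j)" using distinct_grid_shift[OF less.prems, of 1 0] by simp
      from less.IH[OF _ this, of "d - Suc n" "\<lambda>lam. (v (inc lam) - f (grid_point (Suc n) c (inc lam))) / w (inc lam)"] False
      obtain h where h: "sympoly (Suc n) (d - Suc n) h"
        "\<And>lam. lam \<in> partitions (Suc n) \<Longrightarrow> psize (Suc n) lam \<le> d - Suc n \<Longrightarrow>
          h (grid_point (Suc n) (\<lambda>m j. c (m + 1) j) lam) = (v (inc lam) - f (grid_point (Suc n) c (inc lam))) / w (inc lam)"
        by auto
      define F where "F y = f y + (\<Prod>i\<in>{1..Suc n}. b - y i) * h y" for y
      have "sympoly (Suc n) d F"
        unfolding F_def using False by (intro sympoly.add f(1) sympoly_mult_le[OF sympoly_prod_diff h(1)]) auto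
      moreover have "F (grid_point (Suc n) c lam) = v lam"
        if lam: "lam \<in> partitions (Suc n)" "psize (Suc n) lam \<le> d" for lam
      proof (cases "lam (Suc n) = 0")
        case True
        then have "(\<Prod>i\<in>{1..Suc n}. b - grid_point (Suc n) c lam i) = 0"
          by (intro prod_zero bexI[of _ "Suc n"]) (auto simp: grid_point_def b_def)
        then show ?thesis using f0 lam True by (simp add: F_def)
      next
        case nz: False
        have "w lam \<noteq> 0"
        proof -
          have "c (int (lam i)) (int (Suc n) - int i) \<noteq> c 0 0" if "i \<in> {1..Suc n}" for i
            using less.prems[unfolded distinct_grid_def, rule_format, of 0 "int (lam i)" 0 "int (Suc n) - int i"]
              ge1[OF lam(1) nz that] that by auto
          then have "c 0 0 - grid_point (Suc n) c lam i \<noteq> 0" if "i \<in> {1..Suc n}" for i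
            using that unfolding grid_point_def by fastforce
          then show ?thesis unfolding w_def b_def by (subst prod_zero_iff) auto
        qed
        moreover have "h (grid_point (Suc n) c lam) = h (grid_point (Suc n) (\<lambda>m j. c (m + 1) j) (dec lam))"
        proof (rule sympoly_cong[OF h(1)])
          fix i assume "i \<in> {1..Suc n}"
          then show "grid_point (Suc n) c lam i = grid_point (Suc n) (\<lambda>m j. c (m + 1) j) (dec lam) i"
            using ge1[OF lam(1) nz, of i] by (auto simp: grid_point_def dec_def of_nat_diff)
        qed
        moreover have "h (grid_point (Suc n) (\<lambda>m j. c (m + 1) j) (dec lam)) = (v lam - f (grid_point (Suc n) c lam)) / w lam"
          using h(2)[OF dec_part[OF lam(1)]] size_dec[OF lam(1) nz] lam(2) incdec[OF lam(1) nz] by simp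
        ultimately show ?thesis by (simp add: F_def w_def)
      qed
      ultimately show ?thesis by blast
    qed
  qed
qed

section \<open>Laurent polynomials\<close>

abbreviation "keys \<equiv> Poly_Mapping.keys"
abbreviation "lookup \<equiv> Poly_Mapping.lookup"

definition monomial_value :: "(nat \<Rightarrow> 'a::field) \<Rightarrow> (nat \<Rightarrow>\<^sub>0 int) \<Rightarrow> 'a" where
  "monomial_value x \<alpha> = (\<Prod>i\<in>keys \<alpha>. x i powi lookup \<alpha> i)"

text \<open>\<open>0 powi k\<close> is 0 for negative \<open>k\<close>, so at a zero coordinate
  evaluation would not respect the product of a variable and its inverse.\<close>

definition monomial_ok :: "(nat \<Rightarrow> 'a::field) \<Rightarrow> (nat \<Rightarrow>\<^sub>0 int) \<Rightarrow> bool" where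
  "monomial_ok x \<alpha> \<longleftrightarrow> (\<forall>i. x i = 0 \<longrightarrow> 0 \<le> lookup \<alpha> i)"

lemma monomial_value_superset:
  assumes "finite S" "keys \<alpha> \<subseteq> S"
  shows "monomial_value x \<alpha> = (\<Prod>i\<in>S. x i powi lookup \<alpha> i)"
  unfolding monomial_value_def using assms by (intro prod.mono_neutral_left) (auto simp: in_keys_iff)

lemma power_int_add_ok:
  assumes "x = 0 \<longrightarrow> 0 \<le> a \<and> 0 \<le> b"
  shows "(x :: 'a::field) powi (a + b) = x powi a * x powi b"
proof (cases "x = 0 \<and> a + b = 0")
  case True
  then have "a = 0" "b = 0" using assms by auto
  then show ?thesis by simp
next
  case False
  then show ?thesis by (intro power_int_add) auto
qed

lemma monomial_value_add:
  assumes "monomial_ok x \<alpha>" "monomial_ok x \<beta>"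
  shows "monomial_value x (\<alpha> + \<beta>) = monomial_value x \<alpha> * monomial_value x \<beta>"
proof -
  let ?S = "keys \<alpha> \<union> keys \<beta>"
  have "monomial_value x (\<alpha> + \<beta>) = (\<Prod>i\<in>?S. x i powi (lookup \<alpha> i + lookup \<beta> i))"
    using Poly_Mapping.keys_add[of \<alpha> \<beta>] by (subst monomial_value_superset[of ?S]) (auto simp: lookup_add)
  also have "\<dots> = (\<Prod>i\<in>?S. x i powi lookup \<alpha> i * x i powi lookup \<beta> i)"
    using assms unfolding monomial_ok_def by (intro prod.cong refl power_int_add_ok) auto
  also have "\<dots> = monomial_value x \<alpha> * monomial_value x \<beta>"
    unfolding prod.distrib by (subst (1 2) monomial_value_superset[of ?S]) auto
  finally show ?thesis .
qed

lemma laurent_eval_superset: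
  assumes "finite S" "keys f \<subseteq> S"
  shows "laurent_eval f x = (\<Sum>\<alpha>\<in>S. lookup f \<alpha> * monomial_value x \<alpha>)"
  unfolding laurent_eval_def monomial_value_def[symmetric]
  using assms by (intro sum.mono_neutral_left) (auto simp: in_keys_iff)

lemma laurent_eval_add: "laurent_eval (f + g) x = laurent_eval f x + laurent_eval g x"
proof -
  let ?S = "keys f \<union> keys g"
  show ?thesis
    using Poly_Mapping.keys_add[of f g]
    by (subst (1 2 3) laurent_eval_superset[of ?S]) (auto simp: lookup_add sum.distrib distrib_right)
qed

lemma laurent_eval_zero: "laurent_eval 0 x = 0"
  by (simp add: laurent_eval_def)

lemma laurent_eval_sum: "laurent_eval (\<Sum>i\<in>A. f i) x = (\<Sum>i\<in>A. laurent_eval (f i) x)"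
  by (induction A rule: infinite_finite_induct) (auto simp: laurent_eval_zero laurent_eval_add)

lemma laurent_eval_single: "laurent_eval (Poly_Mapping.single \<alpha> c) x = c * monomial_value x \<alpha>"
  by (subst laurent_eval_superset[of "{\<alpha>}"]) auto

lemma monomial_value_0: "monomial_value x 0 = 1"
  by (simp add: monomial_value_def)

lemma laurent_expand: "f = (\<Sum>\<alpha>\<in>keys f. Poly_Mapping.single \<alpha> (lookup f \<alpha>))"
proof (rule poly_mapping_eqI)
  fix \<beta>
  have "lookup (\<Sum>\<alpha>\<in>keys f. Poly_Mapping.single \<alpha> (lookup f \<alpha>)) \<beta>
      = (\<Sum>\<alpha>\<in>keys f. if \<alpha> = \<beta> then lookup f \<alpha> else 0)"
    unfolding lookup_sum by (intro sum.cong) (auto simp: lookup_single when_def)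
  then show "lookup f \<beta> = lookup (\<Sum>\<alpha>\<in>keys f. Poly_Mapping.single \<alpha> (lookup f \<alpha>)) \<beta>"
    by (simp add: in_keys_iff)
qed

lemma laurent_mult_expand:
  "f * g = (\<Sum>\<alpha>\<in>keys f. \<Sum>\<beta>\<in>keys g. Poly_Mapping.single (\<alpha> + \<beta>) (lookup f \<alpha> * lookup g \<beta>))"
  by (subst laurent_expand[of f], subst laurent_expand[of g]) (simp add: sum_product mult_single)

lemma laurent_eval_mult:
  assumes "\<And>\<alpha>. \<alpha> \<in> keys f \<Longrightarrow> monomial_ok x \<alpha>" "\<And>\<alpha>. \<alpha> \<in> keys g \<Longrightarrow> monomial_ok x \<alpha>"
  shows "laurent_eval (f * g) x = laurent_eval f x * laurent_eval g x"
proof -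
  have "laurent_eval (f * g) x = (\<Sum>\<alpha>\<in>keys f. \<Sum>\<beta>\<in>keys g. lookup f \<alpha> * lookup g \<beta> * monomial_value x (\<alpha> + \<beta>))"
    by (subst laurent_mult_expand) (simp add: laurent_eval_sum laurent_eval_single)
  also have "\<dots> = (\<Sum>\<alpha>\<in>keys f. \<Sum>\<beta>\<in>keys g. (lookup f \<alpha> * monomial_value x \<alpha>) * (lookup g \<beta> * monomial_value x \<beta>))"
    by (intro sum.cong refl) (simp add: monomial_value_add assms)
  also have "\<dots> = laurent_eval f x * laurent_eval g x"
    by (simp add: sum_product laurent_eval_def monomial_value_def)
  finally show ?thesis .
qed

section \<open>Symmetries of Laurent polynomials\<close>

lemma map_key_sum: "inj s \<Longrightarrow> Poly_Mapping.map_key s (\<Sum>i\<in>A. f i) = (\<Sum>i\<in>A. Poly_Mapping.map_key s (f i))"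
  by (induction A rule: infinite_finite_induct) (auto simp: map_key_plus)

text \<open>An additive bijection of the exponents induces a ring automorphism. It is applied to
  permutations of the variables and to the inversion of some of them.\<close>

lemma map_key_mult:
  fixes f g :: "'a::comm_ring_1 laurent"
  assumes bij: "bij s" and add: "\<And>a b. s (a + b) = s a + s b"
  shows "Poly_Mapping.map_key s (f * g) = Poly_Mapping.map_key s f * Poly_Mapping.map_key s g"
proof -
  have inj: "inj s" and surj: "surj s" using bij by (auto simp: bij_def)
  have single: "Poly_Mapping.map_key s (Poly_Mapping.single a v) = Poly_Mapping.single (inv s a) v" 
    for a and v :: 'a
    using map_key_single[OF inj, of "inv s a" v] surj by (simp add: surj_f_inv_f)
  have inv_add: "inv s (a + b) = inv s a + inv s b" for a b
    by (rule inv_f_eq[OF inj]) (simp add: add surj surj_f_inv_f)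
  show ?thesis
    by (subst laurent_mult_expand, subst (3) laurent_expand[of f], subst (3) laurent_expand[of g])
       (simp add: map_key_sum inj single inv_add sum_product mult_single)
qed

lemma map_key_one:
  fixes s :: "(nat \<Rightarrow>\<^sub>0 int) \<Rightarrow> (nat \<Rightarrow>\<^sub>0 int)"
  assumes "inj s" "s 0 = 0"
  shows "Poly_Mapping.map_key s (1 :: 'a::comm_ring_1 laurent) = 1"
  using map_key_single[OF assms(1), of 0 "1::'a"] assms(2) by simp

lemma bij_map_key_permutes:
  assumes "p permutes S"
  shows "bij (Poly_Mapping.map_key p :: ('i \<Rightarrow>\<^sub>0 'b::zero) \<Rightarrow> _)"
proof (rule o_bij)
  have p: "inj p" "inj (inv p)" using assms permutes_inj permutes_inv by blast+
  show "Poly_Mapping.map_key (inv p) \<circ> Poly_Mapping.map_key p = id"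
    using p by (intro ext poly_mapping_eqI) (simp add: map_key.rep_eq permutes_inverses(1)[OF assms])
  show "Poly_Mapping.map_key p \<circ> Poly_Mapping.map_key (inv p) = id"
    using p by (intro ext poly_mapping_eqI) (simp add: map_key.rep_eq permutes_inverses(2)[OF assms])
qed

lemma symmetric_iff_map_key:
  "symmetric n f \<longleftrightarrow> (\<forall>p. p permutes {1..n} \<longrightarrow> Poly_Mapping.map_key (Poly_Mapping.map_key p) f = f)"
proof -
  have "Poly_Mapping.map_key (Poly_Mapping.map_key p) f = f \<longleftrightarrow> 
    (\<forall>\<alpha>. lookup f (Poly_Mapping.map_key p \<alpha>) = lookup f \<alpha>)" if "p permutes {1..n}" for p
  proof -
    have "inj (Poly_Mapping.map_key p :: (nat \<Rightarrow>\<^sub>0 int) \<Rightarrow> _)"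
      by (intro bij_is_inj bij_map_key_permutes[OF that])
    then show ?thesis by (simp add: poly_mapping_eq_iff map_key.rep_eq fun_eq_iff)
  qed
  then show ?thesis unfolding symmetric_def by blast
qed

lemma symmetric_mult:
  assumes "symmetric n f" "symmetric n (g :: 'a::comm_ring_1 laurent)"
  shows "symmetric n (f * g)"
  unfolding symmetric_iff_map_key
proof (intro allI impI)
  fix p assume p: "p permutes {1..n}"
  have "Poly_Mapping.map_key (Poly_Mapping.map_key p) (f * g) =
      Poly_Mapping.map_key (Poly_Mapping.map_key p) f * Poly_Mapping.map_key (Poly_Mapping.map_key p) g"
    by (intro map_key_mult bij_map_key_permutes[OF p] map_key_plus permutes_inj[OF p])
  then show "Poly_Mapping.map_key (Poly_Mapping.map_key p) (f * g) = f * g"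
    using assms p unfolding symmetric_iff_map_key by simp
qed

lemma symmetric_add: "symmetric n f \<Longrightarrow> symmetric n g \<Longrightarrow> symmetric n (f + g)"
  by (simp add: symmetric_def lookup_add)

lemma symmetric_const: "symmetric n (Poly_Mapping.single 0 c)"
proof -
  have "Poly_Mapping.map_key p \<alpha> = 0 \<longleftrightarrow> \<alpha> = 0" if "p permutes {1..n}" for p and \<alpha> :: "nat \<Rightarrow>\<^sub>0 int"
    using inj_eq[OF bij_is_inj[OF bij_map_key_permutes[OF that]], of \<alpha> 0]
      map_key_zero[OF permutes_inj[OF that]] by metis
  then show ?thesis
    by (auto simp: symmetric_def lookup_single when_def)
qed

lemma lookup_const_mult: "lookup (Poly_Mapping.single 0 c * f) \<alpha> = c * lookup f \<alpha>"
  by (simp flip: mult_map_scale_conv_mult add: map.rep_eq when_def)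

definition weight :: "(nat \<Rightarrow>\<^sub>0 int) \<Rightarrow> nat" where
  "weight \<alpha> = (\<Sum>i\<in>keys \<alpha>. nat \<bar>lookup \<alpha> i\<bar>)"

lemma weight_superset:
  assumes "finite S" "keys \<alpha> \<subseteq> S"
  shows "weight \<alpha> = (\<Sum>i\<in>S. nat \<bar>lookup \<alpha> i\<bar>)"
  unfolding weight_def using assms by (intro sum.mono_neutral_left) (auto simp: in_keys_iff)

lemma weight_add: "weight (\<alpha> + \<beta>) \<le> weight \<alpha> + weight \<beta>"
proof -
  let ?S = "keys \<alpha> \<union> keys \<beta>"
  have "weight (\<alpha> + \<beta>) = (\<Sum>i\<in>?S. nat \<bar>lookup \<alpha> i + lookup \<beta> i\<bar>)"
    using Poly_Mapping.keys_add[of \<alpha> \<beta>] by (subst weight_superset[of ?S]) (auto simp: lookup_add)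
  also have "\<dots> \<le> (\<Sum>i\<in>?S. nat \<bar>lookup \<alpha> i\<bar> + nat \<bar>lookup \<beta> i\<bar>)"
    by (intro sum_mono) linarith
  also have "\<dots> = weight \<alpha> + weight \<beta>"
    unfolding sum.distrib by (subst (1 2) weight_superset[of ?S]) auto
  finally show ?thesis .
qed

lemma laurent_degree_le_iff: "laurent_degree f \<le> D \<longleftrightarrow> (\<forall>\<alpha>\<in>keys f. weight \<alpha> \<le> D)"
  unfolding laurent_degree_def weight_def by (subst Max_le_iff) auto

lemma laurent_degree_add: "laurent_degree f \<le> D \<Longrightarrow> laurent_degree g \<le> D \<Longrightarrow> laurent_degree (f + g) \<le> D"
  unfolding laurent_degree_le_iff using Poly_Mapping.keys_add[of f g] by auto

lemma laurent_degree_mult: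
  assumes "laurent_degree f \<le> D" "laurent_degree g \<le> E" "D + E \<le> F"
  shows "laurent_degree (f * g) \<le> F"
  unfolding laurent_degree_le_iff
proof
  fix \<gamma> assume "\<gamma> \<in> keys (f * g)"
  then obtain \<alpha> \<beta> where "\<alpha> \<in> keys f" "\<beta> \<in> keys g" "\<gamma> = \<alpha> + \<beta>"
    using keys_mult[of f g] by auto
  then show "weight \<gamma> \<le> F"
    using assms weight_add[of \<alpha> \<beta>] unfolding laurent_degree_le_iff by fastforce
qed

lemma laurent_degree_const: "laurent_degree (Poly_Mapping.single 0 c) \<le> D"
  by (auto simp: laurent_degree_le_iff weight_def split: if_splits)

lemma generated_algebra_diff:
  assumes "f \<in> generated_algebra G" "g \<in> generated_algebra G"
  shows "f - g \<in> generated_algebra G"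
proof -
  have "Poly_Mapping.single 0 (-1) * g = - g"
    by (rule poly_mapping_eqI) (simp add: lookup_const_mult)
  then have "f - g = f + Poly_Mapping.single 0 (-1) * g" by simp
  also have "\<dots> \<in> generated_algebra G" 
    using assms by (intro generated_algebra.add generated_algebra.mult generated_algebra.const)
  finally show ?thesis .
qed

lemma ec_in_generated_algebra:
  assumes "finite A" "y ` A \<subseteq> G"
  shows "ec A k y \<in> generated_algebra G"
  using assms
proof (induction A arbitrary: k rule: finite_induct)
  case empty
  have "Poly_Mapping.single 0 1 \<in> generated_algebra G" "Poly_Mapping.single 0 0 \<in> generated_algebra G"
    by (rule generated_algebra.const)+
  then show ?case by (cases k) (auto simp: ec_def)
next
  case (insert i A)
  have "Poly_Mapping.single 0 1 \<in> generated_algebra G" by (rule generated_algebra.const)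
  moreover have "y i * ec A l y \<in> generated_algebra G" for l
    using insert by (intro generated_algebra.mult generated_algebra.gen[of "y i"]) auto
  ultimately show ?case using insert
    by (cases k) (auto simp: ec_insert intro!: generated_algebra_diff)
qed

lemma laurent_degree_ec:
  fixes y :: "'i \<Rightarrow> 'a::comm_ring_1 laurent"
  assumes "finite A" "\<And>i. i \<in> A \<Longrightarrow> laurent_degree (y i) \<le> w"
  shows "laurent_degree (ec A k y) \<le> w * k"
  using assms
proof (induction A arbitrary: k rule: finite_induct)
  case empty
  then show ?case
    using laurent_degree_const[of "1::'a" "w * k"] laurent_degree_const[of "0::'a" "w * k"]
    by (cases k) (auto simp: ec_def)
next
  case (insert i A)
  show ?case
  proof (cases k)
    case 0
    then show ?thesis using laurent_degree_const[of "1::'a" 0] by simp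
  next
    case (Suc l)
    have "laurent_degree (y i * ec A l y) \<le> w * k"
      using insert Suc by (intro laurent_degree_mult[of _ w _ "w * l"]) auto
    moreover have "laurent_degree (- (y i * ec A l y)) = laurent_degree (y i * ec A l y)"
      by (simp add: laurent_degree_def)
    ultimately have "laurent_degree (ec A (Suc l) y + - (y i * ec A l y)) \<le> w * k"
      using insert.IH[of "Suc l"] insert Suc by (intro laurent_degree_add) auto
    then show ?thesis using insert Suc by (simp add: ec_insert)
  qed
qed

lemma map_key_ec:
  fixes y :: "'i \<Rightarrow> 'a::comm_ring_1 laurent" and s :: "(nat \<Rightarrow>\<^sub>0 int) \<Rightarrow> (nat \<Rightarrow>\<^sub>0 int)"
  assumes s: "bij s" "\<And>a b. s (a + b) = s a + s b" and "finite A"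
  shows "Poly_Mapping.map_key s (ec A k y) = ec A k (\<lambda>i. Poly_Mapping.map_key s (y i))"
  using assms(3)
proof (induction A arbitrary: k rule: finite_induct)
  case empty
  have "s 0 = 0" using s(2)[of 0 0] by simp
  from map_key_one[OF bij_is_inj[OF s(1)] this] show ?case
    using bij_is_inj[OF s(1)] by (cases k) (auto simp: ec_def)
next
  case (insert i A)
  have "s 0 = 0" using s(2)[of 0 0] by simp
  note one = map_key_one[OF bij_is_inj[OF s(1)] this]
  have "Poly_Mapping.map_key s (f - g) = Poly_Mapping.map_key s f - Poly_Mapping.map_key s g" for f g :: "'a laurent"
    using bij_is_inj[OF s(1)] by (intro poly_mapping_eqI) (simp add: map_key.rep_eq lookup_minus)
  then show ?case
    using insert one by (cases k) (auto simp: ec_insert map_key_mult[OF s])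
qed

lemma ec_permute:
  assumes "p permutes A"
  shows "ec A k (\<lambda>i. y (p i)) = ec A k y"
  unfolding ec_def using prod.permute[OF assms, of "\<lambda>i. [:1, - y i:]"] by (simp add: comp_def)

text \<open>The permutation is chosen to minimise the sum of all \<open>i * b (p i)\<close>;
  exchanging two entries in the wrong order would lower it.\<close>

lemma sort_permutation:
  fixes b :: "nat \<Rightarrow> nat"
  assumes b: "\<And>i. i \<notin> {1..n} \<Longrightarrow> b i = 0"
  obtains p where "p permutes {1..n}" "b \<circ> p \<in> partitions n"
proof -
  define S where "S p = (\<Sum>i\<in>{1..n}. i * b (p i))" for p :: "nat \<Rightarrow> nat"
  have "finite {p. p permutes {1..n}}" by (rule finite_permutations) simp
  moreover have "{p. p permutes {1..n}} \<noteq> {}" using permutes_id[of "{1..n}"] by blast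
  ultimately obtain p where p: "p permutes {1..n}" and min: "\<And>q. q permutes {1..n} \<Longrightarrow> S p \<le> S q"
    using ex_min_if_finite[of "S ` {p. p permutes {1..n}}"]
    by (metis (no_types, lifting) finite_imageI image_iff image_is_empty mem_Collect_eq not_less)
  have "b \<circ> p \<in> partitions n"
  proof (rule partitionsI)
    fix i j assume ij: "1 \<le> i" "i \<le> j" "j \<le> n"
    show "(b \<circ> p) j \<le> (b \<circ> p) i"
    proof (rule ccontr)
      assume "\<not> ?thesis"
      then have lt: "b (p i) < b (p j)" by simp
      then have "i < j" using ij by (cases "i = j") auto
      define q where "q = p \<circ> transpose i j"
      have q: "q permutes {1..n}"
        unfolding q_def using ij by (intro permutes_compose permutes_swap_id p) auto
      have split: "S r = i * b (r i) + (j * b (r j) + (\<Sum>k\<in>{1..n} - {i, j}. k * b (r k)))" for r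
      proof -
        have "{1..n} = insert i (insert j ({1..n} - {i, j}))" using ij by auto
        then have "S r = (\<Sum>k\<in>insert i (insert j ({1..n} - {i, j})). k * b (r k))" 
          unfolding S_def by metis
        then show ?thesis using \<open>i < j\<close> by simp
      qed
      have "(\<Sum>k\<in>{1..n} - {i, j}. k * b (q k)) = (\<Sum>k\<in>{1..n} - {i, j}. k * b (p k))"
        by (intro sum.cong) (auto simp: q_def transpose_def)
      then have "S q = i * b (p j) + (j * b (p i) + (\<Sum>k\<in>{1..n} - {i, j}. k * b (p k)))"
        unfolding split[of q] by (simp add: q_def)
      moreover have "i * b (p j) + j * b (p i) < i * b (p i) + j * b (p j)"
      proof -
        obtain d where "b (p j) = b (p i) + d" "d > 0" using lt less_imp_add_positive[OF lt] by metis
        moreover have "i * d < j * d" using \<open>i < j\<close> \<open>d > 0\<close> by simp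
        ultimately show ?thesis by (simp only: distrib_left)
      qed
      ultimately have "S q < S p" using split[of p] by linarith
      then show False using min[OF q] by simp
    qed
  next
    fix i assume "i = 0 \<or> i > n"
    then have "i \<notin> {1..n}" by auto
    then show "(b \<circ> p) i = 0" using permutes_not_in[OF p] b by simp
  qed
  then show ?thesis using that p by blast
qed

section \<open>Tools for the dimension count\<close>

lemma finite_partitions_le: "finite {lam \<in> partitions n. psize n lam \<le> d}"
proof (rule finite_subset)
  show "{lam \<in> partitions n. psize n lam \<le> d} \<subseteq>
     {f. \<forall>i. (i \<in> {1..n} \<longrightarrow> f i \<in> {0..d}) \<and> (i \<notin> {1..n} \<longrightarrow> f i = 0)}"
  proof safe
    fix lam i assume a: "lam \<in> partitions n" "psize n lam \<le> d" "i \<in> {1..n}"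
    have "lam i \<le> psize n lam" unfolding psize_def by (rule member_le_sum) (use a in auto)
    then show "lam i \<in> {0..d}" using a by simp
  next
    fix lam i assume "lam \<in> partitions n" "i \<notin> {1..n}"
    then show "lam i = 0" by (intro partitionsD(2)) auto
  qed
  show "finite {f. \<forall>i. (i \<in> {1..n} \<longrightarrow> f i \<in> {0..d}) \<and> (i \<notin> {1..n} \<longrightarrow> f i = (0::nat))}"
    by (rule finite_set_of_finite_funs) auto
qed

text \<open>Gaussian elimination: each equation costs at most one unknown, the pivot
  \<open>p\<close>, so with more unknowns than equations one stays free.\<close>

lemma linear_dependence:
  fixes a :: "'s \<Rightarrow> 't \<Rightarrow> 'a::field"
  assumes "finite T" "finite S" "card T < card S"
  shows "\<exists>x. (\<exists>s\<in>S. x s \<noteq> 0) \<and> (\<forall>t\<in>T. (\<Sum>s\<in>S. x s * a s t) = 0)"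
  using assms
proof (induction T arbitrary: S a rule: finite_induct)
  case empty
  then obtain s where "s \<in> S" by fastforce
  then show ?case by (intro exI[of _ "\<lambda>_. 1"]) auto
next
  case (insert t T)
  show ?case
  proof (cases "\<forall>s\<in>S. a s t = 0")
    case True
    have "card T < card S" using insert by simp
    from insert.IH[OF insert.prems(1) this, of a] obtain x where
      "\<exists>s\<in>S. x s \<noteq> 0" "\<forall>t\<in>T. (\<Sum>s\<in>S. x s * a s t) = 0" by blast
    then show ?thesis using True by (intro exI[of _ x]) auto
  next
    case False
    then obtain p where p: "p \<in> S" "a p t \<noteq> 0" by blast
    define a' where "a' s u = a s u - a s t / a p t * a p u" for s u
    have "card T < card (S - {p})" using insert p by simp
    from insert.IH[OF _ this, of a'] insert.prems obtain x where
      x: "\<exists>s\<in>S - {p}. x s \<noteq> 0" "\<And>u. u \<in> T \<Longrightarrow> (\<Sum>s\<in>S - {p}. x s * a' s u) = 0" by auto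
    define z where "z = - (\<Sum>s\<in>S - {p}. x s * a s t) / a p t"
    have sum: "(\<Sum>s\<in>S. (x(p := z)) s * a s u) = z * a p u + (\<Sum>s\<in>S - {p}. x s * a s u)" for u
      using p insert.prems by (subst sum.remove[of _ p]) (auto intro!: sum.cong)
    have "(\<Sum>s\<in>S. (x(p := z)) s * a s u) = 0" if "u \<in> insert t T" for u
    proof (cases "u = t")
      case True
      then show ?thesis unfolding sum using p by (simp add: z_def)
    next
      case False
      have "z * a p u + (\<Sum>s\<in>S - {p}. x s * a s u) = (\<Sum>s\<in>S - {p}. x s * a' s u)"
        unfolding z_def a'_def
        by (simp add: right_diff_distrib sum_subtractf sum_divide_distrib sum_distrib_right sum_distrib_left mult_ac)
      then show ?thesis unfolding sum using x(2) False that by auto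
    qed
    moreover have "\<exists>s\<in>S. (x(p := z)) s \<noteq> 0" using x(1) by auto
    ultimately show ?thesis by blast
  qed
qed

definition expo :: "nat \<Rightarrow> nat \<Rightarrow> (nat \<Rightarrow> nat) \<Rightarrow> nat \<Rightarrow>\<^sub>0 int" where
  "expo n w b = (\<Sum>i\<in>{1..n}. Poly_Mapping.single i (int (w * b i)))"

lemma lookup_expo: "lookup (expo n w b) i = (if i \<in> {1..n} then int (w * b i) else 0)"
proof -
  have "lookup (expo n w b) i = (\<Sum>k\<in>{1..n}. if k = i then int (w * b i) else 0)"
    unfolding expo_def lookup_sum by (intro sum.cong) (auto simp: lookup_single when_def)
  then show ?thesis by simp
qed

definition interpolates :: "nat \<Rightarrow> ((nat \<Rightarrow> nat) \<Rightarrow> 'p) \<Rightarrow> (nat \<Rightarrow> nat) \<Rightarrow> ('p \<Rightarrow> 'a::zero_neq_one) \<Rightarrow> bool" where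
  "interpolates n pt mu f \<longleftrightarrow> (\<forall>lam\<in>partitions n. psize n lam \<le> psize n mu \<longrightarrow> f (pt lam) = (if lam = mu then 1 else 0))"

text \<open>The generator \<open>y i\<close> is \<open>\<phi>\<close> of the i-th variable and has
  degree at most \<open>w\<close>. By \<open>dominant\<close> every monomial of an element has a
  companion of the same weight whose exponents are nonnegative multiples of \<open>w\<close>;
  symmetry then sorts these into a partition. \<open>pt_ok\<close> selects points at which all
  occurring exponents can be evaluated.\<close>

locale laurent_family =
  fixes n :: nat and y :: "nat \<Rightarrow> 'a::field laurent" and w :: nat and \<phi> :: "'a \<Rightarrow> 'a"
    and pt_ok :: "(nat \<Rightarrow> 'a) \<Rightarrow> bool"
  assumes w_pos: "w \<ge> 1"
    and degree_gen: "\<And>i. i \<in> {1..n} \<Longrightarrow> laurent_degree (y i) \<le> w"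
    and permute_gen: "\<And>p i. p permutes {1..n} \<Longrightarrow> Poly_Mapping.map_key (Poly_Mapping.map_key p) (y i) = y (p i)"
    and dominant: "\<And>f \<alpha>. f \<in> generated_algebra (y ` {1..n}) \<Longrightarrow> \<alpha> \<in> keys f \<Longrightarrow>
       \<exists>b. (\<forall>i. i \<notin> {1..n} \<longrightarrow> b i = 0) \<and> w * psize n b = weight \<alpha> \<and> expo n w b \<in> keys f"
    and keys_ok: "\<And>f \<alpha> x. f \<in> generated_algebra (y ` {1..n}) \<Longrightarrow> \<alpha> \<in> keys f \<Longrightarrow> pt_ok x \<Longrightarrow> monomial_ok x \<alpha>"
    and eval_gen: "\<And>i x. i \<in> {1..n} \<Longrightarrow> pt_ok x \<Longrightarrow> laurent_eval (y i) x = \<phi> (x i)"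
begin

abbreviation "Lam \<equiv> symmetric_algebra n y"

lemma eval_mult:
  assumes "f \<in> generated_algebra (y ` {1..n})" "g \<in> generated_algebra (y ` {1..n})" "pt_ok x"
  shows "laurent_eval (f * g) x = laurent_eval f x * laurent_eval g x"
  using keys_ok assms by (intro laurent_eval_mult) blast+

lemma eval_ec:
  assumes "pt_ok x" "A \<subseteq> {1..n}"
  shows "laurent_eval (ec A k y) x = ec A k (\<lambda>i. \<phi> (x i))"
proof -
  have "finite A" using assms(2) finite_subset by blast
  then show ?thesis using assms(2)
  proof (induction A arbitrary: k rule: finite_induct)
    case empty
    have "laurent_eval 1 x = 1" using laurent_eval_single[of 0 1 x] by (simp add: monomial_value_0)
    then show ?case by (cases k) (auto simp: ec_def laurent_eval_zero)
  next
    case (insert i A)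
    have one: "laurent_eval 1 x = 1" using laurent_eval_single[of 0 1 x] by (simp add: monomial_value_0)
    have "laurent_eval (ec A (Suc l) y - y i * ec A l y) x = ec A (Suc l) (\<lambda>i. \<phi> (x i)) - \<phi> (x i) * ec A l (\<lambda>i. \<phi> (x i))" for l
    proof -
      have "laurent_eval (ec A (Suc l) y - y i * ec A l y) x + laurent_eval (y i * ec A l y) x = laurent_eval (ec A (Suc l) y) x"
        by (subst laurent_eval_add[symmetric]) simp
      moreover have "laurent_eval (y i * ec A l y) x = \<phi> (x i) * ec A l (\<lambda>i. \<phi> (x i))"
      proof -
        have "y i \<in> generated_algebra (y ` {1..n})" using insert by (intro generated_algebra.gen) auto
        moreover have "ec A l y \<in> generated_algebra (y ` {1..n})"
          using insert by (intro ec_in_generated_algebra) auto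
        ultimately show ?thesis using insert assms by (simp add: eval_mult eval_gen)
      qed
      ultimately show ?thesis using insert by (simp add: eq_diff_eq)
    qed
    then show ?case using insert by (cases k) (auto simp: ec_insert one)
  qed
qed

lemma Lam_ec: "ec {1..n} k y \<in> Lam"
  unfolding symmetric_algebra_def symmetric_iff_map_key
proof (intro CollectI conjI allI impI)
  show "ec {1..n} k y \<in> generated_algebra (y ` {1..n})" by (rule ec_in_generated_algebra) auto
next
  fix p assume p: "p permutes {1..n}"
  have "Poly_Mapping.map_key (Poly_Mapping.map_key p) (ec {1..n} k y) =
      ec {1..n} k (\<lambda>i. Poly_Mapping.map_key (Poly_Mapping.map_key p) (y i))"
    by (intro map_key_ec bij_map_key_permutes[OF p] map_key_plus permutes_inj[OF p]) auto
  also have "\<dots> = ec {1..n} k (\<lambda>i. y (p i))" by (simp only: permute_gen[OF p])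
  also have "\<dots> = ec {1..n} k y" by (rule ec_permute[OF p])
  finally show "Poly_Mapping.map_key (Poly_Mapping.map_key p) (ec {1..n} k y) = ec {1..n} k y" .
qed

lemma Lam_const: "Poly_Mapping.single 0 a \<in> Lam"
  by (auto simp: symmetric_algebra_def symmetric_const generated_algebra.const)

lemma Lam_add: "f \<in> Lam \<Longrightarrow> g \<in> Lam \<Longrightarrow> f + g \<in> Lam"
  by (auto simp: symmetric_algebra_def symmetric_add generated_algebra.add)

lemma Lam_mult: "f \<in> Lam \<Longrightarrow> g \<in> Lam \<Longrightarrow> f * g \<in> Lam"
  by (auto simp: symmetric_algebra_def symmetric_mult generated_algebra.mult)

lemma eval_Lam_mult:
  "f \<in> Lam \<Longrightarrow> g \<in> Lam \<Longrightarrow> pt_ok x \<Longrightarrow> laurent_eval (f * g) x = laurent_eval f x * laurent_eval g x"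
  by (rule eval_mult) (auto simp: symmetric_algebra_def)

lemma realize:
  assumes "sympoly n d f"
  shows "\<exists>h\<in>Lam. laurent_degree h \<le> w * d \<and> (\<forall>x. pt_ok x \<longrightarrow> laurent_eval h x = f (\<lambda>i. \<phi> (x i)))"
  using assms
proof (induction rule: sympoly.induct)
  case (const d c)
  show ?case
    by (intro bexI[of _ "Poly_Mapping.single 0 c"])
       (auto simp: Lam_const laurent_degree_const laurent_eval_single monomial_value_0)
next
  case (elem k d)
  have "laurent_degree (ec {1..n} k y) \<le> w * k" by (intro laurent_degree_ec degree_gen) auto
  also have "\<dots> \<le> w * d" using elem by simp
  finally show ?case by (intro bexI[of _ "ec {1..n} k y"]) (auto simp: Lam_ec eval_ec)
next
  case (add d f g)
  then obtain F G where "F \<in> Lam" "laurent_degree F \<le> w * d" "\<forall>x. pt_ok x \<longrightarrow> laurent_eval F x = f (\<lambda>i. \<phi> (x i))"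
    "G \<in> Lam" "laurent_degree G \<le> w * d" "\<forall>x. pt_ok x \<longrightarrow> laurent_eval G x = g (\<lambda>i. \<phi> (x i))"
    by blast
  then show ?case by (intro bexI[of _ "F + G"]) (auto simp: laurent_degree_add laurent_eval_add Lam_add)
next
  case (mult d f e g)
  then obtain F G where "F \<in> Lam" "laurent_degree F \<le> w * d" "\<forall>x. pt_ok x \<longrightarrow> laurent_eval F x = f (\<lambda>i. \<phi> (x i))"
    "G \<in> Lam" "laurent_degree G \<le> w * e" "\<forall>x. pt_ok x \<longrightarrow> laurent_eval G x = g (\<lambda>i. \<phi> (x i))"
    by blast
  then show ?case
    by (intro bexI[of _ "F * G"] conjI laurent_degree_mult[of F "w * d" G "w * e"])
       (auto simp: eval_Lam_mult Lam_mult distrib_left)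
qed

text \<open>By \<open>dominant\<close> and sorting, any nonzero coefficient leads to a nonzero one
  at a partition of size at most \<open>d\<close>. The elements of degree at most
  \<open>w * d\<close> therefore span a space whose dimension is at most the number of these
  partitions.\<close>

lemma dominant_coeffs_inj:
  assumes f: "f \<in> Lam" and deg: "laurent_degree f \<le> w * d"
    and zero: "\<And>lam. lam \<in> partitions n \<Longrightarrow> psize n lam \<le> d \<Longrightarrow> lookup f (expo n w lam) = 0"
  shows "f = 0"
proof (rule ccontr)
  assume "f \<noteq> 0"
  then obtain \<alpha> where \<alpha>: "\<alpha> \<in> keys f" by (metis all_not_in_conv keys_eq_empty)
  obtain b where b: "\<And>i. i \<notin> {1..n} \<Longrightarrow> b i = 0" "w * psize n b = weight \<alpha>" "expo n w b \<in> keys f"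
    using dominant[OF _ \<alpha>] f by (auto simp: symmetric_algebra_def)
  obtain p where p: "p permutes {1..n}" "b \<circ> p \<in> partitions n" using sort_permutation[of n b] b(1) by blast
  have "psize n (b \<circ> p) = psize n b"
    unfolding psize_def using sum.permute[OF p(1), of b] by (simp add: comp_def)
  moreover have "w * psize n b \<le> w * d"
    using deg \<alpha> b(2) by (auto simp: laurent_degree_le_iff)
  ultimately have "psize n (b \<circ> p) \<le> d" using w_pos by simp
  moreover have "Poly_Mapping.map_key p (expo n w b) = expo n w (b \<circ> p)"
    using permutes_in_image[OF p(1)]
    by (intro poly_mapping_eqI) (simp add: map_key.rep_eq[OF permutes_inj[OF p(1)]] lookup_expo)
  then have "lookup f (expo n w (b \<circ> p)) = lookup f (expo n w b)"
    using f p(1) unfolding symmetric_algebra_def symmetric_def by (metis (mono_tags, lifting) mem_Collect_eq)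
  ultimately show False using zero[OF p(2)] b(3) by (simp add: in_keys_iff)
qed

text \<open>Dimension count: the coefficients at the dominant exponents embed the space of elements of
  bounded degree into a space whose dimension is the number of interpolation points, and evaluation
  at these points is surjective by \<open>interpolation_exists\<close>.\<close>

lemma vanishing_unique:
  assumes dist: "distinct_grid c"
    and bar: "\<And>lam i. lam \<in> partitions n \<Longrightarrow> i \<in> {1..n} \<Longrightarrow> \<phi> (bar lam i) = grid_point n c lam i"
    and ok: "\<And>lam. lam \<in> partitions n \<Longrightarrow> pt_ok (bar lam)"
    and h: "h \<in> Lam" "laurent_degree h \<le> w * d"
    and zero: "\<And>lam. lam \<in> partitions n \<Longrightarrow> psize n lam \<le> d \<Longrightarrow> laurent_eval h (bar lam) = 0"
  shows "h = 0"
proof -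
  let ?P = "{lam \<in> partitions n. psize n lam \<le> d}"
  define delta where "delta mu g \<longleftrightarrow> g \<in> Lam \<and> laurent_degree g \<le> w * d \<and> 
     (\<forall>lam\<in>?P. laurent_eval g (bar lam) = (if lam = mu then 1 else 0))" for mu g
  have "\<forall>mu. \<exists>g. delta mu g"
  proof
    fix mu
    obtain f where f: "sympoly n d f"
      "\<And>lam. lam\<in>partitions n \<Longrightarrow> psize n lam \<le> d \<Longrightarrow> f (grid_point n c lam) = (if lam = mu then 1 else 0)"
      using interpolation_exists[OF dist, of n d "\<lambda>lam. if lam = mu then 1 else 0"] by blast
    obtain g where g: "g \<in> Lam" "laurent_degree g \<le> w * d" "\<And>x. pt_ok x \<Longrightarrow> laurent_eval g x = f (\<lambda>i. \<phi> (x i))"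
      using realize[OF f(1)] by blast
    have "laurent_eval g (bar lam) = (if lam = mu then 1 else 0)" if "lam \<in> ?P" for lam
      using that g(3)[OF ok, of lam] f(2)[of lam] bar[of lam]
        sympoly_cong[OF f(1), of "\<lambda>i. \<phi> (bar lam i)" "grid_point n c lam"] by simp
    then show "\<exists>g. delta mu g" using g unfolding delta_def by blast
  qed
  then obtain G where "\<forall>mu. delta mu (G mu)" unfolding choice_iff by blast
  then have G: "\<And>mu. G mu \<in> Lam" "\<And>mu. laurent_degree (G mu) \<le> w * d"
     "\<And>mu lam. lam \<in> ?P \<Longrightarrow> laurent_eval (G mu) (bar lam) = (if lam = mu then 1 else 0)"
    unfolding delta_def by blast+
  \<comment> \<open>One vector more than there are coefficients: \<open>h\<close> sits at
    \<open>None\<close>, the functions dual to the interpolation points at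
    \<open>Some mu\<close>.\<close>
  define S where "S = insert None (Some ` ?P)"
  define F where "F s = (case s of None \<Rightarrow> h | Some mu \<Rightarrow> G mu)" for s
  have F: "F s \<in> Lam" "laurent_degree (F s) \<le> w * d" for s
    using h G by (auto simp: F_def split: option.split)
  have "card S = Suc (card ?P)"
    unfolding S_def using finite_partitions_le by (subst card_insert_disjoint) (auto simp: card_image)
  moreover have "finite S" unfolding S_def using finite_partitions_le by auto
  ultimately obtain x where x: "\<exists>s\<in>S. x s \<noteq> 0"
    "\<And>lam. lam \<in> ?P \<Longrightarrow> (\<Sum>s\<in>S. x s * lookup (F s) (expo n w lam)) = 0"
    using linear_dependence[OF finite_partitions_le, of S n d "\<lambda>s lam. lookup (F s) (expo n w lam)"] by auto
  define H where "H = (\<Sum>s\<in>S. Poly_Mapping.single 0 (x s) * F s)"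
  have "H \<in> Lam \<and> laurent_degree H \<le> w * d"
    unfolding H_def using \<open>finite S\<close>
  proof (induction S rule: finite_induct)
    case empty
    then show ?case using Lam_const[of 0] laurent_degree_const[of "0::'a" "w * d"] by simp
  next
    case (insert s S)
    have "laurent_degree (Poly_Mapping.single 0 (x s) * F s) \<le> w * d"
      by (rule laurent_degree_mult[OF laurent_degree_const[of _ 0] F(2)]) simp
    then show ?case
      using insert F[of s] by (simp add: Lam_add Lam_mult Lam_const laurent_degree_add)
  qed
  moreover have "lookup H (expo n w lam) = 0" if "lam \<in> ?P" for lam
    using x(2)[OF that] by (simp add: H_def lookup_sum lookup_const_mult)
  ultimately have "H = 0" using dominant_coeffs_inj[of H d] by blast
  have evH: "laurent_eval H (bar lam) = (\<Sum>s\<in>S. x s * laurent_eval (F s) (bar lam))" if "lam \<in> ?P" for lam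
    using that ok F by (simp add: H_def laurent_eval_sum eval_Lam_mult Lam_const laurent_eval_single monomial_value_0)
  \<comment> \<open>Evaluating the relation at \<open>mu\<close> isolates the coefficient of
    \<open>G mu\<close>, since \<open>h\<close> vanishes there. What remains of the relation is a
    nonzero multiple of \<open>h\<close>.\<close>
  have xSome: "x (Some mu) = 0" if mu: "mu \<in> ?P" for mu
  proof -
    have "0 = (\<Sum>s\<in>S. x s * laurent_eval (F s) (bar mu))"
      using evH[OF mu] \<open>H = 0\<close> by (simp add: laurent_eval_zero)
    also have "\<dots> = (\<Sum>s\<in>S. if s = Some mu then x (Some mu) else 0)"
      using G(3)[OF mu] zero mu by (intro sum.cong) (auto simp: F_def S_def split: option.split)
    also have "\<dots> = x (Some mu)" using \<open>finite S\<close> mu by (simp add: S_def)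
    finally show ?thesis by simp
  qed
  then have "x None \<noteq> 0" using x(1) by (auto simp: S_def)
  have "H = Poly_Mapping.single 0 (x None) * h + (\<Sum>s\<in>Some ` ?P. Poly_Mapping.single 0 (x s) * F s)"
    unfolding H_def S_def using finite_partitions_le by (subst sum.insert) (auto simp: F_def)
  also have "(\<Sum>s\<in>Some ` ?P. Poly_Mapping.single 0 (x s) * F s) = 0"
    using xSome by (intro sum.neutral) auto
  finally have "lookup H \<alpha> = x None * lookup h \<alpha>" for \<alpha>
    by (simp only: add_0_right lookup_const_mult)
  then have "x None * lookup h \<alpha> = 0" for \<alpha>
    using \<open>H = 0\<close> by (metis lookup_zero)
  then show "h = 0" using \<open>x None \<noteq> 0\<close> by (intro poly_mapping_eqI) simp
qed

text \<open>Makes the definite description accessible: \<open>realize\<close> supplies a Laurent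
  polynomial with the values of \<open>f\<close>, and \<open>vanishing_unique\<close> applied to a
  difference shows that there is no other.\<close>

theorem interpolation_binomial_eq:
  assumes dist: "distinct_grid c"
    and bar: "\<And>lam i. lam \<in> partitions n \<Longrightarrow> i \<in> {1..n} \<Longrightarrow> \<phi> (bar lam i) = grid_point n c lam i"
    and ok: "\<And>lam. lam \<in> partitions n \<Longrightarrow> pt_ok (bar lam)"
    and f: "sympoly n (psize n mu) f" "interpolates n (grid_point n c) mu f"
    and lam: "lam \<in> partitions n"
  shows "interpolation_binomial n y w bar lam mu = f (grid_point n c lam)"
proof -
  obtain h where h: "h \<in> Lam" "laurent_degree h \<le> w * psize n mu" "\<And>x. pt_ok x \<Longrightarrow> laurent_eval h x = f (\<lambda>i. \<phi> (x i))"
    using realize[OF f(1)] by blast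
  have ev: "laurent_eval h (bar lam) = f (grid_point n c lam)" if "lam \<in> partitions n" for lam
    using that h(3)[OF ok, of lam] bar[of lam]
      sympoly_cong[OF f(1), of "\<lambda>i. \<phi> (bar lam i)" "grid_point n c lam"] by simp
  have "interpolation_poly n y w bar mu = h"
    unfolding interpolation_poly_def
  proof (rule the_equality)
    show "h \<in> Lam \<and> laurent_degree h \<le> w * psize n mu \<and>
      (\<forall>lam\<in>partitions n. psize n lam \<le> psize n mu \<longrightarrow> laurent_eval h (bar lam) = (if lam = mu then 1 else 0))"
      using h f(2) ev by (auto simp: interpolates_def)
  next
    fix g assume g: "g \<in> Lam \<and> laurent_degree g \<le> w * psize n mu \<and>
      (\<forall>lam\<in>partitions n. psize n lam \<le> psize n mu \<longrightarrow> laurent_eval g (bar lam) = (if lam = mu then 1 else 0))"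
    have neg: "g - h = g + Poly_Mapping.single 0 (-1) * h"
      by (rule poly_mapping_eqI) (simp add: lookup_const_mult lookup_minus lookup_add)
    have "g - h = 0"
    proof (rule vanishing_unique[OF dist bar ok])
      show "g - h \<in> Lam" unfolding neg using g h by (intro Lam_add Lam_mult Lam_const) auto
      show "laurent_degree (g - h) \<le> w * psize n mu"
        unfolding neg using g h
        by (intro laurent_degree_add laurent_degree_mult[of _ 0 _ "w * psize n mu"] laurent_degree_const) auto
    next
      fix lam assume lam: "lam \<in> partitions n" "psize n lam \<le> psize n mu"
      have "laurent_eval (g - h) (bar lam) = laurent_eval g (bar lam) - laurent_eval h (bar lam)"
        unfolding neg using g h ok[OF lam(1)]
        by (simp add: laurent_eval_add eval_Lam_mult Lam_const laurent_eval_single monomial_value_0)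
      then show "laurent_eval (g - h) (bar lam) = 0"
        using g lam f(2) ev[OF lam(1)] by (simp add: interpolates_def)
    qed auto
    then show "g = h" by simp
  qed
  then show ?thesis using ev[OF lam] by (simp add: interpolation_binomial_def)
qed

end

section \<open>The algebras generated by x_i, by x_i^2 and by x_i + 1/x_i\<close>

lemma keys_generated_algebra:
  assumes "f \<in> generated_algebra G" "\<And>g. g \<in> G \<Longrightarrow> keys g \<subseteq> M" "0 \<in> M" "\<And>a b. a \<in> M \<Longrightarrow> b \<in> M \<Longrightarrow> a + b \<in> M"
  shows "keys f \<subseteq> M"
  using assms(1)
proof (induction rule: generated_algebra.induct)
  case (add f g)
  then show ?case using Poly_Mapping.keys_add[of f g] by blast
next
  case (mult f g)
  then show ?case using keys_mult[of f g] assms(4) by blast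
qed (use assms in auto)

lemma map_key_permutes_single:
  "p permutes S \<Longrightarrow> Poly_Mapping.map_key (Poly_Mapping.map_key p) (Poly_Mapping.single (Poly_Mapping.single i (k::int)) (v::'a::zero))
     = Poly_Mapping.single (Poly_Mapping.single (p i) k) v"
  using map_key_single[OF bij_is_inj[OF bij_map_key_permutes], of p S "Poly_Mapping.single (p i) k" v]
    map_key_single[OF permutes_inj, of p S i k] by metis

lemma weight_single: "weight (Poly_Mapping.single i k) = nat \<bar>k\<bar>"
  by (auto simp: weight_def)

lemma monomial_value_single: "monomial_value x (Poly_Mapping.single i k) = x i powi k"
  by (auto simp: monomial_value_def)

definition nonneg_exponents :: "nat \<Rightarrow> nat \<Rightarrow> (nat \<Rightarrow>\<^sub>0 int) set" where
  "nonneg_exponents n w = {\<alpha>. (\<forall>i. i \<notin> {1..n} \<longrightarrow> lookup \<alpha> i = 0) \<and> (\<forall>i. 0 \<le> lookup \<alpha> i \<and> int w dvd lookup \<alpha> i)}"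

lemma nonneg_exponents_dominant:
  assumes "\<alpha> \<in> nonneg_exponents n w" "w \<ge> 1"
  shows "\<exists>b. (\<forall>i. i \<notin> {1..n} \<longrightarrow> b i = 0) \<and> w * psize n b = weight \<alpha> \<and> expo n w b = \<alpha>"
proof -
  define b where "b i = nat (lookup \<alpha> i div int w)" for i
  have b: "int (w * b i) = lookup \<alpha> i" for i
    using assms unfolding b_def nonneg_exponents_def by (auto simp: pos_imp_zdiv_nonneg_iff)
  then have b': "w * b i = nat \<bar>lookup \<alpha> i\<bar>" for i by (metis abs_of_nat nat_int)
  have "expo n w b = \<alpha>"
    using assms b by (intro poly_mapping_eqI) (auto simp: lookup_expo nonneg_exponents_def)
  moreover have "keys \<alpha> \<subseteq> {1..n}"
    using assms(1) by (auto simp: nonneg_exponents_def in_keys_iff)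
  then have "w * psize n b = weight \<alpha>"
    by (subst weight_superset[of "{1..n}"]) (auto simp: psize_def sum_distrib_left b')
  moreover have "b i = 0" if "i \<notin> {1..n}" for i
    using assms(1) that by (auto simp: b_def nonneg_exponents_def)
  ultimately show ?thesis by blast
qed

lemma laurent_family_nonneg:
  fixes y :: "nat \<Rightarrow> 'a::field laurent"
  assumes y: "\<And>i. y i = Poly_Mapping.single (Poly_Mapping.single i (int w)) 1" and w: "w \<ge> 1"
  shows "laurent_family n y w (\<lambda>x. x ^ w) (\<lambda>_. True)"
proof
  fix i
  show "laurent_degree (y i) \<le> w"
    by (simp add: laurent_degree_le_iff y weight_single)
  show "Poly_Mapping.map_key (Poly_Mapping.map_key p) (y i) = y (p i)" if "p permutes {1..n}" for p
    unfolding y by (rule map_key_permutes_single[OF that])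
  show "laurent_eval (y i) x = x i ^ w" for x
    by (simp add: y laurent_eval_single monomial_value_single)
next
  fix f \<alpha> assume f: "f \<in> generated_algebra (y ` {1..n})" and \<alpha>: "\<alpha> \<in> keys f"
  have "keys f \<subseteq> nonneg_exponents n w"
  proof (rule keys_generated_algebra[OF f])
    fix g assume "g \<in> y ` {1..n}"
    then show "keys g \<subseteq> nonneg_exponents n w"
      by (auto simp: y nonneg_exponents_def lookup_single when_def)
  qed (auto simp: nonneg_exponents_def lookup_add)
  then have mem: "\<alpha> \<in> nonneg_exponents n w" using \<alpha> by blast
  then show "\<exists>b. (\<forall>i. i \<notin> {1..n} \<longrightarrow> b i = 0) \<and> w * psize n b = weight \<alpha> \<and> expo n w b \<in> keys f"
    using nonneg_exponents_dominant[OF mem w] \<alpha> by metis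
  show "monomial_ok x \<alpha>" for x :: "nat \<Rightarrow> 'a"
    using mem by (auto simp: monomial_ok_def nonneg_exponents_def)
qed (use w in auto)

lemma laurent_family_X: "laurent_family n (X :: nat \<Rightarrow> 'a::field laurent) 1 (\<lambda>x. x) (\<lambda>_. True)"
  using laurent_family_nonneg[of X 1 n] by (simp add: X_def)

lemma laurent_family_X2: "laurent_family n (\<lambda>i. X i ^ 2 :: 'a::field laurent) 2 (\<lambda>x. x ^ 2) (\<lambda>_. True)"
  by (rule laurent_family_nonneg) (simp_all add: X_def power2_eq_square mult_single single_add[symmetric])

text \<open>Pulling back along \<open>flip T\<close> substitutes \<open>1 / x_i\<close> for
  \<open>x_i\<close> with \<open>i\<close> in \<open>T\<close>; the generators
  \<open>x_i + 1 / x_i\<close> are invariant.\<close>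

definition flip :: "nat set \<Rightarrow> (nat \<Rightarrow>\<^sub>0 int) \<Rightarrow> nat \<Rightarrow>\<^sub>0 int" where
  "flip T = Poly_Mapping.mapp (\<lambda>i v. if i \<in> T then - v else v)"

lemma lookup_flip: "lookup (flip T \<alpha>) i = (if i \<in> T then - lookup \<alpha> i else lookup \<alpha> i)"
  by (auto simp: flip_def lookup_mapp when_def in_keys_iff)

lemma flip_add: "flip T (a + b) = flip T a + flip T b"
  by (rule poly_mapping_eqI) (simp add: lookup_flip lookup_add)

lemma bij_flip: "bij (flip T)"
  by (rule o_bij[of "flip T"]) (auto intro!: poly_mapping_eqI simp: fun_eq_iff lookup_flip)

lemma flip_generated_algebra:
  fixes f :: "'a::field laurent"
  assumes "f \<in> generated_algebra ((\<lambda>i. X i + X_inv i) ` {1..n})"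
  shows "Poly_Mapping.map_key (flip T) f = f"
  using assms
proof (induction rule: generated_algebra.induct)
  have inj: "inj (flip T)" using bij_flip by (rule bij_is_inj)
  {
    case (const c)
    have "flip T 0 = 0" by (rule poly_mapping_eqI) (simp add: lookup_flip)
    then show ?case using map_key_single[OF inj, of 0 c] by simp
  next
    case (gen g)
    then obtain i where i: "g = X i + X_inv i" by blast
    have s: "Poly_Mapping.map_key (flip T) (Poly_Mapping.single (Poly_Mapping.single i k) (1::'a))
      = Poly_Mapping.single (Poly_Mapping.single i (if i \<in> T then - k else k)) 1" for k
    proof -
      have "flip T (Poly_Mapping.single i (if i \<in> T then - k else k)) = Poly_Mapping.single i k"
        by (rule poly_mapping_eqI) (auto simp: lookup_flip lookup_single when_def)
      then show ?thesis using map_key_single[OF inj, of "Poly_Mapping.single i (if i \<in> T then - k else k)" "1::'a"] by simp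
    qed
    show ?case unfolding i X_def X_inv_def by (simp add: map_key_plus[OF inj] s)
  next
    case (add f g)
    then show ?case by (simp add: map_key_plus[OF inj])
  next
    case (mult f g)
    then show ?case by (simp add: map_key_mult[OF bij_flip flip_add])
  }
qed

lemma laurent_family_X_inv:
  "laurent_family n (\<lambda>i. X i + X_inv i :: 'a::field laurent) 1 (\<lambda>x. x + inverse x) (\<lambda>x. \<forall>i. x i \<noteq> 0)"
proof
  fix i
  have "keys (X i + X_inv i :: 'a laurent) \<subseteq> {Poly_Mapping.single i 1, Poly_Mapping.single i (-1)}"
    using Poly_Mapping.keys_add[of "X i :: 'a laurent" "X_inv i"] by (auto simp: X_def X_inv_def)
  then show "laurent_degree (X i + X_inv i :: 'a laurent) \<le> 1"
    by (auto simp: laurent_degree_le_iff weight_single)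
  show "Poly_Mapping.map_key (Poly_Mapping.map_key p) (X i + X_inv i) = (X (p i) + X_inv (p i) :: 'a laurent)"
    if "p permutes {1..n}" for p
    unfolding X_def X_inv_def
    by (simp add: map_key_plus[OF bij_is_inj[OF bij_map_key_permutes[OF that]]] map_key_permutes_single[OF that])
  show "laurent_eval (X i + X_inv i) x = x i + inverse (x i)" for x :: "nat \<Rightarrow> 'a"
    by (simp add: X_def X_inv_def laurent_eval_add laurent_eval_single monomial_value_single power_int_minus)
next
  fix f :: "'a laurent" and \<alpha>
  assume f: "f \<in> generated_algebra ((\<lambda>i. X i + X_inv i) ` {1..n})" and \<alpha>: "\<alpha> \<in> keys f"
  define M where "M = {\<alpha> :: nat \<Rightarrow>\<^sub>0 int. \<forall>i. i \<notin> {1..n} \<longrightarrow> lookup \<alpha> i = 0}"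
  have "keys f \<subseteq> M"
  proof (rule keys_generated_algebra[OF f])
    fix g :: "'a laurent" assume "g \<in> (\<lambda>i. X i + X_inv i) ` {1..n}"
    then obtain i where i: "i \<in> {1..n}" "g = X i + X_inv i" by blast
    then show "keys g \<subseteq> M"
      using Poly_Mapping.keys_add[of "X i :: 'a laurent" "X_inv i"]
      by (auto simp: X_def X_inv_def M_def lookup_single when_def)
  qed (auto simp: M_def lookup_add)
  then have M: "\<alpha> \<in> M" using \<alpha> by blast
  \<comment> \<open>Flipping exactly the negative exponents makes all of them nonnegative and
    preserves absolute values, hence the weight.\<close>
  define T where "T = {i. lookup \<alpha> i < 0}"
  have "lookup f (flip T \<alpha>) = lookup (Poly_Mapping.map_key (flip T) f) \<alpha>"
    by (simp add: map_key.rep_eq[OF bij_is_inj[OF bij_flip]])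
  then have "flip T \<alpha> \<in> keys f" using \<alpha> by (simp add: flip_generated_algebra[OF f] in_keys_iff)
  moreover have "flip T \<alpha> \<in> nonneg_exponents n 1"
    using M by (auto simp: nonneg_exponents_def M_def lookup_flip T_def)
  from nonneg_exponents_dominant[OF this] obtain b where b: "\<And>i. i \<notin> {1..n} \<Longrightarrow> b i = 0"
    "1 * psize n b = weight (flip T \<alpha>)" "expo n 1 b = flip T \<alpha>" by auto
  moreover have "weight (flip T \<alpha>) = weight \<alpha>"
  proof -
    have "keys (flip T \<alpha>) = keys \<alpha>" by (auto simp: in_keys_iff lookup_flip split: if_splits)
    then show ?thesis unfolding weight_def by (intro sum.cong) (auto simp: lookup_flip)
  qed
  ultimately show "\<exists>b. (\<forall>i. i \<notin> {1..n} \<longrightarrow> b i = 0) \<and> 1 * psize n b = weight \<alpha> \<and> expo n 1 b \<in> keys f"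
    by (intro exI[of _ b]) auto
  show "monomial_ok x \<alpha>" if "\<forall>i. x i \<noteq> 0" for x :: "nat \<Rightarrow> 'a"
    using that by (auto simp: monomial_ok_def)
qed auto

text \<open>The grid values are taken as points of the ordinary symmetric polynomial algebra, so one
  uniqueness statement serves all four families. The zero holds at every \<open>lam\<close>,
  partition or not.\<close>

lemma sympoly_unique:
  fixes c :: "int \<Rightarrow> int \<Rightarrow> 'a::field"
  assumes dist: "distinct_grid c" and f: "sympoly n d f"
    and zero: "\<And>lam. lam \<in> partitions n \<Longrightarrow> psize n lam \<le> d \<Longrightarrow> f (grid_point n c lam) = 0"
  shows "f (grid_point n c lam) = 0"
proof -
  interpret laurent_family n "X :: nat \<Rightarrow> 'a laurent" 1 "\<lambda>x. x" "\<lambda>_. True"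
    by (rule laurent_family_X)
  obtain h where h: "h \<in> Lam" "laurent_degree h \<le> 1 * d" "\<And>x. laurent_eval h x = f x"
    using realize[OF f] by blast
  have "h = 0"
    by (rule vanishing_unique[OF dist, of "grid_point n c"]) (use h zero in auto)
  then show ?thesis using h(3)[of "grid_point n c lam"] by (simp add: laurent_eval_zero)
qed

definition interp :: "nat \<Rightarrow> (int \<Rightarrow> int \<Rightarrow> 'a::field) \<Rightarrow> (nat \<Rightarrow> nat) \<Rightarrow> (nat \<Rightarrow> 'a) \<Rightarrow> 'a" where
  "interp n c mu = (SOME f. sympoly n (psize n mu) f \<and> interpolates n (grid_point n c) mu f)"

definition binom :: "nat \<Rightarrow> (int \<Rightarrow> int \<Rightarrow> 'a::field) \<Rightarrow> (nat \<Rightarrow> nat) \<Rightarrow> (nat \<Rightarrow> nat) \<Rightarrow> 'a" where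
  "binom n c lam mu = interp n c mu (grid_point n c lam)"

lemma interp:
  assumes "distinct_grid c"
  shows "sympoly n (psize n mu) (interp n c mu)" "interpolates n (grid_point n c) mu (interp n c mu)"
proof -
  have "\<exists>f. sympoly n (psize n mu) f \<and> interpolates n (grid_point n c) mu f"
    unfolding interpolates_def
    using interpolation_exists[OF assms, of n "psize n mu" "\<lambda>lam. if lam = mu then 1 else 0"] by simp
  from someI_ex[OF this] show "sympoly n (psize n mu) (interp n c mu)" "interpolates n (grid_point n c) mu (interp n c mu)"
    unfolding interp_def by auto
qed

lemma binom_delta:
  "distinct_grid c \<Longrightarrow> lam \<in> partitions n \<Longrightarrow> psize n lam \<le> psize n mu \<Longrightarrow> binom n c lam mu = (if lam = mu then 1 else 0)"
  using interp(2)[of c n mu] unfolding binom_def interpolates_def by blast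

lemma (in laurent_family) interpolation_binomial_eq_binom:
  assumes "distinct_grid c"
    and "\<And>lam i. lam \<in> partitions n \<Longrightarrow> i \<in> {1..n} \<Longrightarrow> \<phi> (bar lam i) = grid_point n c lam i"
    and "\<And>lam. lam \<in> partitions n \<Longrightarrow> pt_ok (bar lam)"
    and "lam \<in> partitions n"
  shows "interpolation_binomial n y w bar lam mu = binom n c lam mu"
  unfolding binom_def using assms interp[OF assms(1)] by (intro interpolation_binomial_eq) auto

lemma binom_unique:
  assumes "distinct_grid c" "sympoly n (psize n mu) f" "interpolates n (grid_point n c) mu f"
  shows "f (grid_point n c lam) = binom n c lam mu"
proof -
  have "f (grid_point n c lam) - interp n c mu (grid_point n c lam) = 0"
    by (rule sympoly_unique[OF assms(1) sympoly_diff[OF assms(2) interp(1)[OF assms(1)]]])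
       (use assms(3) interp(2)[OF assms(1), of n mu] in \<open>auto simp: interpolates_def\<close>)
  then show ?thesis by (simp add: binom_def)
qed

text \<open>Stability in the number of rows. At partitions with last part 0 the last coordinate is
  \<open>c 0 0\<close>, and the interpolation polynomial restricts to one in fewer variables with
  the same degree bound. If \<open>mu (Suc n)\<close> is positive, the restriction vanishes at all
  points that this bound tests.\<close>

lemma binom_restrict:
  assumes dist: "distinct_grid c" and lam: "lam \<in> partitions (Suc n)" "lam (Suc n) = 0"
    and mu: "mu \<in> partitions (Suc n)"
  shows "binom (Suc n) c lam mu = (if mu (Suc n) = 0 then binom n (\<lambda>m j. c m (j + 1)) lam mu else 0)"
proof -
  let ?c = "\<lambda>m j. c m (j + 1)"
  have dist': "distinct_grid ?c" using distinct_grid_shift[OF dist, of 0 1] by simp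
  obtain g where g: "sympoly n (psize (Suc n) mu) g" "\<And>y. y (Suc n) = c 0 0 \<Longrightarrow> interp (Suc n) c mu y = g y"
    using sympoly_restrict[OF interp(1)[OF dist, of "Suc n" mu], of "c 0 0"] by blast
  have eq: "g (grid_point n ?c kap) = binom (Suc n) c kap mu" if "kap (Suc n) = 0" for kap
    using g(2)[of "grid_point (Suc n) c kap"] that
    unfolding binom_def grid_point_Suc[symmetric] by (simp add: grid_point_def)
  have val: "g (grid_point n ?c kap) = (if kap = mu then 1 else 0)"
    if kap: "kap \<in> partitions n" "psize n kap \<le> psize (Suc n) mu" for kap
  proof -
    have "kap (Suc n) = 0" using partitionsD(2)[OF kap(1)] by simp
    then show ?thesis
      using kap eq partitions_Suc_zero[of kap n] binom_delta[OF dist, of kap "Suc n" mu] by (simp add: psize_Suc)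
  qed
  show ?thesis
  proof (cases "mu (Suc n) = 0")
    case True
    then have "interpolates n (grid_point n ?c) mu g"
      unfolding interpolates_def using val by (simp add: psize_Suc)
    then show ?thesis
      using binom_unique[OF dist', of n mu g lam] g(1) eq[of lam, OF lam(2)] True by (simp add: psize_Suc)
  next
    case False
    have "g (grid_point n ?c lam) = 0"
    proof (rule sympoly_unique[OF dist' g(1)])
      fix kap assume kap: "kap \<in> partitions n" "psize n kap \<le> psize (Suc n) mu"
      have "kap \<noteq> mu" using partitionsD(2)[OF kap(1), of "Suc n"] False by auto
      then show "g (grid_point n ?c kap) = 0" using val[OF kap] by simp
    qed
    then show ?thesis using eq[of lam, OF lam(2)] False by simp
  qed
qed

section \<open>Positivity in type A\<close>

text \<open>In the last row where \<open>lam\<close> exceeds \<open>mu\<close> a box can be removed: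
  the row below is bounded by \<open>mu\<close> and hence strictly shorter.\<close>

lemma exists_removable:
  assumes lam: "lam \<in> partitions n" and mu: "mu \<in> partitions n" and ex: "k \<in> {1..n}" "mu k < lam k"
  obtains i where "i \<in> {1..n}" "mu i < lam i" "lam(i := lam i - 1) \<in> partitions n"
proof -
  define i where "i = Max {i \<in> {1..n}. mu i < lam i}"
  have i: "i \<in> {1..n}" "mu i < lam i"
  proof -
    have "i \<in> {i \<in> {1..n}. mu i < lam i}" unfolding i_def using ex by (intro Max_in) auto
    then show "i \<in> {1..n}" "mu i < lam i" by auto
  qed
  have max: "\<not> mu j < lam j" if "i < j" "j \<le> n" for j
  proof
    assume "mu j < lam j"
    then have "j \<le> i" unfolding i_def using that i by (intro Max_ge) auto
    then show False using that by simp
  qed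
  have "lam(i := lam i - 1) \<in> partitions n"
  proof (rule partitionsI)
    fix a b assume ab: "1 \<le> a" "a \<le> b" "b \<le> n"
    have 1: "lam b \<le> lam a" using partitionsD(1)[OF lam] ab by simp
    have 2: "lam b \<le> lam i - 1" if "a = i" "b \<noteq> i"
    proof -
      have "lam b \<le> mu b" using max[of b] that ab by simp
      also have "mu b \<le> mu i" using partitionsD(1)[OF mu, of i b] that ab by simp
      finally show ?thesis using i by simp
    qed
    show "(lam(i := lam i - 1)) b \<le> (lam(i := lam i - 1)) a"
      using 1 2 by auto
  next
    fix a assume a: "a = 0 \<or> a > n"
    then have "a \<noteq> i" using i(1) by auto
    then show "(lam(i := lam i - 1)) a = 0" using partitionsD(2)[OF lam a] by simp
  qed
  with i that show ?thesis by blast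
qed

section \<open>Adding and removing single boxes\<close>

lemma partitions_eqI:
  assumes "lam \<in> partitions n" "mu \<in> partitions n" "\<And>i. i \<in> {1..n} \<Longrightarrow> lam i = mu i"
  shows "lam = mu"
proof
  fix i show "lam i = mu i"
    using assms partitionsD(2)[of lam n i] partitionsD(2)[of mu n i] by (cases "i \<in> {1..n}") auto
qed

lemma contains_psize_le: "contains n lam mu \<Longrightarrow> psize n mu \<le> psize n lam"
  unfolding contains_def psize_def by (intro sum_mono) auto

lemma contains_psize_eq:
  assumes "lam \<in> partitions n" "mu \<in> partitions n" "contains n lam mu" "psize n lam \<le> psize n mu"
  shows "lam = mu"
proof (rule partitions_eqI[OF assms(1,2)])
  fix i assume i: "i \<in> {1..n}"
  have "(\<Sum>i\<in>{1..n}. mu i) = (\<Sum>i\<in>{1..n}. lam i)"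
    using contains_psize_le[OF assms(3)] assms(4) by (simp add: psize_def)
  then show "lam i = mu i"
    using sum_mono_inv[of mu "{1..n}" lam i] assms(3) i by (simp add: contains_def)
qed

lemma psize_add: "i \<in> {1..n} \<Longrightarrow> psize n (lam(i := Suc (lam i))) = Suc (psize n lam)"
  unfolding psize_def by (simp add: sum.remove[of "{1..n}" i])

lemma psize_rem: "i \<in> {1..n} \<Longrightarrow> lam i > 0 \<Longrightarrow> Suc (psize n (lam(i := lam i - 1))) = psize n lam"
  using psize_add[of i n "lam(i := lam i - 1)"] by simp

lemma add_box_partition:
  assumes lam: "lam \<in> partitions n" and i: "i \<in> {1..n}" "i = 1 \<or> lam i < lam (i - 1)"
  shows "lam(i := Suc (lam i)) \<in> partitions n"
proof (rule partitionsI)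
  fix a b assume ab: "1 \<le> a" "a \<le> b" "b \<le> n"
  have 1: "lam b \<le> lam a" using partitionsD(1)[OF lam] ab by simp
  have 2: "Suc (lam b) \<le> lam a" if "b = i" "a \<noteq> i"
  proof -
    have "a \<le> i - 1" "i \<noteq> 1" using that ab by auto
    moreover from this have "lam (i - 1) \<le> lam a"
      using i by (intro partitionsD(1)[OF lam ab(1)]) auto
    ultimately show ?thesis using i that by auto
  qed
  show "(lam(i := Suc (lam i))) b \<le> (lam(i := Suc (lam i))) a"
    using 1 2 by (cases "a = i"; cases "b = i") (simp_all add: le_SucI)
next
  fix a assume a: "a = 0 \<or> a > n"
  then have "a \<noteq> i" using i(1) by auto
  then show "(lam(i := Suc (lam i))) a = 0" using partitionsD(2)[OF lam a] by simp
qed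

lemma rem_box_partition:
  assumes lam: "lam \<in> partitions n" and i: "i \<in> {1..n}" "i = n \<or> lam (i + 1) < lam i"
  shows "lam(i := lam i - 1) \<in> partitions n"
proof (rule partitionsI)
  fix a b assume ab: "1 \<le> a" "a \<le> b" "b \<le> n"
  have 1: "lam b \<le> lam a" using partitionsD(1)[OF lam] ab by simp
  have 2: "lam b \<le> lam a - 1" if "a = i" "b \<noteq> i"
  proof -
    have "lam b \<le> lam (i + 1)" using ab that i by (intro partitionsD(1)[OF lam]) auto
    then show ?thesis using i that ab by auto
  qed
  show "(lam(i := lam i - 1)) b \<le> (lam(i := lam i - 1)) a"
    using 1 2 by (cases "a = i"; cases "b = i") (simp_all add: diff_le_mono le_diff_conv)
next
  fix a assume a: "a = 0 \<or> a > n"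
  then have "a \<noteq> i" using i(1) by auto
  then show "(lam(i := lam i - 1)) a = 0" using partitionsD(2)[OF lam a] by simp
qed

text \<open>If the box cannot be added, row \<open>i - 1\<close> has the same length, and the
  shifted coordinate of row \<open>i\<close> is the coordinate of row \<open>i - 1\<close>.\<close>

lemma shift_coeff_add_zero:
  assumes lam: "lam \<in> partitions n" and i: "i \<in> {1..n}" and no: "lam(i := Suc (lam i)) \<notin> partitions n"
  shows "shift_coeff n c r 1 lam i = 0"
proof -
  have "i \<noteq> 1" "\<not> lam i < lam (i - 1)" using add_box_partition[OF lam i] no by auto
  moreover have "lam i \<le> lam (i - 1)" using partitionsD(1)[OF lam, of "i - 1" i] i \<open>i \<noteq> 1\<close> by auto
  ultimately have eq: "lam (i - 1) = lam i" by simp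
  have "(\<Prod>j\<in>{1..n} - {i}. (c (int (lam i)) (int n - int i + 1) - grid_point n c lam j) /
        (grid_point n c lam i - grid_point n c lam j)) = 0"
    using i \<open>i \<noteq> 1\<close> eq
    by (intro prod_zero bexI[of _ "i - 1"]) (auto simp: grid_point_def of_nat_diff algebra_simps)
  then show ?thesis unfolding shift_coeff_def by (simp only: mult_zero_right)
qed

text \<open>Here row \<open>i + 1\<close> is the neighbour. The last row has none below it; there an
  impossible removal means \<open>lam n = 0\<close>, and the prefactor \<open>r 0 0\<close> has to
  vanish.\<close>

lemma shift_coeff_rem_zero:
  assumes lam: "lam \<in> partitions n" and i: "i \<in> {1..n}" and r0: "r 0 0 = 0"
    and no: "lam i = 0 \<or> lam(i := lam i - 1) \<notin> partitions n"
  shows "shift_coeff n c r (-1) lam i = 0"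
proof (cases "i = n")
  case True
  have "lam i = 0" using no rem_box_partition[OF lam i] True by auto
  then show ?thesis unfolding shift_coeff_def using True r0 by simp
next
  case False
  then have "\<not> lam (i + 1) < lam i" using no rem_box_partition[OF lam i] by auto
  moreover have "lam (i + 1) \<le> lam i" using partitionsD(1)[OF lam, of i "i + 1"] i False by auto
  ultimately have eq: "lam (i + 1) = lam i" by simp
  have "(\<Prod>j\<in>{1..n} - {i}. (c (int (lam i)) (int n - int i + -1) - grid_point n c lam j) /
        (grid_point n c lam i - grid_point n c lam j)) = 0"
    using i False eq
    by (intro prod_zero bexI[of _ "i + 1"]) (auto simp: grid_point_def algebra_simps)
  then show ?thesis unfolding shift_coeff_def by (simp only: mult_zero_right)
qed

lemma grid_point_add: "grid_point n c (lam(i := Suc (lam i))) = (grid_point n c lam)(i := c (int (lam i) + 1) (int n - int i))"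
  by (auto simp: grid_point_def fun_eq_iff add.commute)

lemma grid_point_rem:
  "lam i > 0 \<Longrightarrow> grid_point n c (lam(i := lam i - 1)) = (grid_point n c lam)(i := c (int (lam i) - 1) (int n - int i))"
  by (auto simp: grid_point_def fun_eq_iff of_nat_diff)

text \<open>At \<open>lam i = 0\<close> the coordinate \<open>c (-1)\<close> lies off the grid, but
  its coefficient is 0, so the truncated \<open>lam i - 1\<close> may stand in its place.\<close>

lemma box_operator:
  fixes c :: "int \<Rightarrow> int \<Rightarrow> 'a::field"
  assumes n: "n \<ge> 1" and dist: "distinct_grid c" and sh: "polynomial_shift e c r r'" and r0: "r' 0 0 = 0"
    and f: "sympoly n d f"
  shows "\<exists>g. sympoly n (d - 1 + e) g \<and> (\<forall>lam\<in>partitions n.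
     (\<Sum>i\<in>{1..n}. shift_coeff n c r 1 lam i *
          (f (grid_point n c (lam(i := Suc (lam i)))) - f (grid_point n c lam)) +
        shift_coeff n c r' (-1) lam i *
          (f (grid_point n c (lam(i := lam i - 1))) - f (grid_point n c lam)))
     = g (grid_point n c lam))"
proof -
  obtain g where g: "sympoly n (d - 1 + e) g" "\<And>lam. lam\<in>partitions n \<Longrightarrow>
     (\<Sum>i\<in>{1..n}. shift_coeff n c r 1 lam i *
          (f ((grid_point n c lam)(i := c (int (lam i) + 1) (int n - int i))) - f (grid_point n c lam)) +
        shift_coeff n c r' (-1) lam i *
          (f ((grid_point n c lam)(i := c (int (lam i) - 1) (int n - int i))) - f (grid_point n c lam)))
     = g (grid_point n c lam)" using shift_operator[OF n dist sh f] by blast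
  have "shift_coeff n c r' (-1) lam i * (f (grid_point n c (lam(i := lam i - 1))) - f (grid_point n c lam))
     = shift_coeff n c r' (-1) lam i *
          (f ((grid_point n c lam)(i := c (int (lam i) - 1) (int n - int i))) - f (grid_point n c lam))"
    if "lam \<in> partitions n" "i \<in> {1..n}" for lam i
  proof (cases "lam i = 0")
    case True
    then show ?thesis using shift_coeff_rem_zero[OF that, of r' c] r0 by (simp only: mult_zero_left simp_thms)
  next
    case False
    then show ?thesis using grid_point_rem[of lam i n c] by simp
  qed
  then show ?thesis
    by (intro exI[of _ g] conjI g(1) ballI, subst g(2)[symmetric]) 
       (auto simp only: grid_point_add intro!: sum.cong)
qed

text \<open>Strictly positive elements. Closure under inverses permits solving an equation for one
  term without leaving the cone.\<close>

locale positive_cone =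
  fixes P :: "'a::field set"
  assumes zero_notin: "0 \<notin> P" and one_in: "1 \<in> P"
    and add_in: "x \<in> P \<Longrightarrow> y \<in> P \<Longrightarrow> x + y \<in> P"
    and mult_in: "x \<in> P \<Longrightarrow> y \<in> P \<Longrightarrow> x * y \<in> P"
    and inverse_in: "x \<in> P \<Longrightarrow> inverse x \<in> P"
begin

lemma divide_in: "x \<in> P \<Longrightarrow> y \<in> P \<Longrightarrow> x / y \<in> P"
  by (simp add: divide_inverse mult_in inverse_in)

lemma power_in: "x \<in> P \<Longrightarrow> x ^ k \<in> P"
  by (induction k) (auto simp: one_in mult_in)

lemma power_int_in: "x \<in> P \<Longrightarrow> x powi k \<in> P"
  by (simp add: power_int_def power_in inverse_in)

lemma of_nat_in: "k > 0 \<Longrightarrow> of_nat k \<in> P"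
proof (induction k)
  case (Suc k)
  show ?case
  proof (cases k)
    case 0
    then show ?thesis by (simp add: one_in)
  next
    case (Suc l)
    then have "of_nat k \<in> P" using \<open>k > 0 \<Longrightarrow> of_nat k \<in> P\<close> by simp
    then show ?thesis by (simp only: of_nat_Suc add_in one_in)
  qed
qed simp

lemma of_int_in: "k > 0 \<Longrightarrow> of_int k \<in> P"
  using of_nat_in[of "nat k"] by (simp add: of_nat_nat)

lemma prod_in: "(\<And>i. i \<in> A \<Longrightarrow> f i \<in> P) \<Longrightarrow> prod f A \<in> P"
  by (induction A rule: infinite_finite_induct) (auto simp: one_in mult_in)

lemma add_nonneg: "x \<in> insert 0 P \<Longrightarrow> y \<in> insert 0 P \<Longrightarrow> x + y \<in> insert 0 P"
  using add_in by auto

lemma mult_nonneg: "x \<in> insert 0 P \<Longrightarrow> y \<in> insert 0 P \<Longrightarrow> x * y \<in> insert 0 P"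
  using mult_in by auto

lemma add_pos_nonneg: "x \<in> P \<Longrightarrow> y \<in> insert 0 P \<Longrightarrow> x + y \<in> P"
  using add_in by auto

lemma add_nonneg_pos: "x \<in> insert 0 P \<Longrightarrow> y \<in> P \<Longrightarrow> x + y \<in> P"
  using add_in by auto

lemma sum_nonneg: "(\<And>i. i \<in> A \<Longrightarrow> f i \<in> insert 0 P) \<Longrightarrow> sum f A \<in> insert 0 P"
proof (induction A rule: infinite_finite_induct)
  case (insert x F)
  then have "f x + sum f F \<in> insert 0 P" by (intro add_nonneg) auto
  then show ?case using insert by simp
qed auto

lemma sum_pos:
  assumes "finite A" "\<And>i. i \<in> A \<Longrightarrow> f i \<in> insert 0 P" "k \<in> A" "f k \<in> P"
  shows "sum f A \<in> P"
  using add_pos_nonneg[of "f k" "sum f (A - {k})"] sum_nonneg[of "A - {k}" f] assms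
  by (simp add: sum.remove[of A k f])

end

text \<open>\<open>s\<close> is 1 for increasing \<open>c\<close> and -1 for decreasing
  \<open>c\<close>, as for \<open>q^m t^j\<close>. Bounding \<open>m + m'\<close> and
  \<open>j + j'\<close> instead of each argument admits the positions \<open>m - 1\<close> and
  \<open>j - 1\<close> at the boundary. It is the natural range for c = x^2, whose differences
  factor as (x - x')(x + x').\<close>

locale ordered_grid = positive_cone P for P :: "'a::field set" +
  fixes c :: "int \<Rightarrow> int \<Rightarrow> 'a" and s :: 'a
  assumes sgn: "s \<noteq> 0"
    and order: "m' \<le> m \<Longrightarrow> j' \<le> j \<Longrightarrow> (m, j) \<noteq> (m', j') \<Longrightarrow> 0 \<le> m + m' \<Longrightarrow> 0 \<le> j + j' \<Longrightarrow> s * (c m j - c m' j') \<in> P"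
begin

lemma distinct: "distinct_grid c"
  unfolding distinct_grid_def
proof (intro allI impI)
  fix m m' j j' :: int assume "0 \<le> m'" "m' \<le> m" "0 \<le> j'" "j' \<le> j" "(m, j) \<noteq> (m', j')"
  then have "s * (c m j - c m' j') \<in> P" by (intro order) auto
  then show "c m j \<noteq> c m' j'" using zero_notin by auto
qed

lemma ratio_in: "s * a \<in> P \<Longrightarrow> s * b \<in> P \<Longrightarrow> a / b \<in> P"
  using divide_in[of "s * a" "s * b"] sgn by simp

lemma ratio_in': "s * - a \<in> P \<Longrightarrow> s * - b \<in> P \<Longrightarrow> a / b \<in> P"
  using ratio_in[of "- a" "- b"] by simp

text \<open>Numerator and denominator of each factor have the same sign, that of \<open>s\<close>
  for rows below and the opposite one for rows above. For the row directly above, this requires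
  \<open>lam i < lam j\<close>, which is where addability enters.\<close>

lemma shift_coeff_add_pos:
  assumes lam: "lam \<in> partitions n" and i: "i \<in> {1..n}" and add: "lam(i := Suc (lam i)) \<in> partitions n"
    and r: "r (int (lam i)) (int n - int i) \<in> P"
  shows "shift_coeff n c r 1 lam i \<in> P"
  unfolding shift_coeff_def
proof (intro mult_in[OF r] prod_in)
  fix j assume j: "j \<in> {1..n} - {i}"
  show "(c (int (lam i)) (int n - int i + 1) - grid_point n c lam j) / (grid_point n c lam i - grid_point n c lam j) \<in> P"
  proof (cases "i < j")
    case True
    then have "lam j \<le> lam i" using partitionsD(1)[OF lam, of i j] i j by auto
    then show ?thesis unfolding grid_point_def using True j i by (intro ratio_in order) auto
  next
    case False
    then have "j < i" using j by auto
    have le: "Suc (lam i) \<le> lam j" 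
      using partitionsD(1)[OF add, of j i] i j \<open>j < i\<close> by (auto split: if_splits)
    have "s * (c (int (lam j)) (int n - int j) - c (int (lam i)) (int n - int i + 1)) \<in> P"
      using \<open>j < i\<close> i j le by (intro order) auto
    moreover have "s * (c (int (lam j)) (int n - int j) - c (int (lam i)) (int n - int i)) \<in> P"
      using \<open>j < i\<close> i j le by (intro order) auto
    ultimately show ?thesis unfolding grid_point_def by (intro ratio_in') simp_all
  qed
qed

lemma shift_coeff_rem_pos:
  assumes lam: "lam \<in> partitions n" and i: "i \<in> {1..n}" "lam i > 0" and rem: "lam(i := lam i - 1) \<in> partitions n"
    and r: "r (int (lam i)) (int n - int i) \<in> P"
  shows "shift_coeff n c r (-1) lam i \<in> P"
  unfolding shift_coeff_def
proof (intro mult_in[OF r] prod_in)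
  fix j assume j: "j \<in> {1..n} - {i}"
  show "(c (int (lam i)) (int n - int i + -1) - grid_point n c lam j) / (grid_point n c lam i - grid_point n c lam j) \<in> P"
  proof (cases "i < j")
    case True
    then have "lam j < lam i" using partitionsD(1)[OF rem, of i j] i j by (auto split: if_splits)
    then show ?thesis unfolding grid_point_def using True j i by (intro ratio_in order) auto
  next
    case False
    then have "j < i" using j by auto
    have le: "lam i \<le> lam j" using partitionsD(1)[OF lam, of j i] i j \<open>j < i\<close> by auto
    have "s * (c (int (lam j)) (int n - int j) - c (int (lam i)) (int n - int i + -1)) \<in> P"
      using \<open>j < i\<close> i j le by (intro order) auto
    moreover have "s * (c (int (lam j)) (int n - int j) - c (int (lam i)) (int n - int i)) \<in> P"
      using \<open>j < i\<close> i j le by (intro order) auto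
    ultimately show ?thesis unfolding grid_point_def by (intro ratio_in') simp_all
  qed
qed

lemma sum_grid_point_strict_mono:
  assumes kk: "kap \<in> partitions n" "ka \<in> partitions n" "contains n kap ka" "kap \<noteq> ka"
  shows "s * ((\<Sum>i\<in>{1..n}. grid_point n c kap i) - (\<Sum>i\<in>{1..n}. grid_point n c ka i)) \<in> P"
proof -
  have ne: "s * (grid_point n c kap i - grid_point n c ka i) \<in> P" if "i \<in> {1..n}" "ka i < kap i" for i
    using order[of "int (ka i)" "int (kap i)" "int n - int i" "int n - int i"] that by (auto simp: grid_point_def)
  have "s * (grid_point n c kap i - grid_point n c ka i) \<in> insert 0 P" if i: "i \<in> {1..n}" for i
  proof (cases "ka i = kap i")
    case True
    then show ?thesis by (simp add: grid_point_def)
  next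
    case False
    then have "ka i < kap i" using kk(3) i unfolding contains_def by (simp add: le_neq_implies_less)
    then show ?thesis using ne[OF i] by simp
  qed
  moreover obtain k where "k \<in> {1..n}" "ka k < kap k"
    using partitions_eqI[OF kk(1,2)] kk(3,4) unfolding contains_def by (metis le_neq_implies_less)
  ultimately have "(\<Sum>i\<in>{1..n}. s * (grid_point n c kap i - grid_point n c ka i)) \<in> P"
    using ne by (intro sum_pos[of _ _ k]) auto
  then show ?thesis by (simp add: sum_subtractf flip: sum_distrib_left)
qed

text \<open>The operator only removes boxes, so \<open>h\<^sub>\<mu>\<close> is an eigenfunction with eigenvalue \<open>- S \<mu>\<close>. Evaluated
  at \<open>\<lambda>\<close> this is a recursion with nonnegative coefficients.\<close>

lemma type_A_positivity:
  fixes r :: "int \<Rightarrow> int \<Rightarrow> 'a"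
  assumes n: "n \<ge> 1" and sh: "polynomial_shift 1 c (\<lambda>_ _. 0) r" and r0: "r 0 0 = 0"
    and rpos: "\<And>m j. 0 \<le> m \<Longrightarrow> 0 \<le> j \<Longrightarrow> (m, j) \<noteq> (0, 0) \<Longrightarrow> r m j \<in> P"
    and S: "\<And>lam. S lam = (\<Sum>i\<in>{1..n}. shift_coeff n c r (-1) lam i)"
    and Spos: "\<And>lam mu. lam \<in> partitions n \<Longrightarrow> mu \<in> partitions n \<Longrightarrow> contains n lam mu \<Longrightarrow> lam \<noteq> mu \<Longrightarrow> S lam - S mu \<in> P"
    and Sne: "\<And>lam mu. lam \<in> partitions n \<Longrightarrow> mu \<in> partitions n \<Longrightarrow> psize n mu < psize n lam \<Longrightarrow> S lam \<noteq> S mu"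
    and lam: "lam \<in> partitions n" and mu: "mu \<in> partitions n"
  shows "(contains n lam mu \<longrightarrow> binom n c lam mu \<in> P) \<and> (\<not> contains n lam mu \<longrightarrow> binom n c lam mu = 0)"
\<comment> \<open>Split off because the bound \<open>psize n mu - 1 + 1\<close> is too large at size
  0, where the interpolation polynomial is constant.\<close>
proof (cases "psize n mu = 0")
  case True
  then have "mu i = 0" if "i \<in> {1..n}" for i using that by (auto simp: psize_def)
  then have "contains n lam mu" by (simp add: contains_def)
  moreover have "binom n c lam mu = 1"
  proof -
    obtain k where k: "\<And>y. interp n c mu y = k" using sympoly_0_const[OF interp(1)[OF distinct, of n mu] True] by blast
    then show ?thesis using binom_delta[OF distinct mu, of mu] by (simp add: binom_def)
  qed
  ultimately show ?thesis by (simp add: one_in)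
next
  case False
  let ?b = "\<lambda>lam. binom n c lam mu"
  let ?L = "\<lambda>lam i. shift_coeff n c r (-1) lam i"
  obtain g where g: "sympoly n (psize n mu - 1 + 1) g" "\<And>lam. lam \<in> partitions n \<Longrightarrow>
     (\<Sum>i\<in>{1..n}. shift_coeff n c (\<lambda>_ _. 0) 1 lam i * (?b (lam(i := Suc (lam i))) - ?b lam) +
        ?L lam i * (?b (lam(i := lam i - 1)) - ?b lam)) = g (grid_point n c lam)"
    using box_operator[OF n distinct sh r0 interp(1)[OF distinct, of n mu]] unfolding binom_def by blast
  have g': "g (grid_point n c lam) = (\<Sum>i\<in>{1..n}. ?L lam i * ?b (lam(i := lam i - 1))) - S lam * ?b lam"
    if "lam \<in> partitions n" for lam
    unfolding g(2)[OF that, symmetric] S sum_distrib_right sum_subtractf[symmetric]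
    by (intro sum.cong) (auto simp: shift_coeff_def[of _ _ "\<lambda>_ _. 0"] right_diff_distrib)
  \<comment> \<open>At points with at most as many boxes as \<open>mu\<close>, a removal leads to
    fewer boxes, where the interpolation polynomial vanishes. The combination thus vanishes at all
    points tested by its degree bound.\<close>
  have "g (grid_point n c lam) + S mu * interp n c mu (grid_point n c lam) = 0" for lam
  proof (rule sympoly_unique[OF distinct])
    show "sympoly n (psize n mu) (\<lambda>y. g y + S mu * interp n c mu y)"
      using g(1) False by (intro sympoly.add sympoly_cmult interp(1)[OF distinct]) simp
  next
    fix kap assume kap: "kap \<in> partitions n" "psize n kap \<le> psize n mu"
    have "?L kap i * ?b (kap(i := kap i - 1)) = 0" if i: "i \<in> {1..n}" for i
    proof (cases "kap i = 0 \<or> kap(i := kap i - 1) \<notin> partitions n")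
      case True
      then show ?thesis using shift_coeff_rem_zero[where r=r and c=c, OF kap(1) i r0] by simp
    next
      case False
      then have "Suc (psize n (kap(i := kap i - 1))) = psize n kap" using psize_rem[OF i] by simp
      then have lt: "psize n (kap(i := kap i - 1)) < psize n mu" using kap by simp
      then have "kap(i := kap i - 1) \<noteq> mu" by auto
      then have "?b (kap(i := kap i - 1)) = 0"
        using binom_delta[OF distinct, of "kap(i := kap i - 1)" n mu] lt False by simp
      then show ?thesis by simp
    qed
    then have "(\<Sum>i\<in>{1..n}. ?L kap i * ?b (kap(i := kap i - 1))) = 0" by (rule sum.neutral[rule_format])
    then have "g (grid_point n c kap) = - S kap * ?b kap" using g'[OF kap(1)] by simp
    then show "g (grid_point n c kap) + S mu * interp n c mu (grid_point n c kap) = 0"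
      unfolding binom_def[symmetric] using binom_delta[OF distinct kap] by (auto split: if_splits)
  qed
  then have rec: "(S lam - S mu) * ?b lam = (\<Sum>i\<in>{1..n}. ?L lam i * ?b (lam(i := lam i - 1)))"
    if "lam \<in> partitions n" for lam
    using g'[OF that] unfolding binom_def[symmetric] by (simp add: algebra_simps add_eq_0_iff)
  show ?thesis using lam
  proof (induction "psize n lam" arbitrary: lam rule: less_induct)
    case less
    note lam = less.prems
    have Lnonneg: "?L lam i \<in> insert 0 P" if "i \<in> {1..n}" for i
      using shift_coeff_rem_zero[where r=r and c=c, OF lam that r0]
        shift_coeff_rem_pos[OF lam that, of r] rpos[of "int (lam i)" "int n - int i"] that by auto
    have IH: "(contains n (lam(i := lam i - 1)) mu \<longrightarrow> ?b (lam(i := lam i - 1)) \<in> P) \<and>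
       (\<not> contains n (lam(i := lam i - 1)) mu \<longrightarrow> ?b (lam(i := lam i - 1)) = 0)"
      if "i \<in> {1..n}" "lam i > 0" "lam(i := lam i - 1) \<in> partitions n" for i
      using less.hyps[OF _ that(3)] psize_rem[of i n lam, OF that(1,2)] by auto
    have terms: "?L lam i * ?b (lam(i := lam i - 1)) \<in> insert 0 P" if i: "i \<in> {1..n}" for i
      using shift_coeff_rem_zero[where r=r and c=c, OF lam i r0] IH[OF i] Lnonneg[OF i] mult_nonneg
      by (cases "lam i = 0 \<or> lam(i := lam i - 1) \<notin> partitions n") auto
    show ?case
    proof (intro conjI impI)
      assume con: "contains n lam mu"
      show "?b lam \<in> P"
      proof (cases "lam = mu")
        case True
        then show ?thesis using binom_delta[OF distinct mu, of mu] one_in by simp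
      next
        case False
        then obtain k where "k \<in> {1..n}" "mu k < lam k"
          using partitions_eqI[OF lam mu] con unfolding contains_def by (metis le_neq_implies_less)
        from exists_removable[OF lam mu this] obtain i where
          i: "i \<in> {1..n}" "mu i < lam i" "lam(i := lam i - 1) \<in> partitions n" by blast
        have "contains n (lam(i := lam i - 1)) mu" using con i by (auto simp: contains_def)
        then have "?b (lam(i := lam i - 1)) \<in> P" using IH[of i] i by auto
        moreover have "?L lam i \<in> P" using i rpos[of "int (lam i)" "int n - int i"] by (intro shift_coeff_rem_pos lam) auto
        ultimately have "(\<Sum>i\<in>{1..n}. ?L lam i * ?b (lam(i := lam i - 1))) \<in> P"
          using i terms by (intro sum_pos[of _ _ i] mult_in) auto
        moreover have "S lam - S mu \<in> P" using Spos[OF lam mu con False] .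
        moreover have "?b lam = (S lam - S mu) * ?b lam / (S lam - S mu)"
          using \<open>S lam - S mu \<in> P\<close> zero_notin by auto
        ultimately show ?thesis using rec[OF lam] divide_in by metis
      qed
    next
      assume con: "\<not> contains n lam mu"
      show "?b lam = 0"
      proof (cases "psize n lam \<le> psize n mu")
        case True
        moreover have "lam \<noteq> mu" using con by (auto simp: contains_def)
        ultimately show ?thesis using binom_delta[OF distinct lam] by simp
      next
        case False
        have "?L lam i * ?b (lam(i := lam i - 1)) = 0" if i: "i \<in> {1..n}" for i
        proof (cases "lam i = 0 \<or> lam(i := lam i - 1) \<notin> partitions n")
          case True
          then show ?thesis using shift_coeff_rem_zero[where r=r and c=c, OF lam i r0] by simp
        next
          case False
          moreover have "\<not> contains n (lam(i := lam i - 1)) mu"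
            using con unfolding contains_def by (metis fun_upd_apply diff_le_self order.trans)
          ultimately show ?thesis using IH[OF i] by simp
        qed
        then have "(\<Sum>i\<in>{1..n}. ?L lam i * ?b (lam(i := lam i - 1))) = 0" by (rule sum.neutral[rule_format])
        then have "(S lam - S mu) * ?b lam = 0" using rec[OF lam] by simp
        \<comment> \<open>Without containment the eigenvalues cannot be compared in the cone; that
          they are different is enough here.\<close>
        then show ?thesis using Sne[OF lam mu] False by simp
      qed
    qed
  qed
qed

end

section \<open>Positivity in type B\<close>

text \<open>The functions \<open>p0 + p1 * xU\<close> and \<open>p0 + p1 * xL\<close> are the values of one and the same \<open>p\<close> at \<open>x\<close> and at
  its mirror image (\<open>- x\<close> or \<open>1 / x\<close>), so \<open>p\<close> can be chosen to vanish at a given point of the grid.\<close>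

locale type_B = ordered_grid P c 1 for P :: "'a::field set" and c :: "int \<Rightarrow> int \<Rightarrow> 'a" +
  fixes rU rL xU xL :: "int \<Rightarrow> int \<Rightarrow> 'a"
  assumes rU: "0 \<le> m \<Longrightarrow> 0 \<le> j \<Longrightarrow> rU m j \<in> P"
    and rL0: "rL 0 0 = 0"
    and rL: "1 \<le> m \<Longrightarrow> - rL m 0 \<in> P"
    and xU: "0 \<le> m' \<Longrightarrow> m' \<le> m \<Longrightarrow> 0 \<le> j' \<Longrightarrow> j' \<le> j \<Longrightarrow> (m, j) \<noteq> (m', j') \<Longrightarrow> xU m j - xU m' j' \<in> P"
    and xL: "0 \<le> m \<Longrightarrow> 0 \<le> j \<Longrightarrow> 0 \<le> m' \<Longrightarrow> 0 \<le> j' \<Longrightarrow> xU m' j' - xL m j \<in> P"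
    and shift: "polynomial_shift 0 c (\<lambda>m j. rU m j * (p0 + p1 * xU m j)) (\<lambda>m j. rL m j * (p0 + p1 * xL m j))"
begin

text \<open>The operator lowers the degree, hence its value at \<open>h\<^sub>\<mu>\<close> is determined by the values at the
  partitions with fewer boxes than \<open>\<mu>\<close>, where only the terms adding a box survive.\<close>

lemma interp_expansion:
  fixes n :: nat and p0 p1 :: 'a
  defines "pU lam i \<equiv> p0 + p1 * xU (int (lam i)) (int n - int i)"
    and "pL lam i \<equiv> p0 + p1 * xL (int (lam i)) (int n - int i)"
  assumes n: "n \<ge> 1" and lam: "lam \<in> partitions n" and mu: "mu \<in> partitions n"
  shows "(\<Sum>i\<in>{1..n}. pU lam i * shift_coeff n c rU 1 lam i * (binom n c (lam(i := Suc (lam i))) mu - binom n c lam mu) +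
        pL lam i * shift_coeff n c rL (-1) lam i * (binom n c (lam(i := lam i - 1)) mu - binom n c lam mu)) =
     (\<Sum>j | j \<in> {1..n} \<and> 0 < mu j \<and> mu(j := mu j - 1) \<in> partitions n.
        pU (mu(j := mu j - 1)) j * shift_coeff n c rU 1 (mu(j := mu j - 1)) j * binom n c lam (mu(j := mu j - 1)))"
proof -
  define J where "J = {j. j \<in> {1..n} \<and> 0 < mu j \<and> mu(j := mu j - 1) \<in> partitions n}"
  define W where "W j = pU (mu(j := mu j - 1)) j * shift_coeff n c rU 1 (mu(j := mu j - 1)) j" for j
  define r where "r m j = rU m j * (p0 + p1 * xU m j)" for m j
  define r' where "r' m j = rL m j * (p0 + p1 * xL m j)" for m j
  have U: "shift_coeff n c r 1 lam i = pU lam i * shift_coeff n c rU 1 lam i" for lam i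
    unfolding shift_coeff_def r_def pU_def by (simp only: mult_ac)
  have L: "shift_coeff n c r' (-1) lam i = pL lam i * shift_coeff n c rL (-1) lam i" for lam i
    unfolding shift_coeff_def r'_def pL_def by (simp only: mult_ac)
  have sh: "polynomial_shift 0 c r r'" unfolding r_def r'_def by (rule shift)
  have r'0: "r' 0 0 = 0" by (simp add: r'_def rL0)
  obtain g where g: "sympoly n (psize n mu - 1 + 0) g" "\<And>lam. lam \<in> partitions n \<Longrightarrow>
     (\<Sum>i\<in>{1..n}. shift_coeff n c r 1 lam i * (binom n c (lam(i := Suc (lam i))) mu - binom n c lam mu) +
        shift_coeff n c r' (-1) lam i * (binom n c (lam(i := lam i - 1)) mu - binom n c lam mu)) = g (grid_point n c lam)"
    using box_operator[OF n distinct sh r'0 interp(1)[OF distinct, of n mu]] unfolding binom_def by blast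
  have "g (grid_point n c lam) = (\<Sum>j\<in>J. W j * binom n c lam (mu(j := mu j - 1)))"
  \<comment> \<open>The truncated degree bound would only give a constant here; that the constant is
    0 follows from the differences.\<close>
  proof (cases "psize n mu = 0")
    case True
    obtain k where k: "\<And>y. interp n c mu y = k" using sympoly_0_const[OF interp(1)[OF distinct, of n mu] True] by blast
    then have "g (grid_point n c lam) = 0" unfolding g(2)[OF lam, symmetric] binom_def by simp
    moreover have "J = {}" using True by (auto simp: J_def psize_def)
    ultimately show ?thesis by simp
  next
    case False
    have "g (grid_point n c lam) - (\<Sum>j\<in>J. W j * interp n c (mu(j := mu j - 1)) (grid_point n c lam)) = 0"
    proof (rule sympoly_unique[OF distinct])
      have "sympoly n (psize n mu - 1) (\<lambda>y. W j * interp n c (mu(j := mu j - 1)) y)" if "j \<in> J" for j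
      proof -
        have "psize n mu - 1 = psize n (mu(j := mu j - 1))"
          using psize_rem[of j n mu] that by (simp add: J_def)
        then show ?thesis using sympoly_cmult[OF interp(1)[OF distinct, of n "mu(j := mu j - 1)"]] by simp
      qed
      then show "sympoly n (psize n mu - 1) (\<lambda>y. g y - (\<Sum>j\<in>J. W j * interp n c (mu(j := mu j - 1)) y))"
        using g(1) by (intro sympoly_diff sympoly_sum) auto
    next
      fix kap assume kap: "kap \<in> partitions n" "psize n kap \<le> psize n mu - 1"
      have b0: "binom n c kap mu = 0"
        using binom_delta[OF distinct kap(1), of mu] kap(2) False by auto
      have up: "shift_coeff n c r 1 kap i * (binom n c (kap(i := Suc (kap i))) mu - binom n c kap mu) =
          (if kap(i := Suc (kap i)) = mu then shift_coeff n c r 1 kap i else 0)" if i: "i \<in> {1..n}" for i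
      proof (cases "kap(i := Suc (kap i)) \<in> partitions n")
        case True
        have "psize n (kap(i := Suc (kap i))) \<le> psize n mu" using psize_add[OF i, of kap] kap(2) False by linarith
        then show ?thesis using binom_delta[OF distinct True] b0 by simp
      next
        case False
        then show ?thesis using shift_coeff_add_zero[OF kap(1) i False, of c r] by simp
      qed
      have down: "shift_coeff n c r' (-1) kap i * (binom n c (kap(i := kap i - 1)) mu - binom n c kap mu) = 0"
        if i: "i \<in> {1..n}" for i
      proof (cases "kap i = 0 \<or> kap(i := kap i - 1) \<notin> partitions n")
        case True
        then show ?thesis using shift_coeff_rem_zero[where r = r' and c = c, OF kap(1) i r'0] by simp
      next
        case nr: False
        then have lt: "psize n (kap(i := kap i - 1)) < psize n mu"
          using psize_rem[of i n kap, OF i] kap(2) False by linarith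
        then have "kap(i := kap i - 1) \<noteq> mu" by auto
        then show ?thesis using binom_delta[OF distinct, of "kap(i := kap i - 1)" n mu] lt nr b0 by simp
      qed
      have "g (grid_point n c kap) = (\<Sum>i\<in>{1..n}. if kap(i := Suc (kap i)) = mu then shift_coeff n c r 1 kap i else 0)"
        unfolding g(2)[OF kap(1), symmetric] by (intro sum.cong refl) (simp only: up down add_0_right)
      also have "\<dots> = (\<Sum>j\<in>J. if kap = mu(j := mu j - 1) then W j else 0)"
      proof (rule sum.mono_neutral_cong_right)
        show "\<forall>i\<in>{1..n} - J. (if kap(i := Suc (kap i)) = mu then shift_coeff n c r 1 kap i else 0) = 0"
        proof
          fix i assume i: "i \<in> {1..n} - J"
          have "kap(i := Suc (kap i)) \<noteq> mu"
          proof
            assume eq: "kap(i := Suc (kap i)) = mu"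
            then have "mu(i := mu i - 1) = kap" "0 < mu i" by auto
            then show False using i kap(1) by (auto simp: J_def)
          qed
          then show "(if kap(i := Suc (kap i)) = mu then shift_coeff n c r 1 kap i else 0) = 0" by simp
        qed
      next
        fix j assume j: "j \<in> J"
        then have "kap(j := Suc (kap j)) = mu \<longleftrightarrow> kap = mu(j := mu j - 1)" by (auto simp: J_def fun_eq_iff)
        then show "(if kap(j := Suc (kap j)) = mu then shift_coeff n c r 1 kap j else 0) =
            (if kap = mu(j := mu j - 1) then W j else 0)"
          by (auto simp: U W_def)
      qed (auto simp: J_def)
      also have "\<dots> = (\<Sum>j\<in>J. W j * interp n c (mu(j := mu j - 1)) (grid_point n c kap))"
      proof (intro sum.cong refl)
        fix j assume j: "j \<in> J"
        then have "psize n kap \<le> psize n (mu(j := mu j - 1))" using psize_rem[of j n mu] kap(2) by (auto simp: J_def)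
        then show "(if kap = mu(j := mu j - 1) then W j else 0) = W j * interp n c (mu(j := mu j - 1)) (grid_point n c kap)"
          using binom_delta[OF distinct kap(1)] unfolding binom_def by simp
      qed
      finally show "g (grid_point n c kap) - (\<Sum>j\<in>J. W j * interp n c (mu(j := mu j - 1)) (grid_point n c kap)) = 0"
        by simp
    qed
    then show ?thesis unfolding binom_def by simp
  qed
  then show ?thesis unfolding g(2)[OF lam, symmetric] U L J_def W_def .
qed

end

text \<open>All shifts of the second argument are included because dropping a row by
  \<open>binom_restrict\<close> replaces \<open>c m j\<close> by \<open>c m (j + 1)\<close>. The
  operator data may depend on \<open>k\<close>.\<close>

definition type_B_grid :: "'a::field set \<Rightarrow> (int \<Rightarrow> int \<Rightarrow> 'a) \<Rightarrow> bool" where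
  "type_B_grid P c \<longleftrightarrow> (\<forall>k::nat. \<exists>rU rL xU xL. type_B P (\<lambda>m j. c m (j + int k)) rU rL xU xL)"

lemma type_B_grid_shift: "type_B_grid P c \<Longrightarrow> type_B_grid P (\<lambda>m j. c m (j + 1))"
  unfolding type_B_grid_def
proof
  fix k :: nat
  assume "\<forall>k::nat. \<exists>rU rL xU xL. type_B P (\<lambda>m j. c m (j + int k)) rU rL xU xL"
  then have "\<exists>rU rL xU xL. type_B P (\<lambda>m j. c m (j + int (Suc k))) rU rL xU xL" by blast
  then show "\<exists>rU rL xU xL. type_B P (\<lambda>m j. c m (j + int k + 1)) rU rL xU xL" by (simp add: add_ac)
qed

lemma type_B_gridE:
  assumes "type_B_grid P c"
  obtains rU rL xU xL where "type_B P c rU rL xU xL"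
  using assms[unfolded type_B_grid_def, rule_format, of 0] by auto

lemma contains_Suc: "contains (Suc n) lam mu \<longleftrightarrow> mu (Suc n) \<le> lam (Suc n) \<and> contains n lam mu"
  unfolding contains_def by (simp add: atLeastAtMostSuc_conv)

text \<open>The expansion is used at \<open>\<lambda>\<close> without one box of its last row. If \<open>\<lambda>\<^sub>j < \<mu>\<^sub>j\<close>, then the other
  terms not covered by induction all carry the value of \<open>p\<close> at \<open>x (\<lambda>\<^sub>j) (n - j)\<close>, which is made zero.\<close>

theorem extra_vanishing:
  assumes "type_B_grid P c" "lam \<in> partitions n" "mu \<in> partitions n" "\<not> contains n lam mu"
  shows "binom n c lam mu = 0"
  using assms
proof (induction n arbitrary: c lam mu)
  case 0
  then show ?case by (simp add: contains_def)
next
  case (Suc n)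
  note IHn = Suc.IH
  let ?N = "Suc n"
  obtain rU rL xU xL where "type_B P c rU rL xU xL" using type_B_gridE[OF Suc.prems(1)] .
  then interpret type_B P c rU rL xU xL .
  define k where "k = psize ?N lam"
  show ?case using Suc.prems(2-4) k_def
  proof (induction k arbitrary: lam mu rule: less_induct)
    case (less k)
    note IHk = less.IH
    define l where "l = lam ?N"
    show ?case using less.prems l_def
    proof (induction l arbitrary: lam rule: less_induct)
      case (less l nu)
      note nu = less.prems(1) and mu = less.prems(2) and ncon = less.prems(3)
      show ?case
      proof (cases "nu ?N = 0")
        case True
        show ?thesis
        proof (cases "mu ?N = 0")
          case mu0: True
          have "\<not> contains n nu mu"
            using ncon mu0 by (simp add: contains_Suc)
          then have "binom n (\<lambda>m j. c m (j + 1)) nu mu = 0"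
            using nu mu partitions_Suc_zero[of nu n] partitions_Suc_zero[of mu n] True mu0
            by (intro IHn[OF type_B_grid_shift[OF Suc.prems(1)]]) auto
          then show ?thesis using binom_restrict[OF distinct nu True mu] by simp
        next
          case False
          then show ?thesis using binom_restrict[OF distinct nu True mu] by simp
        qed
      next
        case False
        define la where "la = nu(?N := nu ?N - 1)"
        have N: "?N \<in> {1..?N}" "?N \<ge> 1" by auto
        have la: "la \<in> partitions ?N" unfolding la_def by (rule rem_box_partition[OF nu N(1)]) simp
        have nu_la: "la(?N := Suc (la ?N)) = nu" using False by (auto simp: la_def)
        have size_la: "Suc (psize ?N la) = k" using psize_rem[of ?N ?N nu, OF N(1)] False less.prems(4) by (simp add: la_def)
        obtain j where j: "j \<in> {1..?N}" "nu j < mu j" using ncon unfolding contains_def by (meson not_le)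
        have la_le: "la i \<le> nu i" for i by (simp add: la_def)
        \<comment> \<open>If \<open>j\<close> is the last row, \<open>la\<close> is at least two
          boxes short of \<open>mu\<close> there, so no single box bridges the gap and
          \<open>p = 1\<close> can be taken. In either case \<open>p\<close> is nonzero at the last
          row of \<open>la\<close>, whose term is to be solved for.\<close>
        define p0 p1 where "p0 = (if j = ?N then 1 else - xU (int (la j)) (int ?N - int j))"
          and "p1 = (if j = ?N then 0 else 1 :: 'a)"
        define pU where "pU lam i = p0 + p1 * xU (int (lam i)) (int ?N - int i)" for lam :: "nat \<Rightarrow> nat" and i
        define pL where "pL lam i = p0 + p1 * xL (int (lam i)) (int ?N - int i)" for lam :: "nat \<Rightarrow> nat" and i
        have pU_N: "pU la ?N \<noteq> 0"
        proof (cases "j = ?N")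
          case True
          then show ?thesis by (simp add: pU_def p0_def p1_def)
        next
          case False
          then have "j < ?N" using j by auto
          then have "la ?N \<le> la j" using j by (intro partitionsD(1)[OF la]) auto
          then have "xU (int (la j)) (int ?N - int j) - xU (int (la ?N)) (int ?N - int ?N) \<in> P"
            using \<open>j < ?N\<close> by (intro xU) auto
          then show ?thesis using zero_notin False by (auto simp: pU_def p0_def p1_def)
        qed
        have pU_j: "pU kap j = 0" if "kap j = la j" "j \<noteq> ?N" for kap
          using that by (simp add: pU_def p0_def p1_def)
        have b_la: "binom ?N c la kap = 0" if "kap \<in> partitions ?N" "\<not> contains ?N la kap" for kap
          using IHk[OF _ la that refl] size_la by simp
        have ncon_la: "\<not> contains ?N la mu" using j la_le[of j] unfolding contains_def by force
        have "(\<Sum>i\<in>{1..?N}. pU la i * shift_coeff ?N c rU 1 la i * (binom ?N c (la(i := Suc (la i))) mu - binom ?N c la mu) +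
            pL la i * shift_coeff ?N c rL (-1) la i * (binom ?N c (la(i := la i - 1)) mu - binom ?N c la mu)) =
          (\<Sum>i\<in>{1..?N}. if i = ?N then pU la ?N * shift_coeff ?N c rU 1 la ?N * binom ?N c nu mu else 0)"
        proof (intro sum.cong refl)
          fix i assume i: "i \<in> {1..?N}"
          have "shift_coeff ?N c rL (-1) la i * (binom ?N c (la(i := la i - 1)) mu - binom ?N c la mu) = 0"
          proof (cases "la i = 0 \<or> la(i := la i - 1) \<notin> partitions ?N")
            case True
            then show ?thesis using shift_coeff_rem_zero[where r = rL and c = c, OF la i rL0] by simp
          next
            case nr: False
            have "Suc (psize ?N (la(i := la i - 1))) = psize ?N la" using psize_rem[of i ?N la, OF i] nr by simp
            moreover have "\<not> contains ?N (la(i := la i - 1)) mu"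
              using j la_le[of j] unfolding contains_def by (auto intro!: bexI[of _ j])
            ultimately have "binom ?N c (la(i := la i - 1)) mu = 0"
              using IHk[OF _ _ mu _ refl, of "la(i := la i - 1)"] nr size_la by (simp del: fun_upd_apply)
            then show ?thesis using b_la[OF mu ncon_la] by simp
          qed
          moreover have "pU la i * shift_coeff ?N c rU 1 la i * binom ?N c (la(i := Suc (la i))) mu = 0" if "i \<noteq> ?N"
          proof (cases "la(i := Suc (la i)) \<in> partitions ?N")
            case False
            then show ?thesis using shift_coeff_add_zero[OF la i False, of c rU] by simp
          next
            case True
            show ?thesis
            proof (cases "contains ?N (la(i := Suc (la i))) mu")
              case con: True
              then have "mu j \<le> (la(i := Suc (la i))) j" using j unfolding contains_def by blast
              then have "i = j" using j(2) la_le[of j] by (auto split: if_splits)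
              then show ?thesis using pU_j[of la] that by simp
            next
              case False
              \<comment> \<open>This is the purpose of the inner induction: a box put elsewhere
                restores the size of \<open>nu\<close>, but leaves a shorter last row.\<close>
              have "(la(i := Suc (la i))) ?N < l" using that less.prems(5) \<open>nu ?N \<noteq> 0\<close> by (simp add: la_def)
              moreover have "k = psize ?N (la(i := Suc (la i)))" using psize_add[OF i, of la] size_la by simp
              ultimately have "binom ?N c (la(i := Suc (la i))) mu = 0"
                using less.IH[OF _ True mu False _ refl] by blast
              then show ?thesis by simp
            qed
          qed
          ultimately show "pU la i * shift_coeff ?N c rU 1 la i * (binom ?N c (la(i := Suc (la i))) mu - binom ?N c la mu) +
            pL la i * shift_coeff ?N c rL (-1) la i * (binom ?N c (la(i := la i - 1)) mu - binom ?N c la mu) =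
            (if i = ?N then pU la ?N * shift_coeff ?N c rU 1 la ?N * binom ?N c nu mu else 0)"
            using b_la[OF mu ncon_la] nu_la by (auto simp: mult.assoc)
        qed
        also have "\<dots> = pU la ?N * shift_coeff ?N c rU 1 la ?N * binom ?N c nu mu" by simp
        finally have "pU la ?N * shift_coeff ?N c rU 1 la ?N * binom ?N c nu mu =
          (\<Sum>j | j \<in> {1..?N} \<and> 0 < mu j \<and> mu(j := mu j - 1) \<in> partitions ?N.
            pU (mu(j := mu j - 1)) j * shift_coeff ?N c rU 1 (mu(j := mu j - 1)) j * binom ?N c la (mu(j := mu j - 1)))"
          using interp_expansion[OF N(2) la mu, of p0 p1] unfolding pU_def pL_def by simp
        also have "\<dots> = 0"
        proof (intro sum.neutral ballI)
          fix i assume "i \<in> {j. j \<in> {1..?N} \<and> 0 < mu j \<and> mu(j := mu j - 1) \<in> partitions ?N}"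
          then have i: "i \<in> {1..?N}" "0 < mu i" "mu(i := mu i - 1) \<in> partitions ?N" by auto
          show "pU (mu(i := mu i - 1)) i * shift_coeff ?N c rU 1 (mu(i := mu i - 1)) i * binom ?N c la (mu(i := mu i - 1)) = 0"
          proof (cases "contains ?N la (mu(i := mu i - 1))")
            case False
            then show ?thesis using b_la[OF i(3)] by simp
          next
            case True
            then have le: "(mu(i := mu i - 1)) j \<le> la j" using j unfolding contains_def by blast
            then have ij: "i = j" using j(2) la_le[of j] by (auto split: if_splits)
            then have "mu j - 1 \<le> la j" using le by simp
            moreover have "j \<noteq> ?N" using \<open>mu j - 1 \<le> la j\<close> j(2) False by (auto simp: la_def)
            moreover have "mu j - 1 = la j" using \<open>mu j - 1 \<le> la j\<close> j(2) la_le[of j] by linarith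
            ultimately have "pU (mu(i := mu i - 1)) i = 0" using pU_j[of "mu(i := mu i - 1)"] ij by simp
            then show ?thesis by simp
          qed
        qed
        finally have "pU la ?N * shift_coeff ?N c rU 1 la ?N * binom ?N c nu mu = 0" .
        moreover have "shift_coeff ?N c rU 1 la ?N \<in> P"
          using nu nu_la by (intro shift_coeff_add_pos[OF la N(1)] rU) auto
        then have "shift_coeff ?N c rU 1 la ?N \<noteq> 0" using zero_notin by metis
        ultimately show ?thesis using pU_N by simp
      qed
    qed
  qed
qed

text \<open>A box in a row \<open>j \<noteq> k\<close> can be removed from both partitions at the cost of a positive factor. If
  there is no such row then the larger partition \<open>\<nu>\<close> is a rectangle, and the expansion of \<open>h\<^sub>\<nu>\<close> at \<open>\<nu>\<close>
  itself has a single term on each side once \<open>p\<close> vanishes at the coordinate of the first row.\<close>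

theorem adjacent_positivity:
  assumes "type_B_grid P c" "mu \<in> partitions n" "k \<in> {1..n}" "mu(k := Suc (mu k)) \<in> partitions n"
  shows "binom n c (mu(k := Suc (mu k))) mu \<in> P"
  using assms
proof (induction n arbitrary: c k mu)
  case 0
  then show ?case by simp
next
  case (Suc n)
  note IHn = Suc.IH
  let ?N = "Suc n"
  obtain rU rL xU xL where "type_B P c rU rL xU xL" using type_B_gridE[OF Suc.prems(1)] .
  then interpret type_B P c rU rL xU xL .
  note EV = extra_vanishing[OF Suc.prems(1), where n = ?N]
  define d where "d = psize ?N mu"
  show ?case using Suc.prems(2-4) d_def
  proof (induction d arbitrary: mu k rule: less_induct)
    case (less d)
    note mu = less.prems(1) and k = less.prems(2)
    define nu where "nu = mu(k := Suc (mu k))"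
    have nu: "nu \<in> partitions ?N" using less.prems(3) unfolding nu_def .
    have N: "?N \<in> {1..?N}" "?N \<ge> 1" by auto
    have "binom ?N c nu mu \<in> P"
    proof (cases "nu ?N = 0")
      case True
      then have "k \<noteq> ?N" "mu ?N = 0" by (auto simp: nu_def split: if_splits)
      moreover have "binom n (\<lambda>m j. c m (j + 1)) (mu(k := Suc (mu k))) mu \<in> P"
        using mu nu k partitions_Suc_zero[of nu n] partitions_Suc_zero[of mu n] True calculation
        by (intro IHn[OF type_B_grid_shift[OF Suc.prems(1)]]) (auto simp: nu_def simp del: fun_upd_apply)
      ultimately show ?thesis using binom_restrict[OF distinct nu True mu]
        unfolding nu_def by (simp del: fun_upd_apply)
    next
      case False
      show ?thesis
      proof (cases "\<exists>j\<in>{1..?N}. j \<noteq> k \<and> 0 < mu j \<and> mu(j := mu j - 1) \<in> partitions ?N \<and>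
          mu(j := mu j - 1, k := Suc (mu k)) \<in> partitions ?N")
        case True
        then obtain j where j: "j \<in> {1..?N}" "j \<noteq> k" "0 < mu j" "mu(j := mu j - 1) \<in> partitions ?N"
          "mu(j := mu j - 1, k := Suc (mu k)) \<in> partitions ?N" by blast
        \<comment> \<open>Removing a box of row \<open>j\<close> turns \<open>mu\<close> and
          \<open>nu\<close> into \<open>ka\<close> and \<open>la\<close>. In that row
          \<open>la\<close> is one box short of \<open>mu\<close>, so with \<open>p = 1\<close> only
          steps in row \<open>j\<close> survive, and the two binomial coefficients are
          proportional.\<close>
        define ka where "ka = mu(j := mu j - 1)"
        define la where "la = ka(k := Suc (ka k))"
        have la: "la \<in> partitions ?N" and ka: "ka \<in> partitions ?N" using j by (auto simp: la_def ka_def)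
        have ka_mu: "ka(j := Suc (ka j)) = mu" using j by (auto simp: ka_def)
        have la_nu: "la(j := Suc (la j)) = nu" using j by (auto simp: la_def ka_def nu_def)
        have la_j: "la j < mu j" using j by (simp add: la_def ka_def)
        have size_ka: "Suc (psize ?N ka) = psize ?N mu" using psize_rem[of j ?N mu, OF j(1,3)] by (simp add: ka_def)
        have size_la: "psize ?N la = psize ?N mu" using psize_add[OF k, of ka] size_ka by (simp add: la_def)
        have b0: "binom ?N c kap mu = 0" if "kap \<in> partitions ?N" "kap j < mu j" for kap
          using that j(1) by (intro EV mu) (auto simp: contains_def not_le)
        have "(\<Sum>i\<in>{1..?N}. (1 + 0 * xU (int (la i)) (int ?N - int i)) * shift_coeff ?N c rU 1 la i *
              (binom ?N c (la(i := Suc (la i))) mu - binom ?N c la mu) +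
            (1 + 0 * xL (int (la i)) (int ?N - int i)) * shift_coeff ?N c rL (-1) la i *
              (binom ?N c (la(i := la i - 1)) mu - binom ?N c la mu)) =
          (\<Sum>i\<in>{1..?N}. if i = j then shift_coeff ?N c rU 1 la j * binom ?N c nu mu else 0)"
        proof (intro sum.cong refl)
          fix i assume i: "i \<in> {1..?N}"
          have "shift_coeff ?N c rL (-1) la i * (binom ?N c (la(i := la i - 1)) mu - binom ?N c la mu) = 0"
          proof (cases "la i = 0 \<or> la(i := la i - 1) \<notin> partitions ?N")
            case True
            then show ?thesis using shift_coeff_rem_zero[where r = rL and c = c, OF la i rL0] by simp
          next
            case False
            have "(la(i := la i - 1)) j < mu j" using la_j by (cases "i = j") auto
            then have "binom ?N c (la(i := la i - 1)) mu = 0" using False b0 by blast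
            then show ?thesis using b0[OF la la_j] by simp
          qed
          moreover have "shift_coeff ?N c rU 1 la i * binom ?N c (la(i := Suc (la i))) mu = 0" if "i \<noteq> j"
          proof (cases "la(i := Suc (la i)) \<in> partitions ?N")
            case False
            then show ?thesis using shift_coeff_add_zero[OF la i False, of c rU] by simp
          next
            case True
            then show ?thesis using b0[OF True] that la_j by simp
          qed
          ultimately show "(1 + 0 * xU (int (la i)) (int ?N - int i)) * shift_coeff ?N c rU 1 la i *
              (binom ?N c (la(i := Suc (la i))) mu - binom ?N c la mu) +
            (1 + 0 * xL (int (la i)) (int ?N - int i)) * shift_coeff ?N c rL (-1) la i *
              (binom ?N c (la(i := la i - 1)) mu - binom ?N c la mu) =
            (if i = j then shift_coeff ?N c rU 1 la j * binom ?N c nu mu else 0)"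
            using b0[OF la la_j] la_nu by (auto simp del: fun_upd_apply)
        qed
        also have "\<dots> = shift_coeff ?N c rU 1 la j * binom ?N c nu mu" using j(1) by simp
        finally have "shift_coeff ?N c rU 1 la j * binom ?N c nu mu =
          (\<Sum>i | i \<in> {1..?N} \<and> 0 < mu i \<and> mu(i := mu i - 1) \<in> partitions ?N.
            shift_coeff ?N c rU 1 (mu(i := mu i - 1)) i * binom ?N c la (mu(i := mu i - 1)))"
          using interp_expansion[OF N(2) la mu, of 1 0] by simp
        also have "\<dots> = (\<Sum>i | i \<in> {1..?N} \<and> 0 < mu i \<and> mu(i := mu i - 1) \<in> partitions ?N.
            if i = j then shift_coeff ?N c rU 1 ka j * binom ?N c la ka else 0)"
        proof (intro sum.cong refl)
          fix i assume "i \<in> {i. i \<in> {1..?N} \<and> 0 < mu i \<and> mu(i := mu i - 1) \<in> partitions ?N}"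
          then have i: "mu(i := mu i - 1) \<in> partitions ?N" by auto
          have "binom ?N c la (mu(i := mu i - 1)) = 0" if "i \<noteq> j"
          proof (rule EV[OF la i])
            show "\<not> contains ?N la (mu(i := mu i - 1))"
              using that j(1) la_j unfolding contains_def by (auto intro!: bexI[of _ j])
          qed
          then show "shift_coeff ?N c rU 1 (mu(i := mu i - 1)) i * binom ?N c la (mu(i := mu i - 1)) =
            (if i = j then shift_coeff ?N c rU 1 ka j * binom ?N c la ka else 0)"
            by (simp add: ka_def)
        qed
        also have "\<dots> = shift_coeff ?N c rU 1 ka j * binom ?N c la ka" using j by simp
        finally have eq: "shift_coeff ?N c rU 1 la j * binom ?N c nu mu = shift_coeff ?N c rU 1 ka j * binom ?N c la ka" .
        have "binom ?N c la ka \<in> P"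
          unfolding la_def using size_ka less.prems(4) la
          by (intro less.IH[OF _ ka k _ refl]) (auto simp: la_def simp del: fun_upd_apply)
        moreover have "shift_coeff ?N c rU 1 ka j \<in> P"
          using mu ka_mu j(1) by (intro shift_coeff_add_pos[OF ka j(1)] rU) auto
        moreover have U: "shift_coeff ?N c rU 1 la j \<in> P"
          using nu la_nu j(1) by (intro shift_coeff_add_pos[OF la j(1)] rU) auto
        moreover have "shift_coeff ?N c rU 1 la j \<noteq> 0" using U zero_notin by metis
        then have "binom ?N c nu mu = shift_coeff ?N c rU 1 ka j * binom ?N c la ka / shift_coeff ?N c rU 1 la j"
          unfolding eq[symmetric] by simp
        ultimately show ?thesis by (metis divide_in mult_in)
      next
        case nex: False
        \<comment> \<open>Otherwise a box of the last row could be removed from both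
          partitions.\<close>
        have kN: "k = ?N"
        proof (rule ccontr)
          assume ne: "k \<noteq> ?N"
          then have "mu ?N = nu ?N" by (simp add: nu_def)
          moreover have "mu(?N := mu ?N - 1) \<in> partitions ?N" by (rule rem_box_partition[OF mu N(1)]) simp
          moreover have "nu(?N := nu ?N - 1) \<in> partitions ?N" by (rule rem_box_partition[OF nu N(1)]) simp
          moreover have "nu(?N := nu ?N - 1) = mu(?N := mu ?N - 1, k := Suc (mu k))"
            using ne by (auto simp: nu_def)
          ultimately have "?N \<noteq> k \<and> 0 < mu ?N \<and> mu(?N := mu ?N - 1) \<in> partitions ?N \<and>
              mu(?N := mu ?N - 1, k := Suc (mu k)) \<in> partitions ?N"
            using ne False by (metis neq0_conv)
          then show False using nex N(1) by blast
        qed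
        define M where "M = nu ?N"
        have rect: "nu i = M" if i: "i \<in> {1..?N}" for i
        proof (rule ccontr)
          assume "nu i \<noteq> M"
          moreover have "M \<le> nu i" unfolding M_def using i by (intro partitionsD(1)[OF nu]) auto
          ultimately have lt: "M < nu i" by simp
          define re where "re i = (if i \<in> {1..?N} then M else 0)" for i
          have "re \<in> partitions ?N" by (rule partitionsI) (auto simp: re_def)
          from exists_removable[OF nu this i] lt i obtain j where
            j: "j \<in> {1..?N}" "re j < nu j" "nu(j := nu j - 1) \<in> partitions ?N" by (auto simp: re_def)
          have Mj: "M < nu j" using j by (simp add: re_def)
          then have jN: "j \<noteq> ?N" by (auto simp: M_def)
          then have muj: "mu j = nu j" using kN by (simp add: nu_def)
          have "(nu(j := nu j - 1)) (j + 1) \<le> (nu(j := nu j - 1)) j"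
            using jN j(1) by (intro partitionsD(1)[OF j(3)]) auto
          then have "nu (j + 1) < nu j" using Mj by auto
          moreover have "mu (j + 1) \<le> nu (j + 1)" by (simp add: nu_def)
          ultimately have "mu(j := mu j - 1) \<in> partitions ?N"
            using muj by (intro rem_box_partition[OF mu j(1)]) auto
          moreover have "nu(j := nu j - 1) = mu(j := mu j - 1, k := Suc (mu k))"
            using jN kN by (auto simp: nu_def)
          moreover have "0 < mu j" using muj Mj by simp
          ultimately have "j \<noteq> k \<and> 0 < mu j \<and> mu(j := mu j - 1) \<in> partitions ?N \<and>
              mu(j := mu j - 1, k := Suc (mu k)) \<in> partitions ?N"
            using j(3) kN jN by metis
          then show False using nex j(1) by blast
        qed
        have M: "M > 0" using False by (simp add: M_def)
        have mu_eq: "mu = nu(?N := nu ?N - 1)" by (auto simp: nu_def kN)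
        have muN: "mu ?N = M - 1" by (simp add: M_def nu_def kN)
        have norem: "nu(i := nu i - 1) \<notin> partitions ?N" if i: "i \<in> {1..?N}" "i \<noteq> ?N" for i
        proof
          assume a: "nu(i := nu i - 1) \<in> partitions ?N"
          have "(nu(i := nu i - 1)) (i + 1) \<le> (nu(i := nu i - 1)) i"
            by (rule partitionsD(1)[OF a]) (use i in auto)
          moreover have "nu (i + 1) = M" "nu i = M" using rect[of i] rect[of "i + 1"] i by auto
          ultimately show False using M by simp
        qed
        have noadd: "nu(i := Suc (nu i)) \<notin> partitions ?N" if i: "i \<in> {1..?N}" "i \<noteq> 1" for i
        proof
          assume a: "nu(i := Suc (nu i)) \<in> partitions ?N"
          have "(nu(i := Suc (nu i))) i \<le> (nu(i := Suc (nu i))) (i - 1)"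
            by (rule partitionsD(1)[OF a]) (use i in auto)
          moreover have "i - 1 \<in> {1..?N}" "i - 1 \<noteq> i" using i by auto
          then have "nu (i - 1) = M" "nu i = M" "i - 1 \<noteq> i" using rect i(1) by auto
          ultimately show False by simp
        qed
        \<comment> \<open>The rectangle can gain a box only in row 1 and lose one only in the last
          row. Here \<open>p = x - x1\<close> vanishes at row 1, and \<open>A\<close> and
          \<open>C\<close> are the values of \<open>- p\<close> at the mirror image of the last row
          of \<open>nu\<close> and at the last row of \<open>mu\<close>. Both are positive, and
          \<open>rL\<close> is negative at the corner.\<close>
        define x1 where "x1 = xU (int M) (int ?N - 1)"
        define A where "A = x1 - xL (int M) 0"
        define C where "C = x1 - xU (int (M - 1)) 0"
        have b_nu: "binom ?N c nu nu = 1" using binom_delta[OF distinct nu, of nu] by simp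
        have size_mu: "Suc (psize ?N mu) = psize ?N nu" using psize_add[OF k, of mu] by (simp add: nu_def)
        have b_mu: "binom ?N c mu nu = 0"
          using binom_delta[OF distinct mu, of nu] size_mu by auto
        have "(\<Sum>i\<in>{1..?N}. (- x1 + 1 * xU (int (nu i)) (int ?N - int i)) * shift_coeff ?N c rU 1 nu i *
              (binom ?N c (nu(i := Suc (nu i))) nu - binom ?N c nu nu) +
            (- x1 + 1 * xL (int (nu i)) (int ?N - int i)) * shift_coeff ?N c rL (-1) nu i *
              (binom ?N c (nu(i := nu i - 1)) nu - binom ?N c nu nu)) =
          (\<Sum>i\<in>{1..?N}. if i = ?N then A * shift_coeff ?N c rL (-1) nu ?N else 0)"
        proof (intro sum.cong refl)
          fix i assume i: "i \<in> {1..?N}"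
          have "(- x1 + 1 * xU (int (nu i)) (int ?N - int i)) * shift_coeff ?N c rU 1 nu i = 0"
          proof (cases "i = 1")
            case True
            then show ?thesis using rect[OF i] by (simp add: x1_def)
          next
            case False
            then show ?thesis using shift_coeff_add_zero[OF nu i noadd[OF i False], of c rU] by simp
          qed
          moreover have "shift_coeff ?N c rL (-1) nu i = 0" if "i \<noteq> ?N"
            using shift_coeff_rem_zero[where r = rL and c = c, OF nu i rL0] norem[OF i that] by blast
          ultimately show "(- x1 + 1 * xU (int (nu i)) (int ?N - int i)) * shift_coeff ?N c rU 1 nu i *
              (binom ?N c (nu(i := Suc (nu i))) nu - binom ?N c nu nu) +
            (- x1 + 1 * xL (int (nu i)) (int ?N - int i)) * shift_coeff ?N c rL (-1) nu i *
              (binom ?N c (nu(i := nu i - 1)) nu - binom ?N c nu nu) =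
            (if i = ?N then A * shift_coeff ?N c rL (-1) nu ?N else 0)"
            using b_nu b_mu mu_eq rect[OF i] by (auto simp: A_def algebra_simps simp del: fun_upd_apply)
        qed
        also have "\<dots> = A * shift_coeff ?N c rL (-1) nu ?N" by simp
        finally have "A * shift_coeff ?N c rL (-1) nu ?N =
          (\<Sum>i | i \<in> {1..?N} \<and> 0 < nu i \<and> nu(i := nu i - 1) \<in> partitions ?N.
            (- x1 + 1 * xU (int ((nu(i := nu i - 1)) i)) (int ?N - int i)) *
            shift_coeff ?N c rU 1 (nu(i := nu i - 1)) i * binom ?N c nu (nu(i := nu i - 1)))"
          using interp_expansion[OF N(2) nu nu, of "- x1" 1] by (simp only:)
        also have "{i. i \<in> {1..?N} \<and> 0 < nu i \<and> nu(i := nu i - 1) \<in> partitions ?N} = {?N}"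
          using norem mu M by (auto simp: mu_eq[symmetric] M_def)
        also have "(\<Sum>i\<in>{?N}. (- x1 + 1 * xU (int ((nu(i := nu i - 1)) i)) (int ?N - int i)) *
            shift_coeff ?N c rU 1 (nu(i := nu i - 1)) i * binom ?N c nu (nu(i := nu i - 1)))
          = - C * shift_coeff ?N c rU 1 mu ?N * binom ?N c nu mu"
          by (simp add: mu_eq[symmetric] C_def muN)
        finally have eq: "C * shift_coeff ?N c rU 1 mu ?N * binom ?N c nu mu = A * - shift_coeff ?N c rL (-1) nu ?N"
          by (simp only: minus_mult_left[symmetric] minus_mult_right[symmetric] minus_equation_iff equation_minus_iff minus_minus)
        have "A \<in> P" unfolding A_def x1_def using M by (intro xL) auto
        moreover have "C \<in> P" unfolding C_def x1_def using M by (intro xU) auto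
        moreover have "shift_coeff ?N c rU 1 mu ?N \<in> P"
          using nu kN by (intro shift_coeff_add_pos[OF mu N(1)] rU) (auto simp: nu_def)
        moreover have "- shift_coeff ?N c rL (-1) nu ?N \<in> P"
        proof -
          have rem: "nu(?N := nu ?N - 1) \<in> partitions ?N" using mu mu_eq by metis
          have "shift_coeff ?N c (\<lambda>m j. - rL m j) (-1) nu ?N \<in> P"
            by (intro shift_coeff_rem_pos[OF nu N(1) _ rem]) (use M rL[of "int M"] in \<open>auto simp: M_def\<close>)
          then show ?thesis by (simp add: shift_coeff_def)
        qed
        moreover have "binom ?N c nu mu = A * - shift_coeff ?N c rL (-1) nu ?N / (C * shift_coeff ?N c rU 1 mu ?N)"
        proof -
          have "C \<noteq> 0" "shift_coeff ?N c rU 1 mu ?N \<noteq> 0" using calculation zero_notin by metis+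
          then show ?thesis unfolding eq[symmetric] by simp
        qed
        ultimately show ?thesis by (metis divide_in mult_in)
      qed
    qed
    then show ?case unfolding nu_def .
  qed
qed

text \<open>Induction on the number of boxes by which \<open>lam\<close> exceeds \<open>mu\<close>.
  Subtracting the value at \<open>mu\<close> removes the term of \<open>mu\<close> itself, so each
  \<open>ka\<close> has one box more. By \<open>extra_vanishing\<close> only \<open>ka\<close>
  between \<open>mu\<close> and \<open>lam\<close> contribute, with factors positive by
  \<open>adjacent_positivity\<close> and by induction.\<close>

theorem type_B_positivity:
  assumes B: "type_B_grid P c" and lam: "lam \<in> partitions n" and mu: "mu \<in> partitions n" and con: "contains n lam mu"
  shows "binom n c lam mu \<in> P"
proof -
  obtain rU rL xU xL where "type_B P c rU rL xU xL" using type_B_gridE[OF B] .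
  then interpret type_B P c rU rL xU xL .
  define Y where "Y kap = (\<Sum>i\<in>{1..n}. grid_point n c kap i)" for kap
  have Ypos: "Y kap - Y ka \<in> P" if "kap \<in> partitions n" "ka \<in> partitions n" "contains n kap ka" "kap \<noteq> ka" for kap ka
    using sum_grid_point_strict_mono[OF that] by (simp add: Y_def)
  show ?thesis using mu con
  proof (induction "psize n lam - psize n mu" arbitrary: mu rule: less_induct)
    case less
    note mu = less.prems(1) and con = less.prems(2)
    show ?case
    proof (cases "lam = mu")
      case True
      then show ?thesis using binom_delta[OF distinct lam, of mu] one_in by simp
    next
      case False
      have size: "psize n mu < psize n lam"
        using contains_psize_eq[OF lam mu con] False by linarith
      define V where "V = {ka \<in> partitions n. psize n ka = Suc (psize n mu)}"
      have finV: "finite V"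
        by (rule finite_subset[OF _ finite_partitions_le[of n "Suc (psize n mu)"]]) (auto simp: V_def)
      define w where "w ka = (Y ka - Y mu) * binom n c ka mu" for ka
      have pieri: "(Y lam - Y mu) * binom n c lam mu - (\<Sum>ka\<in>V. w ka * binom n c lam ka) = 0"
        unfolding Y_def binom_def[of n c lam]
      proof (rule sympoly_unique[OF distinct])
        have "sympoly n (Suc (psize n mu)) (\<lambda>y. ((\<Sum>i\<in>{1..n}. y i) - (\<Sum>i\<in>{1..n}. grid_point n c mu i)) * interp n c mu y)"
          by (intro sympoly_mult_le[OF sympoly_diff[OF sympoly_sum_coords sympoly.const] interp(1)[OF distinct]]) simp
        moreover have "sympoly n (Suc (psize n mu)) (\<lambda>y. w ka * interp n c ka y)" if "ka \<in> V" for ka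
          using sympoly_cmult[OF interp(1)[OF distinct, of n ka]] that by (simp add: V_def)
        ultimately show "sympoly n (Suc (psize n mu))
          (\<lambda>y. ((\<Sum>i\<in>{1..n}. y i) - (\<Sum>i\<in>{1..n}. grid_point n c mu i)) * interp n c mu y - (\<Sum>ka\<in>V. w ka * interp n c ka y))"
          by (intro sympoly_diff sympoly_sum)
      next
        fix kap assume kap: "kap \<in> partitions n" "psize n kap \<le> Suc (psize n mu)"
        have "(\<Sum>ka\<in>V. w ka * interp n c ka (grid_point n c kap)) = (\<Sum>ka\<in>V. if ka = kap then w kap else 0)"
        proof (intro sum.cong refl)
          fix ka assume "ka \<in> V"
          then have "binom n c kap ka = (if kap = ka then 1 else 0)"
            using kap by (intro binom_delta[OF distinct]) (auto simp: V_def)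
          then show "w ka * interp n c ka (grid_point n c kap) = (if ka = kap then w kap else 0)"
            by (auto simp: binom_def)
        qed
        also have "\<dots> = (if kap \<in> V then w kap else 0)" using finV by simp
        also have "\<dots> = w kap"
        proof (cases "kap \<in> V")
          case False
          then have "psize n kap \<le> psize n mu" using kap by (auto simp: V_def)
          then show ?thesis using binom_delta[OF distinct kap(1), of mu] by (auto simp: w_def)
        qed simp
        finally show "(sum (grid_point n c kap) {1..n} - sum (grid_point n c mu) {1..n}) * interp n c mu (grid_point n c kap) -
          (\<Sum>ka\<in>V. w ka * interp n c ka (grid_point n c kap)) = 0"
          by (simp add: w_def Y_def binom_def)
      qed
      have adj: "w ka \<in> P" if ka: "ka \<in> V" "contains n ka mu" for ka
      proof -
        have ka': "ka \<in> partitions n" "psize n ka = Suc (psize n mu)" "ka \<noteq> mu" using ka by (auto simp: V_def)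
        obtain k where "k \<in> {1..n}" "mu k < ka k"
          using partitions_eqI[OF ka'(1) mu] ka(2) ka'(3) unfolding contains_def by (metis le_neq_implies_less)
        from exists_removable[OF ka'(1) mu this] obtain i where
          i: "i \<in> {1..n}" "mu i < ka i" "ka(i := ka i - 1) \<in> partitions n" .
        have "contains n (ka(i := ka i - 1)) mu" using ka(2) i by (auto simp: contains_def)
        moreover have "psize n (ka(i := ka i - 1)) \<le> psize n mu"
          using psize_rem[of i n ka] i ka'(2) by simp
        ultimately have "ka(i := ka i - 1) = mu" using contains_psize_eq[OF i(3) mu] by blast
        then have "ka = mu(i := Suc (mu i))" using i(2) by (auto simp: fun_eq_iff split: if_splits)
        then have "binom n c ka mu \<in> P" using adjacent_positivity[OF B mu i(1)] ka'(1) by simp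
        then show ?thesis unfolding w_def using Ypos[OF ka'(1) mu ka(2) ka'(3)] by (intro mult_in)
      qed
      have IH: "binom n c lam ka \<in> P" if "ka \<in> V" "contains n lam ka" for ka
        using that size by (intro less.hyps) (auto simp: V_def)
      have w0: "w ka = 0" if "ka \<in> V" "\<not> contains n ka mu" for ka
        using extra_vanishing[OF B _ mu that(2)] that(1) by (simp add: w_def V_def)
      have b0: "binom n c lam ka = 0" if "ka \<in> V" "\<not> contains n lam ka" for ka
        using extra_vanishing[OF B lam _ that(2)] that(1) by (simp add: V_def)
      have terms: "w ka * binom n c lam ka \<in> insert 0 P" if "ka \<in> V" for ka
        using adj[OF that] IH[OF that] w0[OF that] b0[OF that] mult_in
        by (cases "contains n ka mu"; cases "contains n lam ka") auto
      \<comment> \<open>At least one term has to be nonzero: boxes are removed from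
        \<open>lam\<close> until it has only one more than \<open>mu\<close>.\<close>
      obtain ka where ka: "ka \<in> V" "contains n ka mu" "contains n lam ka"
      proof -
        have "\<exists>ka\<in>partitions n. psize n ka = Suc (psize n mu) \<and> contains n ka mu \<and> contains n kap ka"
          if "kap \<in> partitions n" "contains n kap mu" "psize n mu < psize n kap" for kap
          using that
        proof (induction "psize n kap" arbitrary: kap rule: less_induct)
          case less
          show ?case
          proof (cases "psize n kap = Suc (psize n mu)")
            case True
            then show ?thesis using less.prems by (auto simp: contains_def)
          next
            case False
            have "kap \<noteq> mu" using less.prems by auto
            then obtain k where "k \<in> {1..n}" "mu k < kap k"
              using partitions_eqI[OF less.prems(1) mu] less.prems(2) unfolding contains_def by (metis le_neq_implies_less)
            from exists_removable[OF less.prems(1) mu this] obtain i where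
              i: "i \<in> {1..n}" "mu i < kap i" "kap(i := kap i - 1) \<in> partitions n" .
            have sz: "Suc (psize n (kap(i := kap i - 1))) = psize n kap" using psize_rem[of i n kap] i by simp
            have "contains n (kap(i := kap i - 1)) mu" using less.prems(2) i by (auto simp: contains_def)
            then obtain ka where ka: "ka \<in> partitions n" "psize n ka = Suc (psize n mu)" "contains n ka mu"
                "contains n (kap(i := kap i - 1)) ka"
              using less.hyps[OF _ i(3)] sz False less.prems(3) by (metis Suc_lessI lessI not_less_eq)
            have "contains n kap ka" unfolding contains_def
            proof
              fix j assume "j \<in> {1..n}"
              then have "ka j \<le> (kap(i := kap i - 1)) j" using ka(4) unfolding contains_def by blast
              also have "\<dots> \<le> kap j" by simp
              finally show "ka j \<le> kap j" .
            qed
            then show ?thesis using ka by blast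
          qed
        qed
        from this[OF lam con size] show ?thesis using that by (auto simp: V_def)
      qed
      have "(\<Sum>ka\<in>V. w ka * binom n c lam ka) \<in> P"
        using finV terms ka adj IH by (intro sum_pos[of _ _ ka] mult_in) auto
      moreover have Yp: "Y lam - Y mu \<in> P" using Ypos[OF lam mu con False] .
      moreover have "Y lam - Y mu \<noteq> 0" using Yp zero_notin by metis
      then have "binom n c lam mu = (\<Sum>ka\<in>V. w ka * binom n c lam ka) / (Y lam - Y mu)"
        using pieri by (simp add: field_simps)
      ultimately show ?thesis using divide_in by metis
    qed
  qed
qed

section \<open>The four grids\<close>

text \<open>If \<open>X\<close> and \<open>X'\<close> are the two roots of a quadratic polynomial over the ring generated by \<open>c\<close>, then
  \<open>(R + S X) - (R + S X') = S (X - X')\<close>, which cancels the denominator \<open>X - X'\<close>.\<close>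

lemma polynomial_shift_quadratic:
  fixes c X X' g g' :: "int \<Rightarrow> int \<Rightarrow> 'a::field"
  assumes X: "\<And>m j. 0 \<le> m \<Longrightarrow> 0 \<le> j \<Longrightarrow> X m j * X m j = poly u (c m j) * X m j + poly v (c m j)"
      "\<And>m j. 0 \<le> m \<Longrightarrow> 0 \<le> j \<Longrightarrow> X' m j * X' m j = poly u (c m j) * X' m j + poly v (c m j)"
    and A: "\<And>m j. 0 \<le> m \<Longrightarrow> 0 \<le> j \<Longrightarrow> c (m + 1) j = poly A (c m j) + a * X m j"
      "\<And>m j. 0 \<le> m \<Longrightarrow> 0 \<le> j \<Longrightarrow> c (m - 1) j = poly A (c m j) + a * X' m j"
    and B: "\<And>m j. 0 \<le> m \<Longrightarrow> 0 \<le> j \<Longrightarrow> c m (j + 1) = poly B (c m j) + b * X m j"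
      "\<And>m j. 0 \<le> m \<Longrightarrow> 0 \<le> j \<Longrightarrow> c m (j - 1) = poly B (c m j) + b * X' m j"
    and G: "\<And>m j. 0 \<le> m \<Longrightarrow> 0 \<le> j \<Longrightarrow> g m j = poly G (c m j) + e * X m j"
      "\<And>m j. 0 \<le> m \<Longrightarrow> 0 \<le> j \<Longrightarrow> g' m j = poly G (c m j) + e * X' m j"
    and deg: "degree u \<le> 1" "degree v \<le> 1" "degree A \<le> 1" "degree B \<le> 1" "degree G \<le> 1"
    and ne: "\<And>m j. 0 \<le> m \<Longrightarrow> 0 \<le> j \<Longrightarrow> X m j \<noteq> X' m j"
      "\<And>m j. 0 \<le> m \<Longrightarrow> 0 \<le> j \<Longrightarrow> c (m + 1) j \<noteq> c m j"
      "\<And>m j. 0 \<le> m \<Longrightarrow> 0 \<le> j \<Longrightarrow> c (m - 1) j \<noteq> c m j"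
  shows "polynomial_shift 0 c (\<lambda>m j. g m j / ((X m j - X' m j) * (c (m + 1) j - c m j)))
     (\<lambda>m j. g' m j / ((X' m j - X m j) * (c (m - 1) j - c m j)))"
proof -
  \<comment> \<open>\<open>T\<close> and \<open>T'\<close> are conjugate: the same \<open>R\<close>
    and \<open>S\<close>, with \<open>X\<close> and \<open>X'\<close> exchanged. If \<open>X\<close>
    counts as degree 1, the total degree is at most \<open>Suc D\<close>, and each linear factor
    raises it by one.\<close>
  define Q where "Q D T T' \<longleftrightarrow> (\<exists>R S. degree R \<le> Suc D \<and> degree S \<le> D \<and> (\<forall>m\<ge>0. \<forall>j\<ge>0.
    T m j = poly R (c m j) + poly S (c m j) * X m j \<and> T' m j = poly R (c m j) + poly S (c m j) * X' m j))"
    for D and T T' :: "int \<Rightarrow> int \<Rightarrow> 'a"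
  have Q_mult: "Q (Suc D) (\<lambda>m j. T m j * w m j) (\<lambda>m j. T' m j * w' m j)"
    if "Q D T T'" and w: "\<And>m j. 0 \<le> m \<Longrightarrow> 0 \<le> j \<Longrightarrow> w m j = poly W (c m j) + h * X m j"
      "\<And>m j. 0 \<le> m \<Longrightarrow> 0 \<le> j \<Longrightarrow> w' m j = poly W (c m j) + h * X' m j" "degree W \<le> 1" for D T T' w w' W h
  proof -
    obtain R S where RS: "degree R \<le> Suc D" "degree S \<le> D"
      "\<And>m j. 0 \<le> m \<Longrightarrow> 0 \<le> j \<Longrightarrow> T m j = poly R (c m j) + poly S (c m j) * X m j"
      "\<And>m j. 0 \<le> m \<Longrightarrow> 0 \<le> j \<Longrightarrow> T' m j = poly R (c m j) + poly S (c m j) * X' m j"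
      using \<open>Q D T T'\<close> unfolding Q_def by blast
    define R' where "R' = R * W + smult h (S * v)"
    define S' where "S' = smult h R + S * W + smult h (S * u)"
    have "degree (R * W) \<le> Suc (Suc D)" "degree (S * v) \<le> Suc (Suc D)" "degree (S * W) \<le> Suc D" "degree (S * u) \<le> Suc D"
      using RS(1,2) deg w(3) degree_mult_le[of R W] degree_mult_le[of S v] degree_mult_le[of S W] degree_mult_le[of S u]
      by linarith+
    then have "degree R' \<le> Suc (Suc D)" "degree S' \<le> Suc D"
      unfolding R'_def S'_def using RS(1)
      by (auto intro!: degree_add_le intro: order.trans[OF degree_smult_le])
    moreover have "T m j * w m j = poly R' (c m j) + poly S' (c m j) * X m j"
      "T' m j * w' m j = poly R' (c m j) + poly S' (c m j) * X' m j" if "0 \<le> m" "0 \<le> j" for m j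
    proof -
      have alg: "(r + s * x) * (p + h * x) = (r * p + h * (s * vv)) + (h * r + s * p + h * (s * uu)) * x"
        if "x * x = uu * x + vv" for x r s p uu vv :: 'a
      proof -
        have "(r + s * x) * (p + h * x) = r * p + (h * r + s * p) * x + h * s * (x * x)" by (simp add: algebra_simps)
        then show ?thesis unfolding that by (simp add: algebra_simps)
      qed
      show "T m j * w m j = poly R' (c m j) + poly S' (c m j) * X m j"
        using that alg[OF X(1)[OF that]] by (simp add: RS(3) w(1) R'_def S'_def)
      show "T' m j * w' m j = poly R' (c m j) + poly S' (c m j) * X' m j"
        using that alg[OF X(2)[OF that]] by (simp add: RS(4) w(2) R'_def S'_def)
    qed
    ultimately show ?thesis unfolding Q_def by blast
  qed
  have Q0: "Q 0 g g'"
    unfolding Q_def using G deg(5) by (intro exI[of _ G] exI[of _ "[:e:]"]) simp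
  have Qi: "Q i (\<lambda>m j. g m j * c (m + 1) j ^ i) (\<lambda>m j. g' m j * c (m - 1) j ^ i)" for i
  proof (induction i)
    case 0
    then show ?case using Q0 by simp
  next
    case (Suc i)
    from Q_mult[OF this A(1,2) deg(3)] show ?case by (simp add: mult_ac)
  qed
  have Qik: "Q (i + k) (\<lambda>m j. g m j * c (m + 1) j ^ i * c m (j + 1) ^ k) (\<lambda>m j. g' m j * c (m - 1) j ^ i * c m (j - 1) ^ k)" for i k
  proof (induction k)
    case 0
    then show ?case using Qi by simp
  next
    case (Suc k)
    from Q_mult[OF this B(1,2) deg(4)] show ?case by (simp add: mult_ac)
  qed
  show ?thesis unfolding polynomial_shift_def
  proof (intro allI)
    fix d k :: nat
    have "\<forall>i. \<exists>S. degree S \<le> i + k \<and> (\<forall>m\<ge>0. \<forall>j\<ge>0.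
       g m j * c (m + 1) j ^ i * c m (j + 1) ^ k - g' m j * c (m - 1) j ^ i * c m (j - 1) ^ k = poly S (c m j) * (X m j - X' m j))"
    proof
      fix i
      obtain R S where RS: "degree S \<le> i + k"
        "\<And>m j. 0 \<le> m \<Longrightarrow> 0 \<le> j \<Longrightarrow> g m j * c (m + 1) j ^ i * c m (j + 1) ^ k = poly R (c m j) + poly S (c m j) * X m j"
        "\<And>m j. 0 \<le> m \<Longrightarrow> 0 \<le> j \<Longrightarrow> g' m j * c (m - 1) j ^ i * c m (j - 1) ^ k = poly R (c m j) + poly S (c m j) * X' m j"
        using Qik[of i k] unfolding Q_def by blast
      then show "\<exists>S. degree S \<le> i + k \<and> (\<forall>m\<ge>0. \<forall>j\<ge>0.
       g m j * c (m + 1) j ^ i * c m (j + 1) ^ k - g' m j * c (m - 1) j ^ i * c m (j - 1) ^ k = poly S (c m j) * (X m j - X' m j))"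
        by (intro exI[of _ S]) (auto simp: right_diff_distrib)
    qed
    then obtain S where "\<forall>i. degree (S i) \<le> i + k \<and> (\<forall>m\<ge>0. \<forall>j\<ge>0.
       g m j * c (m + 1) j ^ i * c m (j + 1) ^ k - g' m j * c (m - 1) j ^ i * c m (j - 1) ^ k = poly (S i) (c m j) * (X m j - X' m j))"
      unfolding choice_iff by blast
    then have S: "\<And>i. degree (S i) \<le> i + k" "\<And>i m j. 0 \<le> m \<Longrightarrow> 0 \<le> j \<Longrightarrow>
       g m j * c (m + 1) j ^ i * c m (j + 1) ^ k - g' m j * c (m - 1) j ^ i * c m (j - 1) ^ k = poly (S i) (c m j) * (X m j - X' m j)"
      by blast+
    \<comment> \<open>The difference of two powers is the difference of the bases times a geometric
      sum. That difference cancels in the denominator, and the summands are the conjugate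
      differences described by \<open>S\<close>.\<close>
    define R where "R = (\<Sum>i<Suc d. monom 1 (d - i) * S i)"
    have "degree (monom 1 (d - i) * S i) \<le> d + k" if "i < Suc d" for i
      using degree_mult_le[of "monom 1 (d - i)" "S i"] degree_monom_le[of "1::'a" "d - i"] S(1)[of i] that by linarith
    then have "degree R \<le> d + 0 + k" unfolding R_def by (intro degree_sum_le) auto
    moreover have "g m j / ((X m j - X' m j) * (c (m + 1) j - c m j)) * (c (m + 1) j ^ Suc d - c m j ^ Suc d) * c m (j + 1) ^ k +
        g' m j / ((X' m j - X m j) * (c (m - 1) j - c m j)) * (c (m - 1) j ^ Suc d - c m j ^ Suc d) * c m (j - 1) ^ k = poly R (c m j)"
      if mj: "0 \<le> m" "0 \<le> j" for m j
    proof -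
      define Z where "Z = X m j - X' m j"
      have Z: "Z \<noteq> 0" "X' m j - X m j = - Z" using ne(1)[OF mj] by (auto simp: Z_def)
      have 1: "g m j / (Z * (c (m + 1) j - c m j)) * (c (m + 1) j ^ Suc d - c m j ^ Suc d) * c m (j + 1) ^ k
          = g m j * (\<Sum>i<Suc d. c (m + 1) j ^ i * c m j ^ (d - i)) * c m (j + 1) ^ k / Z"
        using ne(2)[OF mj] by (simp add: diff_power_eq_sum del: power_Suc sum.lessThan_Suc)
      have 2: "g' m j / (- Z * (c (m - 1) j - c m j)) * (c (m - 1) j ^ Suc d - c m j ^ Suc d) * c m (j - 1) ^ k
          = - (g' m j * (\<Sum>i<Suc d. c (m - 1) j ^ i * c m j ^ (d - i)) * c m (j - 1) ^ k / Z)"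
        using ne(3)[OF mj] by (simp add: diff_power_eq_sum del: power_Suc sum.lessThan_Suc)
      have "poly R (c m j) = (\<Sum>i<Suc d. c m j ^ (d - i) * (poly (S i) (c m j) * Z)) / Z"
        using Z by (simp add: R_def poly_sum poly_monom sum_divide_distrib del: sum.lessThan_Suc)
      also have "\<dots> = (\<Sum>i<Suc d. c m j ^ (d - i) *
          (g m j * c (m + 1) j ^ i * c m (j + 1) ^ k - g' m j * c (m - 1) j ^ i * c m (j - 1) ^ k)) / Z"
        by (simp add: S(2)[OF mj] Z_def del: sum.lessThan_Suc)
      also have "\<dots> = g m j * (\<Sum>i<Suc d. c (m + 1) j ^ i * c m j ^ (d - i)) * c m (j + 1) ^ k / Z
         - g' m j * (\<Sum>i<Suc d. c (m - 1) j ^ i * c m j ^ (d - i)) * c m (j - 1) ^ k / Z"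
        unfolding diff_divide_distrib[symmetric] sum_distrib_left sum_distrib_right sum_subtractf[symmetric]
        by (intro arg_cong2[where f = "(/)"] sum.cong refl) (simp add: algebra_simps)
      finally show ?thesis unfolding Z(2) Z_def[symmetric] using 1 2 by simp
    qed
    ultimately show "\<exists>R. degree R \<le> d + 0 + k \<and> (\<forall>m\<ge>0. \<forall>j\<ge>0.
        g m j / ((X m j - X' m j) * (c (m + 1) j - c m j)) * (c (m + 1) j ^ Suc d - c m j ^ Suc d) * c m (j + 1) ^ k +
        g' m j / ((X' m j - X m j) * (c (m - 1) j - c m j)) * (c (m - 1) j ^ Suc d - c m j ^ Suc d) * c m (j - 1) ^ k = poly R (c m j))"
      by blast
  qed
qed

section \<open>Coordinates of Jack and Macdonald type\<close>

definition jack_x :: "'a::field \<Rightarrow> 'a \<Rightarrow> int \<Rightarrow> int \<Rightarrow> 'a" where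
  "jack_x \<tau> \<alpha> m j = of_int m + of_int j * \<tau> + \<alpha>"

definition macdonald_x :: "'a::field \<Rightarrow> 'a \<Rightarrow> 'a \<Rightarrow> int \<Rightarrow> int \<Rightarrow> 'a" where
  "macdonald_x q t a m j = a * q powi m * t powi j"

context positive_cone
begin

lemma jack_x_diff:
  assumes "\<tau> \<in> P" "m' \<le> m" "j' \<le> j" "(m, j) \<noteq> (m', j')"
  shows "jack_x \<tau> \<alpha> m j - jack_x \<tau> \<alpha> m' j' \<in> P"
proof -
  have "jack_x \<tau> \<alpha> m j - jack_x \<tau> \<alpha> m' j' = of_int (m - m') + of_int (j - j') * \<tau>"
    by (simp add: jack_x_def algebra_simps)
  moreover have "of_int (m - m') \<in> insert 0 P" "of_int (j - j') * \<tau> \<in> insert 0 P"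
    using assms of_int_in[of "m - m'"] of_int_in[of "j - j'"] mult_in[of "of_int (j - j')" \<tau>]
    by (cases "m = m'"; cases "j = j'"; simp)+
  moreover have "of_int (m - m') \<in> P \<or> of_int (j - j') * \<tau> \<in> P"
    using assms of_int_in[of "m - m'"] of_int_in[of "j - j'"] mult_in[of "of_int (j - j')" \<tau>]
    by (cases "m = m'") auto
  ultimately show ?thesis using add_pos_nonneg add_nonneg_pos by metis
qed

lemma jack_x_in:
  assumes "\<tau> \<in> P" "\<alpha> \<in> P" "0 \<le> m" "0 \<le> j"
  shows "jack_x \<tau> \<alpha> m j \<in> P"
proof (cases "(m, j) = (0, 0)")
  case True
  then show ?thesis using assms by (simp add: jack_x_def)
next
  case False
  then have "jack_x \<tau> \<alpha> m j - jack_x \<tau> \<alpha> 0 0 \<in> P" using assms by (intro jack_x_diff) auto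
  from add_in[OF this assms(2)] show ?thesis by (simp add: jack_x_def)
qed

text \<open>The mirror image of \<open>x\<close> is \<open>- x\<close>. The numerator
  \<open>x + \<alpha>\<close> is chosen so that its mirror image vanishes at the position (0, 0),
  where \<open>x = \<alpha>\<close>. The condition \<open>generic\<close> excludes (x - 1)^2 = x^2,
  a zero denominator of the removing coefficient at \<open>m = 0\<close>.\<close>

lemma type_B_jack:
  assumes \<tau>: "\<tau> \<in> P" and \<alpha>: "\<alpha> \<in> P"
    and generic: "\<And>j. 0 \<le> j \<Longrightarrow> 2 * jack_x \<tau> \<alpha> 0 j \<noteq> 1"
  defines "c \<equiv> \<lambda>m j. jack_x \<tau> \<alpha> m j ^ 2"
  shows "\<exists>rU rL xU xL. type_B P c rU rL xU xL"
proof -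
  define X where "X = jack_x \<tau> \<alpha>"
  define X' where "X' m j = - X m j" for m j
  define rU where "rU m j = (X m j + \<alpha>) / ((X m j - X' m j) * (c (m + 1) j - c m j))" for m j
  define rL where "rL m j = (X' m j + \<alpha>) / ((X' m j - X m j) * (c (m - 1) j - c m j))" for m j
  note Xin = jack_x_in[OF \<tau> \<alpha>, folded X_def]
  have two: "2 \<in> P" using of_nat_in[of 2] by simp
  have order: "1 * (c m j - c m' j') \<in> P"
    if "m' \<le> m" "j' \<le> j" "(m, j) \<noteq> (m', j')" "0 \<le> m + m'" "0 \<le> j + j'" for m j m' j'
  proof -
    have "X m j + X m' j' = jack_x \<tau> (\<alpha> + \<alpha>) (m + m') (j + j')" by (simp add: X_def jack_x_def algebra_simps)
    also have "\<dots> \<in> P" using that by (intro jack_x_in \<tau> add_in \<alpha>) auto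
    finally have "(X m j - X m' j') * (X m j + X m' j') \<in> P"
      using jack_x_diff[OF \<tau> that(1-3), of \<alpha>] by (intro mult_in) (auto simp: X_def)
    then show ?thesis by (simp add: c_def X_def power2_eq_square algebra_simps)
  qed
  have XX: "X m j - X' m j \<in> P" if "0 \<le> m" "0 \<le> j" for m j
    using add_in[OF Xin Xin, OF that that] by (simp add: X'_def)
  have og: "ordered_grid P c 1" by unfold_locales (use order in auto)
  have nz: "x \<noteq> 0" if "x \<in> P" for x using that zero_notin by metis
  have cdiff: "c (m + 1) j - c m j \<in> P" if "0 \<le> m" "0 \<le> j" for m j
    using order[of m "m + 1" j j] that by simp
  have cdiff': "c m j - c (m - 1) j \<in> P" if "1 \<le> m" "0 \<le> j" for m j
    using order[of "m - 1" m j j] that by simp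
  have "type_B P c rU rL X X'"
  proof (intro type_B.intro og type_B_axioms.intro)
    fix m j :: int assume mj: "0 \<le> m" "0 \<le> j"
    show "rU m j \<in> P" unfolding rU_def by (intro divide_in mult_in add_in Xin XX cdiff mj \<alpha>)
  next
    show "rL 0 0 = 0" by (simp add: rL_def X'_def X_def jack_x_def)
  next
    fix m :: int assume m: "1 \<le> m"
    have "(X m 0 - \<alpha>) / ((X m 0 - X' m 0) * (c m 0 - c (m - 1) 0)) \<in> P"
      using m of_int_in[of m] by (intro divide_in mult_in XX cdiff') (auto simp: X_def jack_x_def)
    moreover have "- rL m 0 = (X m 0 - \<alpha>) / ((X m 0 - X' m 0) * (c m 0 - c (m - 1) 0))"
    proof -
      have eq: "(X' m 0 - X m 0) * (c (m - 1) 0 - c m 0) = (X m 0 - X' m 0) * (c m 0 - c (m - 1) 0)"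
        by (simp add: algebra_simps)
      show ?thesis unfolding rL_def eq minus_divide_left by (simp add: X'_def)
    qed
    ultimately show "- rL m 0 \<in> P" by simp
  next
    fix m' m j' j :: int assume "0 \<le> m'" "m' \<le> m" "0 \<le> j'" "j' \<le> j" "(m, j) \<noteq> (m', j')"
    then show "X m j - X m' j' \<in> P" unfolding X_def by (intro jack_x_diff \<tau>)
  next
    fix m j m' j' :: int assume "0 \<le> m" "0 \<le> j" "0 \<le> m'" "0 \<le> j'"
    then show "X m' j' - X' m j \<in> P" using add_in[OF Xin Xin] by (simp add: X'_def)
  next
    fix p0 p1
    have "polynomial_shift 0 c
       (\<lambda>m j. (X m j + \<alpha>) * (p0 + p1 * X m j) / ((X m j - X' m j) * (c (m + 1) j - c m j)))
       (\<lambda>m j. (X' m j + \<alpha>) * (p0 + p1 * X' m j) / ((X' m j - X m j) * (c (m - 1) j - c m j)))"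
    \<comment> \<open>The data are read off from X^2 = c, \<open>c (m + 1) j = c + 1 + 2 X\<close>,
      \<open>c m (j + 1) = c + \<tau>^2 + 2 \<tau> X\<close> and the expansion of
      \<open>(X + \<alpha>) (p0 + p1 X)\<close>.\<close>
    proof (rule polynomial_shift_quadratic[where u = 0 and v = "[:0, 1:]" and A = "[:1, 1:]" and a = 2
          and B = "[:\<tau>\<^sup>2, 1:]" and b = "2 * \<tau>" and G = "[:\<alpha> * p0, p1:]" and e = "p0 + \<alpha> * p1"])
      fix m j :: int assume mj: "0 \<le> m" "0 \<le> j"
      show "X m j \<noteq> X' m j" "c (m + 1) j \<noteq> c m j" using nz[OF XX[OF mj]] nz[OF cdiff[OF mj]] by auto
      show "c (m - 1) j \<noteq> c m j"
      proof (cases "m = 0")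
        case True
        have "c (m - 1) j - c m j = 1 - 2 * jack_x \<tau> \<alpha> 0 j"
          by (simp add: c_def True jack_x_def power2_eq_square algebra_simps)
        then show ?thesis using generic[OF mj(2)] by auto
      next
        case False
        then show ?thesis using nz[OF cdiff'[of m j]] mj by auto
      qed
    qed (auto simp: c_def X_def X'_def jack_x_def power2_eq_square algebra_simps)
    then show "polynomial_shift 0 c (\<lambda>m j. rU m j * (p0 + p1 * X m j)) (\<lambda>m j. rL m j * (p0 + p1 * X' m j))"
      unfolding rU_def rL_def by simp
  qed
  then show ?thesis by blast
qed

text \<open>The shift by \<open>k\<close> replaces \<open>\<alpha>\<close> by
  \<open>\<alpha> + k \<tau>\<close>, which is again positive and generic.\<close>

lemma type_B_grid_jack:
  assumes "\<tau> \<in> P" "\<alpha> \<in> P" "\<And>j. 0 \<le> j \<Longrightarrow> 2 * jack_x \<tau> \<alpha> 0 j \<noteq> 1"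
  shows "type_B_grid P (\<lambda>m j. jack_x \<tau> \<alpha> m j ^ 2)"
  unfolding type_B_grid_def
proof
  fix k :: nat
  have shift: "jack_x \<tau> \<alpha> m (j + int k) = jack_x \<tau> (\<alpha> + of_nat k * \<tau>) m j" for m j
    by (simp add: jack_x_def algebra_simps)
  have "\<alpha> + of_nat k * \<tau> \<in> P"
    using assms add_in mult_in of_nat_in by (cases "k = 0") auto
  moreover have "2 * jack_x \<tau> (\<alpha> + of_nat k * \<tau>) 0 j \<noteq> 1" if "0 \<le> j" for j
    using assms(3)[of "j + int k"] that by (simp add: shift)
  ultimately show "\<exists>rU rL xU xL. type_B P (\<lambda>m j. (jack_x \<tau> \<alpha> m (j + int k))\<^sup>2) rU rL xU xL"
    unfolding shift by (intro type_B_jack assms(1))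
qed

section \<open>Monomials in parameters between 0 and 1\<close>

lemma one_minus_power:
  assumes "q \<in> P" "1 - q \<in> P"
  shows "k > 0 \<Longrightarrow> 1 - q ^ k \<in> P"
proof (induction k)
  case (Suc k)
  show ?case
  proof (cases "k = 0")
    case False
    then have "(1 - q) + q * (1 - q ^ k) \<in> P" using Suc assms by (intro add_in mult_in) auto
    then show ?thesis by (simp add: algebra_simps)
  qed (use assms in simp)
qed simp

lemma one_minus_mult:
  assumes "u \<in> P" "1 - u \<in> P \<or> u = 1" "1 - v \<in> P \<or> v = 1" "u \<noteq> 1 \<or> v \<noteq> 1"
  shows "1 - u * v \<in> P"
proof -
  have "1 - u * v = (1 - u) + u * (1 - v)" by (simp add: algebra_simps)
  moreover have "1 - u \<in> insert 0 P" "u * (1 - v) \<in> insert 0 P" "1 - u \<in> P \<or> u * (1 - v) \<in> P"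
    using assms mult_in by auto
  ultimately show ?thesis using add_pos_nonneg add_nonneg_pos by metis
qed

lemma one_minus_power_int:
  assumes "q \<in> P" "1 - q \<in> P" "k \<ge> 0"
  shows "1 - q powi k \<in> P \<or> q powi k = 1" "k > 0 \<Longrightarrow> 1 - q powi k \<in> P"
  using one_minus_power[OF assms(1,2), of "nat k"] assms(3)
  by (cases "k = 0"; simp add: power_int_def)+

lemma nonzero: "x \<in> P \<Longrightarrow> x \<noteq> 0"
  using zero_notin by metis

lemma macdonald_x_in: "q \<in> P \<Longrightarrow> t \<in> P \<Longrightarrow> a \<in> P \<Longrightarrow> macdonald_x q t a m j \<in> P"
  unfolding macdonald_x_def by (intro mult_in power_int_in)

lemma macdonald_x_mult:
  assumes "q \<in> P" "t \<in> P"
  shows "macdonald_x q t a m j * macdonald_x q t b m' j' = macdonald_x q t (a * b) (m + m') (j + j')"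
  using assms nonzero by (simp add: macdonald_x_def power_int_add)

lemma macdonald_x_step:
  assumes "q \<in> P" "t \<in> P"
  shows "macdonald_x q t a (m + 1) j = q * macdonald_x q t a m j"
    "macdonald_x q t a (m - 1) j = macdonald_x q t a m j / q"
    "macdonald_x q t a m (j + 1) = t * macdonald_x q t a m j"
    "macdonald_x q t a m (j - 1) = macdonald_x q t a m j / t"
  using assms nonzero by (simp_all add: macdonald_x_def power_int_add power_int_diff)

lemma one_minus_monomial:
  assumes "q \<in> P" "1 - q \<in> P" "t \<in> P" "1 - t \<in> P" "0 \<le> m" "0 \<le> j" "(m, j) \<noteq> (0, 0)"
  shows "1 - macdonald_x q t 1 m j \<in> P"
proof -
  have "q powi m \<noteq> 1 \<or> t powi j \<noteq> 1"
    using assms one_minus_power_int(2)[OF assms(1,2), of m] one_minus_power_int(2)[OF assms(3,4), of j] zero_notin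
    by (cases "m = 0") auto
  then show ?thesis
    unfolding macdonald_x_def mult_1
    using one_minus_power_int(1)[OF assms(1,2,5)] one_minus_power_int(1)[OF assms(3,4,6)]
    by (intro one_minus_mult power_int_in assms) auto
qed

lemma macdonald_x_diff:
  assumes "q \<in> P" "1 - q \<in> P" "t \<in> P" "1 - t \<in> P" "a \<in> P" "m' \<le> m" "j' \<le> j" "(m, j) \<noteq> (m', j')"
  shows "macdonald_x q t a m' j' - macdonald_x q t a m j \<in> P"
proof -
  have "macdonald_x q t a m' j' * (1 - macdonald_x q t 1 (m - m') (j - j')) \<in> P"
    using assms by (intro mult_in one_minus_monomial macdonald_x_in) auto
  then show ?thesis by (simp add: right_diff_distrib macdonald_x_mult[OF assms(1,3)])
qed

text \<open>The mirror image of \<open>X\<close> is \<open>1 / X\<close>. As \<open>X\<close>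
  decreases along the grid, \<open>xU\<close> is \<open>1 / X\<close> and \<open>xL\<close> is
  \<open>X\<close>. The mirror image \<open>a / X - 1\<close> of the numerator vanishes at (0, 0);
  the negative sign of \<open>a X - 1\<close> cancels against \<open>X - 1 / X\<close>. The case X^2
  = q excluded by \<open>generic\<close> would give \<open>c (-1) j = c 0 j\<close>.\<close>

lemma type_B_macdonald:
  assumes q: "q \<in> P" "1 - q \<in> P" and t: "t \<in> P" "1 - t \<in> P" and a: "a \<in> P" "1 - a \<in> P"
    and generic: "\<And>j. 0 \<le> j \<Longrightarrow> macdonald_x q t a 0 j ^ 2 \<noteq> q"
  defines "c \<equiv> \<lambda>m j. macdonald_x q t a m j + inverse (macdonald_x q t a m j)"
  shows "\<exists>rU rL xU xL. type_B P c rU rL xU xL"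
proof -
  define X where "X = macdonald_x q t a"
  define X' where "X' m j = inverse (X m j)" for m j
  define rU where "rU m j = (a * X m j - 1) / ((X m j - X' m j) * (c (m + 1) j - c m j))" for m j
  define rL where "rL m j = (a * X' m j - 1) / ((X' m j - X m j) * (c (m - 1) j - c m j))" for m j
  have Xin: "X m j \<in> P" for m j unfolding X_def by (intro macdonald_x_in q t a)
  have X'in: "X' m j \<in> P" for m j unfolding X'_def by (intro inverse_in Xin)
  have X0: "X m j \<noteq> 0" for m j using nonzero[OF Xin] .
  have q0: "q \<noteq> 0" and t0: "t \<noteq> 0" using nonzero q t by auto
  note step = macdonald_x_step[OF q(1) t(1), where a = a, folded X_def]
  have a2: "1 - a * a \<in> P" using one_minus_mult[of a a] a nonzero[OF a(2)] by auto
  have XX: "1 - X m j * X m' j' \<in> P" if "0 \<le> m + m'" "0 \<le> j + j'" for m j m' j'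
  proof -
    have "X m j * X m' j' = (a * a) * macdonald_x q t 1 (m + m') (j + j')"
      unfolding X_def macdonald_x_mult[OF q(1) t(1)] by (simp add: macdonald_x_def)
    moreover have "1 - macdonald_x q t 1 (m + m') (j + j') \<in> P \<or> macdonald_x q t 1 (m + m') (j + j') = 1"
      using one_minus_monomial[OF q t, of "m + m'" "j + j'"] that
      by (cases "(m + m', j + j') = (0, 0)") (auto simp: macdonald_x_def)
    ultimately show ?thesis using a2 a zero_notin by (auto intro!: one_minus_mult mult_in)
  qed
  have order: "1 * (c m j - c m' j') \<in> P"
    if "m' \<le> m" "j' \<le> j" "(m, j) \<noteq> (m', j')" "0 \<le> m + m'" "0 \<le> j + j'" for m j m' j'
  proof -
    have "(X m' j' - X m j) * (1 - X m j * X m' j') / (X m j * X m' j') \<in> P"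
      using macdonald_x_diff[OF q t a(1) that(1-3)] XX[OF that(4,5)]
      by (intro divide_in mult_in Xin) (auto simp: X_def)
    also have "(X m' j' - X m j) * (1 - X m j * X m' j') / (X m j * X m' j') = 1 * (c m j - c m' j')"
      using X0 by (simp add: c_def X_def[symmetric] divide_simps) (simp add: algebra_simps)
    finally show ?thesis .
  qed
  have XX': "X' m j - X m' j' \<in> P" if "0 \<le> m" "0 \<le> j" "0 \<le> m'" "0 \<le> j'" for m j m' j'
  proof -
    have "(1 - X m j * X m' j') / X m j \<in> P" using that by (intro divide_in XX Xin) auto
    also have "(1 - X m j * X m' j') / X m j = X' m j - X m' j'"
      using X0 by (simp add: X'_def divide_simps)
    finally show ?thesis .
  qed
  have og: "ordered_grid P c 1" by unfold_locales (use order in auto)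
  have cdiff: "c (m + 1) j - c m j \<in> P" if "0 \<le> m" "0 \<le> j" for m j
    using order[of m "m + 1" j j] that by simp
  have cdiff': "c m j - c (m - 1) j \<in> P" if "1 \<le> m" "0 \<le> j" for m j
    using order[of "m - 1" m j j] that by simp
  have "type_B P c rU rL X' X"
  proof (intro type_B.intro og type_B_axioms.intro)
    fix m j :: int assume mj: "0 \<le> m" "0 \<le> j"
    have "1 - a * X m j \<in> P"
      using XX[of 0 m 0 j] mj by (simp add: X_def macdonald_x_def)
    then have "(1 - a * X m j) / ((X' m j - X m j) * (c (m + 1) j - c m j)) \<in> P"
      by (intro divide_in mult_in XX' cdiff mj)
    moreover have "rU m j = (1 - a * X m j) / ((X' m j - X m j) * (c (m + 1) j - c m j))"
    proof -
      have eq: "(X m j - X' m j) * (c (m + 1) j - c m j) = - ((X' m j - X m j) * (c (m + 1) j - c m j))"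
        by (simp add: algebra_simps)
      show ?thesis unfolding rU_def eq by (simp only: divide_minus_right minus_divide_left minus_diff_eq)
    qed
    ultimately show "rU m j \<in> P" by simp
  next
    show "rL 0 0 = 0" using nonzero[OF a(1)] by (simp add: rL_def X'_def X_def macdonald_x_def)
  next
    fix m :: int assume m: "1 \<le> m"
    have "a * X' m 0 - 1 = (1 - q powi m) / q powi m"
      using nonzero[OF a(1)] q0 by (simp add: X'_def X_def macdonald_x_def divide_simps)
    also have "\<dots> \<in> P" using m by (intro divide_in power_int_in one_minus_power_int(2) q) auto
    finally have "(a * X' m 0 - 1) / ((X' m 0 - X m 0) * (c m 0 - c (m - 1) 0)) \<in> P"
      using m by (intro divide_in mult_in XX' cdiff') auto
    moreover have "- rL m 0 = (a * X' m 0 - 1) / ((X' m 0 - X m 0) * (c m 0 - c (m - 1) 0))"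
    proof -
      have eq: "(X' m 0 - X m 0) * (c (m - 1) 0 - c m 0) = - ((X' m 0 - X m 0) * (c m 0 - c (m - 1) 0))"
        by (simp add: algebra_simps)
      show ?thesis unfolding rL_def eq by (simp only: divide_minus_right minus_minus)
    qed
    ultimately show "- rL m 0 \<in> P" by simp
  next
    fix m' m j' j :: int assume "0 \<le> m'" "m' \<le> m" "0 \<le> j'" "j' \<le> j" "(m, j) \<noteq> (m', j')"
    then have "(X m' j' - X m j) / (X m j * X m' j') \<in> P"
      unfolding X_def by (intro divide_in mult_in macdonald_x_diff macdonald_x_in q t a)
    also have "(X m' j' - X m j) / (X m j * X m' j') = X' m j - X' m' j'"
      using X0 by (simp add: X'_def divide_simps)
    finally show "X' m j - X' m' j' \<in> P" .
  next
    fix m j m' j' :: int assume "0 \<le> m" "0 \<le> j" "0 \<le> m'" "0 \<le> j'"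
    then show "X' m' j' - X m j \<in> P" by (intro XX')
  next
    fix p0 p1
    have cX: "c m j = X m j + X' m j" for m j by (simp add: c_def X_def X'_def)
    have inv: "X m j * X' m j = 1" "X' m j * X m j = 1" for m j using X0 by (simp_all add: X'_def)
    have id1: "z * x + 1 / (z * x) = (x + 1 / x) * (1 / z) + (z - 1 / z) * x"
      and id2: "x / z + 1 / (x / z) = (x + 1 / x) * (1 / z) + (z - 1 / z) * (1 / x)"
      if "z \<noteq> 0" "x \<noteq> 0" for z x :: 'a
      using that by (simp_all add: divide_simps) (simp_all add: algebra_simps)
    have lin: "poly [:0, z:] x = x * z" for z x :: 'a by simp
    have "polynomial_shift 0 c
       (\<lambda>m j. (a * X m j - 1) * (p0 + p1 * X' m j) / ((X m j - X' m j) * (c (m + 1) j - c m j)))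
       (\<lambda>m j. (a * X' m j - 1) * (p0 + p1 * X m j) / ((X' m j - X m j) * (c (m - 1) j - c m j)))"
    \<comment> \<open>\<open>X\<close> and \<open>1 / X\<close> are the roots of
      \<open>x^2 = c x - 1\<close>. The other data come from
      \<open>q X + 1 / (q X) = c / q + (q - 1 / q) X\<close>, likewise for \<open>t\<close>, and
      from \<open>1 / X = c - X\<close>.\<close>
    proof (rule polynomial_shift_quadratic[where u = "[:0, 1:]" and v = "[:- 1:]" and A = "[:0, 1 / q:]" and a = "q - 1 / q"
          and B = "[:0, 1 / t:]" and b = "t - 1 / t" and G = "[:a * p1 - p0, - p1:]" and e = "a * p0 + p1"])
      fix m j :: int assume mj: "0 \<le> m" "0 \<le> j"
      show "X m j * X m j = poly [:0, 1:] (c m j) * X m j + poly [:- 1:] (c m j)"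
        "X' m j * X' m j = poly [:0, 1:] (c m j) * X' m j + poly [:- 1:] (c m j)"
        using inv[of m j] by (simp_all add: cX algebra_simps)
      show "c (m + 1) j = poly [:0, 1 / q:] (c m j) + (q - 1 / q) * X m j"
        "c (m - 1) j = poly [:0, 1 / q:] (c m j) + (q - 1 / q) * X' m j"
        "c m (j + 1) = poly [:0, 1 / t:] (c m j) + (t - 1 / t) * X m j"
        "c m (j - 1) = poly [:0, 1 / t:] (c m j) + (t - 1 / t) * X' m j"
        by (simp_all only: lin cX X'_def step inverse_eq_divide id1[OF q0 X0] id2[OF q0 X0] id1[OF t0 X0] id2[OF t0 X0])
      show "(a * X m j - 1) * (p0 + p1 * X' m j) = poly [:a * p1 - p0, - p1:] (c m j) + (a * p0 + p1) * X m j"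
      proof -
        have "(a * X m j - 1) * (p0 + p1 * X' m j) = a * p0 * X m j + a * p1 * (X m j * X' m j) - p0 - p1 * X' m j"
          by (simp add: algebra_simps)
        then show ?thesis unfolding inv by (simp add: cX algebra_simps)
      qed
      show "(a * X' m j - 1) * (p0 + p1 * X m j) = poly [:a * p1 - p0, - p1:] (c m j) + (a * p0 + p1) * X' m j"
      proof -
        have "(a * X' m j - 1) * (p0 + p1 * X m j) = a * p0 * X' m j + a * p1 * (X' m j * X m j) - p0 - p1 * X m j"
          by (simp add: algebra_simps)
        then show ?thesis unfolding inv by (simp add: cX algebra_simps)
      qed
      show "X m j \<noteq> X' m j" "c (m + 1) j \<noteq> c m j"
        using nonzero[OF XX'[OF mj mj]] nonzero[OF cdiff[OF mj]] by auto
      show "c (m - 1) j \<noteq> c m j"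
      proof (cases "m = 0")
        case True
        define x where "x = X 0 j"
        have x: "x \<noteq> 0" "x * x \<noteq> q" using X0 generic[OF mj(2)] by (simp_all add: x_def X_def power2_eq_square)
        have "c (m - 1) j - c m j = (x / q + q / x) - (x + 1 / x)"
          using step(2)[of 0 j] by (simp add: cX X'_def True x_def inverse_eq_divide)
        also have "\<dots> = (1 - q) * (x * x - q) / (q * x)"
          using x(1) q0 by (simp add: divide_simps) (simp add: algebra_simps)
        finally show ?thesis using x q0 nonzero[OF q(2)] by auto
      next
        case False
        then show ?thesis using nonzero[OF cdiff'[of m j]] mj by auto
      qed
    qed auto
    then show "polynomial_shift 0 c (\<lambda>m j. rU m j * (p0 + p1 * X' m j)) (\<lambda>m j. rL m j * (p0 + p1 * X m j))"
      unfolding rU_def rL_def by simp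
  qed
  then show ?thesis by blast
qed

lemma type_B_grid_macdonald:
  assumes q: "q \<in> P" "1 - q \<in> P" and t: "t \<in> P" "1 - t \<in> P" and a: "a \<in> P" "1 - a \<in> P"
    and generic: "\<And>j. 0 \<le> j \<Longrightarrow> macdonald_x q t a 0 j ^ 2 \<noteq> q"
  shows "type_B_grid P (\<lambda>m j. macdonald_x q t a m j + inverse (macdonald_x q t a m j))"
  unfolding type_B_grid_def
proof
  fix k :: nat
  have shift: "macdonald_x q t a m (j + int k) = macdonald_x q t (a * t ^ k) m j" for m j
    using nonzero[OF t(1)] by (simp add: macdonald_x_def power_int_add mult_ac)
  have "a * t ^ k \<in> P" "1 - a * t ^ k \<in> P"
    using a t one_minus_power[OF t, of k] nonzero[OF a(2)]
    by (cases "k = 0"; auto intro!: mult_in power_in one_minus_mult)+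
  moreover have "macdonald_x q t (a * t ^ k) 0 j ^ 2 \<noteq> q" if "0 \<le> j" for j
    using generic[of "j + int k"] that by (simp add: shift)
  ultimately show "\<exists>rU rL xU xL. type_B P (\<lambda>m j. macdonald_x q t a m (j + int k) + inverse (macdonald_x q t a m (j + int k))) rU rL xU xL"
    unfolding shift by (intro type_B_macdonald q t)
qed

end

text \<open>The sum of the removing coefficients is symmetric of degree at most 1 in the coordinates
  of \<open>z\<close>, hence equal to \<open>b + e * Z lam\<close>, and the conditions on the
  eigenvalues reduce to \<open>e\<close> being positive. The grid \<open>z\<close> may differ from
  \<open>c\<close> because for AM the sum is affine in the inverse coordinates.\<close>

lemma (in ordered_grid) type_A_positivity_affine:
  fixes r r' z :: "int \<Rightarrow> int \<Rightarrow> 'a"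
  assumes n: "n \<ge> 1" and sh: "polynomial_shift 1 c (\<lambda>_ _. 0) r" and r0: "r 0 0 = 0"
    and rpos: "\<And>m j. 0 \<le> m \<Longrightarrow> 0 \<le> j \<Longrightarrow> (m, j) \<noteq> (0, 0) \<Longrightarrow> r m j \<in> P"
    and z: "ordered_grid P z 1"
    and eq: "\<And>lam i. lam \<in> partitions n \<Longrightarrow> i \<in> {1..n} \<Longrightarrow> shift_coeff n c r (-1) lam i = shift_coeff n z r' (-1) lam i"
    and R: "\<And>k. \<exists>R. degree R \<le> 1 + k \<and> (\<forall>m\<ge>0. \<forall>j\<ge>0. r' m j * z m (j - 1) ^ k = poly R (z m j))"
    and generic: "\<And>lam mu. lam \<in> partitions n \<Longrightarrow> mu \<in> partitions n \<Longrightarrow> psize n mu < psize n lam \<Longrightarrow>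
      (\<Sum>i\<in>{1..n}. grid_point n z lam i) \<noteq> (\<Sum>i\<in>{1..n}. grid_point n z mu i)"
    and lam: "lam \<in> partitions n" and mu: "mu \<in> partitions n"
  shows "(contains n lam mu \<longrightarrow> binom n c lam mu \<in> P) \<and> (\<not> contains n lam mu \<longrightarrow> binom n c lam mu = 0)"
proof -
  interpret z: ordered_grid P z 1 by (rule z)
  define Z where "Z lam = (\<Sum>i\<in>{1..n}. grid_point n z lam i)" for lam
  define S where "S lam = (\<Sum>i\<in>{1..n}. shift_coeff n c r (-1) lam i)" for lam
  have "\<exists>R. degree R \<le> 1 + k \<and> (\<forall>m\<ge>0. \<forall>j\<ge>0. (\<lambda>_ _. 0) m j * z m (j + 1) ^ k + r' m j * z m (j - 1) ^ k = poly R (z m j))" for k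
    using R[of k] by simp
  from shift_coeff_sum[OF n z.distinct this] obtain g where g: "sympoly n 1 g"
    "\<And>lam. lam \<in> partitions n \<Longrightarrow> (\<Sum>i\<in>{1..n}. shift_coeff n z (\<lambda>_ _. 0) 1 lam i + shift_coeff n z r' (-1) lam i)
      = g (grid_point n z lam)" by blast
  obtain b e where be: "\<And>y. g y = b + e * (\<Sum>i\<in>{1..n}. y i)" using sympoly_1_affine[OF g(1) refl] by blast
  have S: "S lam = b + e * Z lam" if "lam \<in> partitions n" for lam
  proof -
    have "S lam = (\<Sum>i\<in>{1..n}. shift_coeff n z (\<lambda>_ _. 0) 1 lam i + shift_coeff n z r' (-1) lam i)"
      unfolding S_def using eq[OF that] by (intro sum.cong) (auto simp: shift_coeff_def[of _ _ "\<lambda>_ _. 0"])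
    then show ?thesis unfolding g(2)[OF that] be Z_def .
  qed
  have e: "e \<in> P"
  proof -
    \<comment> \<open>The slope \<open>e\<close> is found from the empty partition, with eigenvalue
      sum 0, and a single box, where just one coefficient is nonzero.\<close>
    define o1 where "o1 = (\<lambda>_::nat. 0::nat)(1 := 1)"
    define o0 where "o0 = (\<lambda>_::nat. 0::nat)"
    have o0: "o0 \<in> partitions n" by (rule partitionsI) (auto simp: o0_def)
    have o1: "o1 \<in> partitions n" by (rule partitionsI) (use n in \<open>auto simp: o1_def\<close>)
    have rem: "o1(1 := o1 1 - 1) = o0" by (auto simp: o1_def o0_def)
    have "S o0 = 0"
      unfolding S_def using shift_coeff_rem_zero[where c = c and r = r and lam = o0 and n = n, OF o0 _ r0] by (intro sum.neutral) (auto simp: o0_def)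
    moreover have "S o1 \<in> P"
    proof -
      have 1: "shift_coeff n c r (-1) o1 1 \<in> P"
        using n o0 rem by (intro shift_coeff_rem_pos[OF o1] rpos) (auto simp: o1_def)
      have "shift_coeff n c r (-1) o1 i = 0" if "i \<in> {1..n}" "i \<noteq> 1" for i
        using that by (intro shift_coeff_rem_zero[where r = r, OF o1 that(1) r0]) (auto simp: o1_def)
      then show ?thesis unfolding S_def using 1 n by (intro sum_pos[of _ _ 1]) auto
    qed
    moreover have "Z o1 - Z o0 \<in> P"
    proof -
      have "o1 1 \<noteq> o0 1" by (simp add: o1_def o0_def)
      then have "o1 \<noteq> o0" by metis
      then show ?thesis
        using z.sum_grid_point_strict_mono[OF o1 o0] by (simp add: Z_def contains_def o0_def)
    qed
    moreover have "e * (Z o1 - Z o0) = S o1 - S o0" using S[OF o1] S[OF o0] by (simp add: algebra_simps)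
    ultimately have "e = S o1 / (Z o1 - Z o0)" using zero_notin by (auto simp: eq_divide_eq)
    then show ?thesis using \<open>S o1 \<in> P\<close> \<open>Z o1 - Z o0 \<in> P\<close> divide_in by metis
  qed
  show ?thesis
  proof (rule type_A_positivity[OF n sh r0 rpos S_def _ _ lam mu])
    fix lam mu assume lm: "lam \<in> partitions n" "mu \<in> partitions n" "contains n lam mu" "lam \<noteq> mu"
    have "e * (Z lam - Z mu) \<in> P"
      using z.sum_grid_point_strict_mono[OF lm] e by (intro mult_in) (simp_all add: Z_def)
    then show "S lam - S mu \<in> P" using S[OF lm(1)] S[OF lm(2)] by (simp add: algebra_simps)
  next
    fix lam mu assume lm: "lam \<in> partitions n" "mu \<in> partitions n" "psize n mu < psize n lam"
    have "e \<noteq> 0" using e zero_notin by metis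
    then show "S lam \<noteq> S mu" using S[OF lm(1)] S[OF lm(2)] generic[OF lm] by (simp add: Z_def)
  qed auto
qed

section \<open>The grids of types AJ and AM\<close>

context positive_cone
begin

lemma ordered_grid_jack: "\<tau> \<in> P \<Longrightarrow> ordered_grid P (jack_x \<tau> \<alpha>) 1"
  by unfold_locales (auto intro: jack_x_diff)

text \<open>The removing coefficient carries the factor \<open>x\<close>, which is 0 at (0, 0). The
  sum of the coordinates is the size plus a constant, so different sizes have different
  eigenvalues.\<close>

lemma type_A_jack:
  assumes n: "n \<ge> 1" and \<tau>: "\<tau> \<in> P" and lam: "lam \<in> partitions n" and mu: "mu \<in> partitions n"
  shows "(contains n lam mu \<longrightarrow> binom n (jack_x \<tau> 0) lam mu \<in> P) \<and>
    (\<not> contains n lam mu \<longrightarrow> binom n (jack_x \<tau> 0) lam mu = 0)"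
proof -
  interpret ordered_grid P "jack_x \<tau> 0" 1 by (rule ordered_grid_jack[OF \<tau>])
  have step: "jack_x \<tau> 0 (m - 1) j = jack_x \<tau> 0 m j - 1" "jack_x \<tau> 0 m (j - 1) = jack_x \<tau> 0 m j - \<tau>" for m j
    by (simp_all add: jack_x_def algebra_simps)
  have degk: "degree ([:- \<tau>, 1:] ^ k) \<le> k" for k
    using degree_power_le[of "[:- \<tau>, 1:]" k] by (simp add: One_nat_def)
  show ?thesis
  proof (rule type_A_positivity_affine[OF n _ _ _ ordered_grid_jack[OF \<tau>] refl _ _ lam mu, where r = "jack_x \<tau> 0"])
    show "polynomial_shift 1 (jack_x \<tau> 0) (\<lambda>_ _. 0) (jack_x \<tau> 0)"
      unfolding polynomial_shift_def
    proof (intro allI)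
      fix a k
      define D where "D = (\<Sum>p<Suc a. [:- 1, 1:] ^ p * [:0, 1::'a:] ^ (a - p))"
      have D: "[:- 1, 1:] ^ Suc a - [:0, 1:] ^ Suc a = - D"
        unfolding diff_power_eq_sum D_def[symmetric] by simp
      have "degree ([:- 1, 1:] ^ p * [:0, 1::'a:] ^ (a - p)) \<le> a" if "p < Suc a" for p
        using degree_mult_le[of "[:- 1, 1:] ^ p" "[:0, 1::'a:] ^ (a - p)"] degree_power_le[of "[:- 1, 1::'a:]" p]
          degree_power_le[of "[:0, 1::'a:]" "a - p"] that by (simp add: One_nat_def)
      then have "degree D \<le> a" unfolding D_def by (intro degree_sum_le) auto
      define R where "R = [:0, 1:] * (- D) * [:- \<tau>, 1:] ^ k"
      have "degree R \<le> a + 1 + k"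
        unfolding R_def using degree_mult_le[of "[:0, 1:] * (- D)" "[:- \<tau>, 1:] ^ k"] degree_mult_le[of "[:0, 1:]" "- D"]
          \<open>degree D \<le> a\<close> degk[of k] by (simp add: One_nat_def)
      moreover have "0 * (jack_x \<tau> 0 (m + 1) j ^ Suc a - jack_x \<tau> 0 m j ^ Suc a) * jack_x \<tau> 0 m (j + 1) ^ k +
         jack_x \<tau> 0 m j * (jack_x \<tau> 0 (m - 1) j ^ Suc a - jack_x \<tau> 0 m j ^ Suc a) * jack_x \<tau> 0 m (j - 1) ^ k = poly R (jack_x \<tau> 0 m j)" for m j
        unfolding R_def D[symmetric] step by (simp add: algebra_simps)
      ultimately show "\<exists>R. degree R \<le> a + 1 + k \<and> (\<forall>m\<ge>0. \<forall>j\<ge>0.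
         0 * (jack_x \<tau> 0 (m + 1) j ^ Suc a - jack_x \<tau> 0 m j ^ Suc a) * jack_x \<tau> 0 m (j + 1) ^ k +
         jack_x \<tau> 0 m j * (jack_x \<tau> 0 (m - 1) j ^ Suc a - jack_x \<tau> 0 m j ^ Suc a) * jack_x \<tau> 0 m (j - 1) ^ k = poly R (jack_x \<tau> 0 m j))"
        by blast
    qed
  next
    fix m j :: int assume "0 \<le> m" "0 \<le> j" "(m, j) \<noteq> (0, 0)"
    then have "jack_x \<tau> 0 m j - jack_x \<tau> 0 0 0 \<in> P" by (intro jack_x_diff \<tau>) auto
    then show "jack_x \<tau> 0 m j \<in> P" by (simp add: jack_x_def)
  next
    fix k
    have "degree ([:0, 1:] * [:- \<tau>, 1:] ^ k) \<le> 1 + k"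
      using degree_mult_le[of "[:0, 1:]" "[:- \<tau>, 1:] ^ k"] degk[of k] by (simp add: One_nat_def)
    then show "\<exists>R. degree R \<le> 1 + k \<and> (\<forall>m\<ge>0. \<forall>j\<ge>0. jack_x \<tau> 0 m j * jack_x \<tau> 0 m (j - 1) ^ k = poly R (jack_x \<tau> 0 m j))"
      by (intro exI[of _ "[:0, 1:] * [:- \<tau>, 1:] ^ k"]) (simp add: step)
  next
    fix lam mu assume lt: "psize n mu < psize n lam"
    have "(\<Sum>i\<in>{1..n}. grid_point n (jack_x \<tau> 0) lam i) - (\<Sum>i\<in>{1..n}. grid_point n (jack_x \<tau> 0) mu i)
        = of_nat (psize n lam) - of_nat (psize n mu)"
      by (simp add: grid_point_def jack_x_def psize_def sum.distrib)
    also have "\<dots> = of_nat (psize n lam - psize n mu)" using lt by simp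
    also have "\<dots> \<in> P" using lt by (intro of_nat_in) simp
    finally show "(\<Sum>i\<in>{1..n}. grid_point n (jack_x \<tau> 0) lam i) \<noteq> (\<Sum>i\<in>{1..n}. grid_point n (jack_x \<tau> 0) mu i)"
      using zero_notin by auto
  qed (simp add: jack_x_def)
qed

lemma ordered_grid_macdonald:
  assumes "q \<in> P" "1 - q \<in> P" "t \<in> P" "1 - t \<in> P"
  shows "ordered_grid P (macdonald_x q t 1) (- 1)"
  by unfold_locales (use macdonald_x_diff[OF assms one_in] in auto)

text \<open>The prefactor \<open>1 / x - 1\<close> vanishes at (0, 0), where \<open>x = 1\<close>.
  It is not polynomial in \<open>x\<close>, but the difference of powers in
  \<open>polynomial_shift\<close> supplies a factor \<open>x\<close>. For the eigenvalue,
  \<open>z = 1 / x\<close> is the coordinate in which the prefactor is linear.\<close>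

lemma type_A_macdonald:
  assumes n: "n \<ge> 1" and q: "q \<in> P" "1 - q \<in> P" and t: "t \<in> P" "1 - t \<in> P"
    and generic: "\<And>lam mu. lam \<in> partitions n \<Longrightarrow> mu \<in> partitions n \<Longrightarrow> psize n mu < psize n lam \<Longrightarrow>
      (\<Sum>i\<in>{1..n}. inverse (grid_point n (macdonald_x q t 1) lam i)) \<noteq> (\<Sum>i\<in>{1..n}. inverse (grid_point n (macdonald_x q t 1) mu i))"
    and lam: "lam \<in> partitions n" and mu: "mu \<in> partitions n"
  shows "(contains n lam mu \<longrightarrow> binom n (macdonald_x q t 1) lam mu \<in> P) \<and>
    (\<not> contains n lam mu \<longrightarrow> binom n (macdonald_x q t 1) lam mu = 0)"
proof -
  define c where "c = macdonald_x q t 1"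
  define z where "z m j = inverse (c m j)" for m j
  define r where "r m j = z m j - 1" for m j
  define r' where "r' m j = (z m j - 1) * (1 / t) ^ (n - 1)" for m j
  interpret ordered_grid P c "- 1" unfolding c_def by (rule ordered_grid_macdonald[OF q t])
  have cin: "c m j \<in> P" for m j unfolding c_def by (intro macdonald_x_in q t one_in)
  note c0 = nonzero[OF cin]
  have q0: "q \<noteq> 0" and t0: "t \<noteq> 0" using nonzero q t by auto
  note step = macdonald_x_step[OF q(1) t(1), where a = 1, folded c_def]
  have zdiff: "z m j - z m' j' \<in> P" if "m' \<le> m" "j' \<le> j" "(m, j) \<noteq> (m', j')" for m j m' j'
  proof -
    have "(c m' j' - c m j) / (c m j * c m' j') \<in> P"
      using macdonald_x_diff[OF q t one_in that] by (intro divide_in mult_in cin) (simp add: c_def)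
    also have "(c m' j' - c m j) / (c m j * c m' j') = z m j - z m' j'"
      using c0 by (simp add: z_def divide_simps)
    finally show ?thesis .
  qed
  have og: "ordered_grid P z 1" by unfold_locales (use zdiff in auto)
  have zstep: "z m (j - 1) = t * z m j" for m j
    using t0 by (simp add: z_def step divide_inverse)
  have z00: "z 0 0 = 1" by (simp add: z_def c_def macdonald_x_def)
  have "(contains n lam mu \<longrightarrow> binom n c lam mu \<in> P) \<and> (\<not> contains n lam mu \<longrightarrow> binom n c lam mu = 0)"
  proof (rule type_A_positivity_affine[OF n _ _ _ og _ _ _ lam mu, where r = r and r' = r'])
    show "polynomial_shift 1 c (\<lambda>_ _. 0) r"
      unfolding polynomial_shift_def
    proof (intro allI)
      fix a k
      define w where "w = ((1 / q) ^ Suc a - 1) * (1 / t) ^ k"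
      define R where "R = smult w ([:1, - 1:] * monom 1 (a + k))"
      have "degree R \<le> a + 1 + k"
        unfolding R_def using degree_mult_le[of "[:1, - 1::'a:]" "monom 1 (a + k)"] degree_monom_le[of "1::'a" "a + k"]
        by (intro order.trans[OF degree_smult_le]) (simp add: One_nat_def)
      moreover have "0 * (c (m + 1) j ^ Suc a - c m j ^ Suc a) * c m (j + 1) ^ k +
          r m j * (c (m - 1) j ^ Suc a - c m j ^ Suc a) * c m (j - 1) ^ k = poly R (c m j)" for m j
      proof -
        have "r m j * (c (m - 1) j ^ Suc a - c m j ^ Suc a) * c m (j - 1) ^ k
            = w * (r m j * c m j) * c m j ^ (a + k)"
          unfolding step w_def by (simp add: power_divide power_add algebra_simps)
        also have "r m j * c m j = 1 - c m j" using c0 by (simp add: r_def z_def algebra_simps)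
        also have "w * (1 - c m j) * c m j ^ (a + k) = poly R (c m j)"
          by (simp add: R_def poly_monom algebra_simps)
        finally show ?thesis by (simp only: mult_zero_left add_0_left)
      qed
      ultimately show "\<exists>R. degree R \<le> a + 1 + k \<and> (\<forall>m\<ge>0. \<forall>j\<ge>0.
          0 * (c (m + 1) j ^ Suc a - c m j ^ Suc a) * c m (j + 1) ^ k +
          r m j * (c (m - 1) j ^ Suc a - c m j ^ Suc a) * c m (j - 1) ^ k = poly R (c m j))" by blast
    qed
  next
    fix m j :: int assume "0 \<le> m" "0 \<le> j" "(m, j) \<noteq> (0, 0)"
    then have "z m j - z 0 0 \<in> P" by (intro zdiff) auto
    then show "r m j \<in> P" by (simp add: r_def z00)
  next
    fix lam i assume lam: "lam \<in> partitions n" and i: "i \<in> {1..n}"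
    \<comment> \<open>One factor rewritten in the inverse coordinates. Each of the
      \<open>n - 1\<close> factors gives \<open>1 / t\<close>, which explains the power in
      \<open>r'\<close>.\<close>
    have ratio: "(x / t - y) / (x - y) = (1 / t) * ((t * inverse x - inverse y) / (inverse x - inverse y))"
      if "x \<noteq> 0" "y \<noteq> 0" for x y
    proof (cases "x = y")
      case False
      then have "inverse x - inverse y \<noteq> 0" "x - y \<noteq> 0" using that by auto
      moreover have "(x / t - y) * (inverse x - inverse y) = (1 / t) * (t * inverse x - inverse y) * (x - y)"
        using that t0 by (simp add: field_simps)
      ultimately have "(x / t - y) / (x - y) = ((1 / t) * (t * inverse x - inverse y)) / (inverse x - inverse y)"
        by (subst frac_eq_eq)
      then show ?thesis by (simp only: times_divide_eq_right)
    qed simp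
    have "(\<Prod>j\<in>{1..n} - {i}. (c (int (lam i)) (int n - int i + -1) - grid_point n c lam j) / (grid_point n c lam i - grid_point n c lam j))
      = (\<Prod>j\<in>{1..n} - {i}. (1 / t) * ((z (int (lam i)) (int n - int i + -1) - grid_point n z lam j) / (grid_point n z lam i - grid_point n z lam j)))"
    proof (rule prod.cong[OF refl])
      fix j
      show "(c (int (lam i)) (int n - int i + -1) - grid_point n c lam j) / (grid_point n c lam i - grid_point n c lam j) =
        (1 / t) * ((z (int (lam i)) (int n - int i + -1) - grid_point n z lam j) / (grid_point n z lam i - grid_point n z lam j))"
        using ratio[OF c0 c0, of "int (lam i)" "int n - int i" "int (lam j)" "int n - int j"]
          step(4)[of "int (lam i)" "int n - int i"] zstep[of "int (lam i)" "int n - int i"]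
        by (simp add: grid_point_def z_def)
    qed
    also have "\<dots> = (1 / t) ^ (n - 1) * (\<Prod>j\<in>{1..n} - {i}. (z (int (lam i)) (int n - int i + -1) - grid_point n z lam j) / (grid_point n z lam i - grid_point n z lam j))"
      unfolding prod.distrib prod_constant using i by simp
    finally show "shift_coeff n c r (- 1) lam i = shift_coeff n z r' (- 1) lam i"
      unfolding shift_coeff_def r_def r'_def by (simp only: mult_ac)
  next
    fix k
    define R where "R = smult ((1 / t) ^ (n - 1) * t ^ k) ([:- 1, 1:] * monom 1 k)"
    have "degree R \<le> 1 + k"
      unfolding R_def using degree_mult_le[of "[:- 1, 1::'a:]" "monom 1 k"] degree_monom_le[of "1::'a" k]
      by (intro order.trans[OF degree_smult_le]) (simp add: One_nat_def)
    moreover have "r' m j * z m (j - 1) ^ k = poly R (z m j)" for m j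
      by (simp add: r'_def zstep R_def poly_monom power_mult_distrib algebra_simps)
    ultimately show "\<exists>R. degree R \<le> 1 + k \<and> (\<forall>m\<ge>0. \<forall>j\<ge>0. r' m j * z m (j - 1) ^ k = poly R (z m j))" by blast
  next
    fix lam mu assume "lam \<in> partitions n" "mu \<in> partitions n" "psize n mu < psize n lam"
    then show "(\<Sum>i\<in>{1..n}. grid_point n z lam i) \<noteq> (\<Sum>i\<in>{1..n}. grid_point n z mu i)"
      using generic[of lam mu] by (simp add: grid_point_def z_def c_def)
  qed (simp add: r_def z00)
  then show ?thesis unfolding c_def .
qed

end

section \<open>The base fields and their cones\<close>

definition frac_cone :: "'p::idom set \<Rightarrow> 'p fract set" where
  "frac_cone S = {Fraction_Field.Fract f g | f g. f \<in> S \<and> g \<in> S}"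

lemma positive_cone_frac_cone:
  assumes S: "0 \<notin> S" "1 \<in> S" "\<And>f g. f \<in> S \<Longrightarrow> g \<in> S \<Longrightarrow> f + g \<in> S" "\<And>f g. f \<in> S \<Longrightarrow> g \<in> S \<Longrightarrow> f * g \<in> S"
  shows "positive_cone (frac_cone S)"
proof
  have nz: "f \<noteq> 0" if "f \<in> S" for f using that S(1) by metis
  show "0 \<notin> frac_cone S"
    using nz by (auto simp: frac_cone_def Zero_fract_def eq_fract)
  show "1 \<in> frac_cone S" unfolding frac_cone_def One_fract_def using S(2) by blast
  fix x y assume "x \<in> frac_cone S" "y \<in> frac_cone S"
  then obtain f g f' g' where fg: "x = Fraction_Field.Fract f g" "y = Fraction_Field.Fract f' g'" "f \<in> S" "g \<in> S" "f' \<in> S" "g' \<in> S"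
    unfolding frac_cone_def by blast
  have "x + y = Fraction_Field.Fract (f * g' + f' * g) (g * g')" using fg nz by simp
  then show "x + y \<in> frac_cone S" unfolding frac_cone_def using fg S by blast
  have "x * y = Fraction_Field.Fract (f * f') (g * g')" using fg by simp
  then show "x * y \<in> frac_cone S" unfolding frac_cone_def using fg S by blast
next
  fix x assume "x \<in> frac_cone S"
  then obtain f g where "x = Fraction_Field.Fract f g" "f \<in> S" "g \<in> S" unfolding frac_cone_def by blast
  then have "inverse x = Fraction_Field.Fract g f" "f \<in> S" "g \<in> S" by simp_all
  then show "inverse x \<in> frac_cone S" unfolding frac_cone_def by blast
qed

lemma to_fract_in_frac_cone: "1 \<in> S \<Longrightarrow> p \<in> S \<Longrightarrow> to_fract p \<in> frac_cone S"
  unfolding frac_cone_def to_fract_def by blast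

lemma positive_cone_INT:
  assumes "\<And>i. i \<in> I \<Longrightarrow> positive_cone (P i)" "I \<noteq> {}"
  shows "positive_cone (\<Inter>i\<in>I. P i)"
proof
  have cone: "positive_cone (P i)" if "i \<in> I" for i by (rule assms(1)[OF that])
  obtain k where k: "k \<in> I" using assms(2) by auto
  show "0 \<notin> (\<Inter>i\<in>I. P i)"
    using positive_cone.zero_notin[OF cone[OF k]] k by auto
  show "1 \<in> (\<Inter>i\<in>I. P i)"
    by (intro INT_I positive_cone.one_in[OF cone])
  fix x y assume "x \<in> (\<Inter>i\<in>I. P i)" "y \<in> (\<Inter>i\<in>I. P i)"
  then have xy: "x \<in> P i" "y \<in> P i" if "i \<in> I" for i using that by auto
  show "x + y \<in> (\<Inter>i\<in>I. P i)"
    by (rule INT_I) (rule positive_cone.add_in[OF cone xy])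
  show "x * y \<in> (\<Inter>i\<in>I. P i)"
    by (rule INT_I) (rule positive_cone.mult_in[OF cone xy])
next
  have cone: "positive_cone (P i)" if "i \<in> I" for i by (rule assms(1)[OF that])
  fix x assume "x \<in> (\<Inter>i\<in>I. P i)"
  then have x: "x \<in> P i" if "i \<in> I" for i using that by auto
  show "inverse x \<in> (\<Inter>i\<in>I. P i)"
    by (rule INT_I) (rule positive_cone.inverse_in[OF cone x])
qed

section \<open>Evaluation of the parameters at real numbers\<close>

definition ring_map :: "('p::comm_ring_1 \<Rightarrow> real) \<Rightarrow> bool" where
  "ring_map h \<longleftrightarrow> h 0 = 0 \<and> h 1 = 1 \<and> (\<forall>x y. h (x + y) = h x + h y) \<and> (\<forall>x y. h (x * y) = h x * h y)"

lemma ring_map_poly: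
  assumes "ring_map h"
  shows "ring_map (\<lambda>p. poly (map_poly h p) x)"
proof -
  have h: "h 0 = 0" "h 1 = 1" "\<And>x y. h (x + y) = h x + h y" "\<And>x y. h (x * y) = h x * h y"
    using assms by (auto simp: ring_map_def)
  have add: "map_poly h (p + q) = map_poly h p + map_poly h q" for p q
    by (rule poly_eqI) (simp add: coeff_map_poly h)
  have smult: "map_poly h (smult a p) = smult (h a) (map_poly h p)" for a p
    by (rule poly_eqI) (simp add: coeff_map_poly h)
  have pcons: "map_poly h (pCons a p) = pCons (h a) (map_poly h p)" for a p
    by (rule poly_eqI) (simp add: coeff_map_poly h coeff_pCons split: nat.split)
  have mult: "map_poly h (p * q) = map_poly h p * map_poly h q" for p q
    by (induction p) (simp_all add: add smult pcons h(1))
  show ?thesis using h by (simp add: ring_map_def add mult)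
qed

lemma map_poly_pCons_0: "h 0 = 0 \<Longrightarrow> map_poly h (pCons a p) = pCons (h a) (map_poly h p)"
  by (rule poly_eqI) (simp add: coeff_map_poly coeff_pCons split: nat.split)

lemma ring_map_eval1: "ring_map (eval1 q)"
proof -
  have "ring_map (of_rat :: rat \<Rightarrow> real)" by (simp add: ring_map_def of_rat_add of_rat_mult)
  from ring_map_poly[OF this] show ?thesis unfolding eval1_def[abs_def] .
qed

lemma ring_map_eval2: "ring_map (eval2 q t)"
  using ring_map_poly[OF ring_map_eval1] unfolding eval2_def[abs_def] .

lemma ring_map_eval3: "ring_map (eval3 q t a)"
  using ring_map_poly[OF ring_map_eval2] unfolding eval3_def[abs_def] .

lemma eval_pCons [simp]:
  "eval1 q 0 = 0" "eval1 q (pCons b p) = of_rat b + q * eval1 q p"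
  "eval2 q t 0 = 0" "eval2 q t (pCons p f) = eval1 q p + t * eval2 q t f"
  "eval3 q t a 0 = 0" "eval3 q t a (pCons f g) = eval2 q t f + a * eval3 q t a g"
  by (simp_all add: eval1_def eval2_def eval3_def map_poly_pCons_0)

lemma ring_map_simps:
  assumes "ring_map h"
  shows "h 0 = 0" "h 1 = 1" "h (x + y) = h x + h y" "h (x * y) = h x * h y" "h (x - y) = h x - h y" "h (x ^ k) = h x ^ k"
proof -
  show h: "h 0 = 0" "h 1 = 1" "h (x + y) = h x + h y" "h (x * y) = h x * h y"
    using assms by (auto simp: ring_map_def)
  have "h (x - y + y) = h (x - y) + h y" using assms by (simp only: ring_map_def)
  then show "h (x - y) = h x - h y" by simp
  show "h (x ^ k) = h x ^ k" using assms by (induction k) (auto simp: ring_map_def)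
qed

lemma positive_cone_eval: "ring_map h \<Longrightarrow> positive_cone (frac_cone {p. 0 < h p})"
  by (rule positive_cone_frac_cone) (auto simp: ring_map_simps)

lemma frac_cone_eval_nonneg_at: "f \<in> frac_cone {p. 0 < h p} \<Longrightarrow> nonneg_at h f"
  unfolding frac_cone_def nonneg_at_def by fastforce

lemma to_fract_in_eval_cone: "ring_map h \<Longrightarrow> 0 < h p \<Longrightarrow> to_fract p \<in> frac_cone {p. 0 < h p}"
  by (rule to_fract_in_frac_cone) (auto simp: ring_map_simps)

lemma to_fract_power: "to_fract (x ^ k) = to_fract x ^ k"
  by (induction k) simp_all

section \<open>The cones of the Jack families\<close>

lemma sum_Nats: "(\<And>i. i \<in> A \<Longrightarrow> f i \<in> \<nat>) \<Longrightarrow> sum f A \<in> (\<nat> :: rat set)"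
  by (induction A rule: infinite_finite_induct) auto

lemma nat_coeffs_mult:
  assumes "\<forall>i. coeff f i \<in> \<nat>" "\<forall>i. coeff g i \<in> \<nat>"
  shows "coeff (f * g) i \<in> (\<nat> :: rat set)"
  unfolding coeff_mult using assms by (intro sum_Nats Nats_mult) auto

lemma Nats_add_eq_0: "(x::rat) \<in> \<nat> \<Longrightarrow> y \<in> \<nat> \<Longrightarrow> x + y = 0 \<Longrightarrow> x = 0"
  by (auto elim!: Nats_cases simp flip: of_nat_add)

lemma frac_cone_minus_zero: "{Fraction_Field.Fract f g | f g. f \<in> S \<and> g \<in> S \<and> g \<noteq> 0} - {0} = frac_cone (S - {0})"
proof (intro equalityI subsetI)
  fix x assume "x \<in> {Fraction_Field.Fract f g | f g. f \<in> S \<and> g \<in> S \<and> g \<noteq> 0} - {0}"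
  then obtain f g where fg: "x = Fraction_Field.Fract f g" "f \<in> S" "g \<in> S" "g \<noteq> 0" "x \<noteq> 0" by blast
  then have "f \<noteq> 0" by (auto simp: Zero_fract_def eq_fract)
  then show "x \<in> frac_cone (S - {0})" unfolding frac_cone_def using fg by blast
next
  fix x assume "x \<in> frac_cone (S - {0})"
  then obtain f g where fg: "x = Fraction_Field.Fract f g" "f \<in> S" "g \<in> S" "f \<noteq> 0" "g \<noteq> 0"
    unfolding frac_cone_def by blast
  then have "x \<noteq> 0" by (auto simp: Zero_fract_def eq_fract)
  then show "x \<in> {Fraction_Field.Fract f g | f g. f \<in> S \<and> g \<in> S \<and> g \<noteq> 0} - {0}" using fg by blast
qed

lemma pos_AJ_eq: "pos_AJ = frac_cone (nonneg_int_poly1 - {0})"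
  unfolding pos_AJ_def nonneg_AJ_def by (rule frac_cone_minus_zero)

lemma pos_BJ_eq: "pos_BJ = frac_cone (nonneg_int_poly2 - {0})"
  unfolding pos_BJ_def nonneg_BJ_def by (rule frac_cone_minus_zero)

lemma one_in_nonneg_int_poly: "1 \<in> nonneg_int_poly1 - {0}" "1 \<in> nonneg_int_poly2 - {0}"
  by (auto simp: nonneg_int_poly1_def nonneg_int_poly2_def coeff_1)

lemma positive_cone_pos_AJ: "positive_cone pos_AJ"
  unfolding pos_AJ_eq
proof (rule positive_cone_frac_cone)
  fix f g assume fg: "f \<in> nonneg_int_poly1 - {0}" "g \<in> nonneg_int_poly1 - {0}"
  then show "f * g \<in> nonneg_int_poly1 - {0}" by (auto simp: nonneg_int_poly1_def nat_coeffs_mult)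
  have "f + g \<noteq> 0"
  proof
    assume "f + g = 0"
    then have "coeff f i + coeff g i = 0" for i by (metis coeff_0 coeff_add)
    then have "coeff f i = 0" for i using fg Nats_add_eq_0[of "coeff f i" "coeff g i"] by (auto simp: nonneg_int_poly1_def)
    then show False using fg by (auto simp: poly_eq_iff)
  qed
  then show "f + g \<in> nonneg_int_poly1 - {0}" using fg by (auto simp: nonneg_int_poly1_def)
qed (use one_in_nonneg_int_poly in auto)

lemma positive_cone_pos_BJ: "positive_cone pos_BJ"
  unfolding pos_BJ_eq
proof (rule positive_cone_frac_cone)
  fix f g assume fg: "f \<in> nonneg_int_poly2 - {0}" "g \<in> nonneg_int_poly2 - {0}"
  have "coeff (coeff (f * g) i) j \<in> \<nat>" for i j
    unfolding coeff_mult[of f g] coeff_sum using fg by (intro sum_Nats nat_coeffs_mult) (auto simp: nonneg_int_poly2_def)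
  then show "f * g \<in> nonneg_int_poly2 - {0}" using fg by (auto simp: nonneg_int_poly2_def)
  have "f + g \<noteq> 0"
  proof
    assume "f + g = 0"
    then have "coeff (coeff f i) j + coeff (coeff g i) j = 0" for i j by (metis coeff_0 coeff_add)
    then have "coeff (coeff f i) j = 0" for i j
      using fg Nats_add_eq_0[of "coeff (coeff f i) j" "coeff (coeff g i) j"] by (auto simp: nonneg_int_poly2_def)
    then show False using fg by (auto simp: poly_eq_iff)
  qed
  then show "f + g \<in> nonneg_int_poly2 - {0}" using fg by (auto simp: nonneg_int_poly2_def)
qed (use one_in_nonneg_int_poly in auto)

lemma tau_AJ_pos: "tau_AJ \<in> pos_AJ"
  unfolding pos_AJ_eq tau_AJ_def to_fract_def[symmetric]
  by (rule to_fract_in_frac_cone[OF one_in_nonneg_int_poly(1)])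
     (auto simp: nonneg_int_poly1_def coeff_pCons split: nat.split)

lemma tau_alpha_BJ_pos: "tau_BJ \<in> pos_BJ" "alpha_BJ \<in> pos_BJ"
proof -
  have "[:[:0, 1:]:] \<in> nonneg_int_poly2 - {0}" "[:0, 1:] \<in> nonneg_int_poly2 - {0}"
    by (auto simp: nonneg_int_poly2_def coeff_pCons split: nat.split)
  then show "tau_BJ \<in> pos_BJ" "alpha_BJ \<in> pos_BJ"
    unfolding pos_BJ_eq tau_BJ_def alpha_BJ_def to_fract_def[symmetric]
    using to_fract_in_frac_cone[OF one_in_nonneg_int_poly(2)] by blast+
qed

text \<open>The representing fraction may change with the point. Positivity of numerator and
  denominator at that point makes the set closed under inverses.\<close>

definition pos_cone2 :: "field2 set" where
  "pos_cone2 = (\<Inter>(q, t)\<in>{0<..<1} \<times> {0<..<1}. frac_cone {p. 0 < eval2 q t p})"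

definition pos_cone3 :: "field3 set" where
  "pos_cone3 = (\<Inter>(q, t, a)\<in>{0<..<1} \<times> {0<..<1} \<times> {0<..<1}. frac_cone {p. 0 < eval3 q t a p})"

lemma positive_cone2: "positive_cone pos_cone2"
  unfolding pos_cone2_def
proof (rule positive_cone_INT)
  have "(1/2, 1/2) \<in> {0<..<1::real} \<times> {0<..<1::real}" by simp
  then show "{0<..<1::real} \<times> {0<..<1::real} \<noteq> {}" by blast
qed (auto intro!: positive_cone_eval ring_map_eval2)

lemma positive_cone3: "positive_cone pos_cone3"
  unfolding pos_cone3_def
proof (rule positive_cone_INT)
  have "(1/2, 1/2, 1/2) \<in> {0<..<1::real} \<times> {0<..<1::real} \<times> {0<..<1::real}" by simp
  then show "{0<..<1::real} \<times> {0<..<1::real} \<times> {0<..<1::real} \<noteq> {}" by blast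
qed (auto intro!: positive_cone_eval ring_map_eval3)

lemma pos_cone2_subset: "pos_cone2 \<subseteq> pos_AM"
  using positive_cone.zero_notin[OF positive_cone2] frac_cone_eval_nonneg_at
  unfolding pos_AM_def nonneg_AM_def pos_cone2_def by fastforce

lemma pos_cone3_subset: "pos_cone3 \<subseteq> pos_BM"
  using positive_cone.zero_notin[OF positive_cone3] frac_cone_eval_nonneg_at
  unfolding pos_BM_def nonneg_BM_def pos_cone3_def by fastforce

lemma to_fract_in_pos_cone2: "(\<And>q t. q \<in> {0<..<1} \<Longrightarrow> t \<in> {0<..<1} \<Longrightarrow> 0 < eval2 q t p) \<Longrightarrow> to_fract p \<in> pos_cone2"
  unfolding pos_cone2_def by (auto intro!: to_fract_in_eval_cone ring_map_eval2)

lemma to_fract_in_pos_cone3: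
  "(\<And>q t a. q \<in> {0<..<1} \<Longrightarrow> t \<in> {0<..<1} \<Longrightarrow> a \<in> {0<..<1} \<Longrightarrow> 0 < eval3 q t a p) \<Longrightarrow> to_fract p \<in> pos_cone3"
  unfolding pos_cone3_def by (auto intro!: to_fract_in_eval_cone ring_map_eval3)

lemma AM_parameters: "q_AM \<in> pos_cone2" "1 - q_AM \<in> pos_cone2" "t_AM \<in> pos_cone2" "1 - t_AM \<in> pos_cone2"
proof -
  have "to_fract [:[:0, 1:]:] \<in> pos_cone2" "to_fract (1 - [:[:0, 1:]:]) \<in> pos_cone2"
    "to_fract [:0, 1:] \<in> pos_cone2" "to_fract (1 - [:0, 1:]) \<in> pos_cone2"
    by (intro to_fract_in_pos_cone2; simp add: ring_map_simps(2,5)[OF ring_map_eval2] ring_map_simps(2)[OF ring_map_eval1])+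
  then show "q_AM \<in> pos_cone2" "1 - q_AM \<in> pos_cone2" "t_AM \<in> pos_cone2" "1 - t_AM \<in> pos_cone2"
    unfolding q_AM_def t_AM_def to_fract_def[symmetric] by simp_all
qed

lemma BM_parameters: "q_BM \<in> pos_cone3" "1 - q_BM \<in> pos_cone3" "t_BM \<in> pos_cone3" "1 - t_BM \<in> pos_cone3"
  "a_BM \<in> pos_cone3" "1 - a_BM \<in> pos_cone3"
proof -
  have "to_fract [:[:[:0, 1:]:]:] \<in> pos_cone3" "to_fract (1 - [:[:[:0, 1:]:]:]) \<in> pos_cone3"
    "to_fract [:[:0, 1:]:] \<in> pos_cone3" "to_fract (1 - [:[:0, 1:]:]) \<in> pos_cone3"
    "to_fract [:0, 1:] \<in> pos_cone3" "to_fract (1 - [:0, 1:]) \<in> pos_cone3"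
    by (intro to_fract_in_pos_cone3; simp add: ring_map_simps(2,5)[OF ring_map_eval3] ring_map_simps(2)[OF ring_map_eval2]
        ring_map_simps(2)[OF ring_map_eval1])+
  then show "q_BM \<in> pos_cone3" "1 - q_BM \<in> pos_cone3" "t_BM \<in> pos_cone3" "1 - t_BM \<in> pos_cone3"
    "a_BM \<in> pos_cone3" "1 - a_BM \<in> pos_cone3"
    unfolding q_BM_def t_BM_def a_BM_def to_fract_def[symmetric] by simp_all
qed

section \<open>Genericity of the parameters\<close>

lemma BJ_generic:
  assumes "0 \<le> j"
  shows "2 * jack_x tau_BJ alpha_BJ 0 j \<noteq> 1"
proof
  assume eq: "2 * jack_x tau_BJ alpha_BJ 0 j = 1"
  define x y :: "rat poly poly" where "x = [:[:0, 1:]:]" and "y = [:0, 1:]"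
  have par: "tau_BJ = to_fract x" "alpha_BJ = to_fract y"
    by (simp_all add: tau_BJ_def alpha_BJ_def to_fract_def x_def y_def)
  define k where "k = nat j"
  have jack: "jack_x tau_BJ alpha_BJ 0 j = of_nat k * to_fract x + to_fract y"
    using assms by (simp add: jack_x_def par k_def)
  define p where "p = 1 - 2 * (of_nat k * x + y)"
  have nat: "to_fract (of_nat k) = (of_nat k :: field2)" for k by (induction k) simp_all
  have two: "to_fract (2 :: rat poly poly) = 2" using nat[of 2] by simp
  have "to_fract p = 1 - 2 * jack_x tau_BJ alpha_BJ 0 j"
    unfolding p_def jack by (simp add: nat two)
  then have "p = 0" using eq by simp
  \<comment> \<open>At \<open>\<tau> = \<alpha> = 0\<close> the polynomial
    \<open>1 - 2 (k \<tau> + \<alpha>)\<close> has the value 1.\<close>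
  have "eval2 0 0 (2 * f) = 0" "eval2 0 0 (of_nat k * g) = 0" if "eval2 0 0 f = 0" "eval2 0 0 g = 0" for f g k
    using that by (simp_all add: ring_map_simps(4)[OF ring_map_eval2])
  moreover have "eval2 0 0 x = 0" "eval2 0 0 y = 0" by (simp_all add: x_def y_def)
  ultimately have "eval2 0 0 p = 1"
    unfolding p_def by (simp add: ring_map_simps(2,3,4,5)[OF ring_map_eval2])
  then show False using \<open>p = 0\<close> by simp
qed

lemma BM_generic:
  assumes "0 \<le> j"
  shows "macdonald_x q_BM t_BM a_BM 0 j ^ 2 \<noteq> q_BM"
proof
  assume eq: "macdonald_x q_BM t_BM a_BM 0 j ^ 2 = q_BM"
  define k where "k = nat j"
  define x y z :: "rat poly poly poly" where "x = [:[:[:0, 1:]:]:]" and "y = [:[:0, 1:]:]" and "z = [:0, 1:]"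
  have par: "q_BM = to_fract x" "t_BM = to_fract y" "a_BM = to_fract z"
    by (simp_all add: q_BM_def t_BM_def a_BM_def to_fract_def x_def y_def z_def)
  define p where "p = (z * y ^ k) ^ 2 - x"
  have "macdonald_x q_BM t_BM a_BM 0 j = a_BM * t_BM ^ k"
    using assms by (simp add: macdonald_x_def k_def power_int_def)
  then have "to_fract p = 0"
    using eq unfolding p_def par by (simp add: to_fract_power)
  then have "p = 0" by simp
  \<comment> \<open>With all parameters equal to 1/2 the square is at most 1/4, below the value 1/2
    of \<open>q\<close>.\<close>
  moreover have "eval3 (1/2) (1/2) (1/2) p = (1/2 * (1/2) ^ k) ^ 2 - 1/2"
  proof -
    have "eval3 (1/2) (1/2) (1/2) x = 1/2" "eval3 (1/2) (1/2) (1/2) y = 1/2" "eval3 (1/2) (1/2) (1/2) z = 1/2"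
      by (simp_all add: x_def y_def z_def ring_map_simps(2)[OF ring_map_eval2] ring_map_simps(2)[OF ring_map_eval1])
    then show ?thesis unfolding p_def by (simp only: ring_map_simps(4,5,6)[OF ring_map_eval3])
  qed
  moreover have "(1/2 * (1/2) ^ k) ^ 2 \<le> (1/2 :: real) ^ 2"
    by (intro power_mono) (auto simp: power_le_one)
  ultimately show False by (simp add: power2_eq_square)
qed

lemma grid_point_macdonald:
  assumes "i \<in> {1..n}"
  shows "grid_point n (macdonald_x q t a) kap i = a * q ^ kap i * t ^ (n - i)"
proof -
  have "int n - int i = int (n - i)" using assms by auto
  then show ?thesis unfolding grid_point_def macdonald_x_def by (simp only: power_int_of_nat)
qed

lemma grid_point_jack:
  assumes "i \<in> {1..n}"
  shows "grid_point n (jack_x \<tau> \<alpha>) kap i = of_nat (kap i) + of_nat (n - i) * \<tau> + \<alpha>"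
proof -
  have "int n - int i = int (n - i)" using assms by auto
  then show ?thesis unfolding grid_point_def jack_x_def by (simp only: of_int_of_nat_eq)
qed

text \<open>The factor \<open>q^N t^n\<close>, with \<open>N\<close> at least every part, clears the
  denominators. The coefficient of \<open>t^i\<close> is then \<open>q^(N - lam i)\<close>, from
  which each part can be read off.\<close>

lemma AM_generic:
  assumes lam: "lam \<in> partitions n" and mu: "mu \<in> partitions n"
    and eq: "(\<Sum>i\<in>{1..n}. inverse (grid_point n (macdonald_x q_AM t_AM 1) lam i)) =
      (\<Sum>i\<in>{1..n}. inverse (grid_point n (macdonald_x q_AM t_AM 1) mu i))"
  shows "lam = mu"
proof -
  define N where "N = psize n lam + psize n mu"
  define p :: "(nat \<Rightarrow> nat) \<Rightarrow> rat poly poly" where "p kap = (\<Sum>i\<in>{1..n}. [:[:0, 1:]:] ^ (N - kap i) * [:0, 1:] ^ i)" for kap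
  have q0: "q_AM \<noteq> 0" and t0: "t_AM \<noteq> 0" using AM_parameters positive_cone.nonzero[OF positive_cone2] by auto
  have le: "kap i \<le> N" if "kap = lam \<or> kap = mu" "i \<in> {1..n}" for kap i
    using that member_le_sum[of i "{1..n}" lam] member_le_sum[of i "{1..n}" mu] by (auto simp: N_def psize_def)
  have P: "to_fract (p kap) = q_AM ^ N * t_AM ^ n * (\<Sum>i\<in>{1..n}. inverse (grid_point n (macdonald_x q_AM t_AM 1) kap i))"
    if kap: "kap = lam \<or> kap = mu" for kap
  proof -
    have sum: "to_fract (\<Sum>i\<in>A. f i) = (\<Sum>i\<in>A. to_fract (f i))" for A :: "nat set" and f :: "nat \<Rightarrow> rat poly poly"
      by (induction A rule: infinite_finite_induct) simp_all
    have "to_fract (p kap) = (\<Sum>i\<in>{1..n}. q_AM ^ (N - kap i) * t_AM ^ i)"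
      unfolding p_def q_AM_def t_AM_def to_fract_def[symmetric] by (simp add: sum to_fract_power)
    also have "\<dots> = (\<Sum>i\<in>{1..n}. q_AM ^ N * t_AM ^ n * inverse (grid_point n (macdonald_x q_AM t_AM 1) kap i))"
    proof (intro sum.cong refl)
      fix i assume i: "i \<in> {1..n}"
      have "grid_point n (macdonald_x q_AM t_AM 1) kap i = q_AM ^ kap i * t_AM ^ (n - i)"
        using grid_point_macdonald[OF i, of q_AM t_AM 1 kap] by (simp only: mult_1)
      moreover have "q_AM ^ N = q_AM ^ (N - kap i) * q_AM ^ kap i" using le[OF kap i] by (simp flip: power_add)
      moreover have "t_AM ^ n = t_AM ^ i * t_AM ^ (n - i)" using i by (simp flip: power_add)
      ultimately show "q_AM ^ (N - kap i) * t_AM ^ i = q_AM ^ N * t_AM ^ n * inverse (grid_point n (macdonald_x q_AM t_AM 1) kap i)"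
        using q0 t0 by (simp add: field_simps)
    qed
    finally show ?thesis by (simp only: sum_distrib_left)
  qed
  have "to_fract (p lam) = to_fract (p mu)" using P[of lam] P[of mu] eq by simp
  then have peq: "p lam = p mu" by simp
  have coeff: "coeff (p kap) i = monom 1 (N - kap i)" if "i \<in> {1..n}" for kap i
  proof -
    have q: "[:[:0, 1:]:] ^ k = [:monom (1::rat) k:]" for k
      by (induction k) (simp_all add: monom_Suc one_pCons)
    have t: "[:0, 1:] ^ k = (monom 1 k :: rat poly poly)" for k by (simp add: monom_altdef)
    have "coeff (p kap) i = (\<Sum>k\<in>{1..n}. if k = i then monom 1 (N - kap i) else 0)"
      unfolding p_def coeff_sum q t by (intro sum.cong) auto
    then show ?thesis using that by simp
  qed
  show ?thesis
  proof (rule partitions_eqI[OF lam mu])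
    fix i assume i: "i \<in> {1..n}"
    have "monom (1::rat) (N - lam i) = monom 1 (N - mu i)" using coeff[OF i] peq by metis
    then have "N - lam i = N - mu i" by (metis degree_monom_eq one_neq_zero)
    then show "lam i = mu i" using le[of lam i] le[of mu i] i by simp
  qed
qed

theorem theorem3:
  fixes n :: nat and lam mu :: "nat \<Rightarrow> nat"
  assumes "n \<ge> 1" and "lam \<in> partitions n" and "mu \<in> partitions n"
  shows "(binomial_AJ n lam mu \<in> pos_AJ \<longleftrightarrow> contains n lam mu) \<and>
         (binomial_BJ n lam mu \<in> pos_BJ \<longleftrightarrow> contains n lam mu) \<and>
         (binomial_AM n lam mu \<in> pos_AM \<longleftrightarrow> contains n lam mu) \<and>
         (binomial_BM n lam mu \<in> pos_BM \<longleftrightarrow> contains n lam mu)"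
proof (intro conjI)
  interpret AJ: positive_cone pos_AJ by (rule positive_cone_pos_AJ)
  interpret BJ: positive_cone pos_BJ by (rule positive_cone_pos_BJ)
  interpret AM: positive_cone pos_cone2 by (rule positive_cone2)
  interpret BM: positive_cone pos_cone3 by (rule positive_cone3)
  show "binomial_AJ n lam mu \<in> pos_AJ \<longleftrightarrow> contains n lam mu"
  proof -
    have "binomial_AJ n lam mu = binom n (jack_x tau_AJ 0) lam mu"
      unfolding binomial_AJ_def
      by (rule laurent_family.interpolation_binomial_eq_binom[OF laurent_family_X
            ordered_grid.distinct[OF AJ.ordered_grid_jack[OF tau_AJ_pos]] _ _ assms(2)])
         (simp_all add: grid_point_jack shift_AJ_def)
    then show ?thesis using AJ.type_A_jack[OF assms(1) tau_AJ_pos assms(2,3)] AJ.zero_notin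
      by (cases "contains n lam mu") auto
  qed
  show "binomial_BJ n lam mu \<in> pos_BJ \<longleftrightarrow> contains n lam mu"
  proof -
    define c where "c = (\<lambda>m j. jack_x tau_BJ alpha_BJ m j ^ 2)"
    have B: "type_B_grid pos_BJ c"
      unfolding c_def by (intro BJ.type_B_grid_jack tau_alpha_BJ_pos BJ_generic)
    obtain rU rL xU xL where T: "type_B pos_BJ c rU rL xU xL" using type_B_gridE[OF B] .
    have dist: "distinct_grid c" by (rule ordered_grid.distinct[OF type_B.axioms(1)[OF T]])
    have c: "grid_point n c kap i = (of_nat (kap i) + of_nat (n - i) * tau_BJ + alpha_BJ) ^ 2" if "i \<in> {1..n}" for kap i
      using grid_point_jack[OF that, of tau_BJ alpha_BJ kap] unfolding c_def grid_point_def by (simp only:)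
    have "binomial_BJ n lam mu = binom n c lam mu"
      unfolding binomial_BJ_def
      by (rule laurent_family.interpolation_binomial_eq_binom[OF laurent_family_X2 dist _ _ assms(2)])
         (simp_all add: c shift_BJ_def)
    then show ?thesis
      using type_B_positivity[OF B assms(2,3)] extra_vanishing[OF B assms(2,3)] BJ.zero_notin
      by (cases "contains n lam mu") auto
  qed
  show "binomial_AM n lam mu \<in> pos_AM \<longleftrightarrow> contains n lam mu"
  proof -
    have "binomial_AM n lam mu = binom n (macdonald_x q_AM t_AM 1) lam mu"
      unfolding binomial_AM_def
      by (rule laurent_family.interpolation_binomial_eq_binom[OF laurent_family_X
            ordered_grid.distinct[OF AM.ordered_grid_macdonald[OF AM_parameters]] _ _ assms(2)])
         (simp_all add: grid_point_macdonald shift_AM_def)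
    moreover have "(contains n lam mu \<longrightarrow> binom n (macdonald_x q_AM t_AM 1) lam mu \<in> pos_cone2) \<and>
      (\<not> contains n lam mu \<longrightarrow> binom n (macdonald_x q_AM t_AM 1) lam mu = 0)"
      using AM_generic by (intro AM.type_A_macdonald assms AM_parameters) blast
    moreover have "0 \<notin> pos_AM" by (simp add: pos_AM_def)
    \<comment> \<open>The dichotomy survives in the larger cone: it contains
      \<open>pos_cone2\<close> and omits 0.\<close>
    ultimately show ?thesis using pos_cone2_subset by (cases "contains n lam mu") auto
  qed
  show "binomial_BM n lam mu \<in> pos_BM \<longleftrightarrow> contains n lam mu"
  proof -
    define c where "c = (\<lambda>m j. macdonald_x q_BM t_BM a_BM m j + inverse (macdonald_x q_BM t_BM a_BM m j))"
    have B: "type_B_grid pos_cone3 c"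
      unfolding c_def by (intro BM.type_B_grid_macdonald BM_parameters BM_generic)
    obtain rU rL xU xL where T: "type_B pos_cone3 c rU rL xU xL" using type_B_gridE[OF B] .
    have dist: "distinct_grid c" by (rule ordered_grid.distinct[OF type_B.axioms(1)[OF T]])
    have c: "grid_point n c kap i = shift_BM n kap i + inverse (shift_BM n kap i)" if "i \<in> {1..n}" for kap i
      using grid_point_macdonald[OF that, of q_BM t_BM a_BM kap]
      unfolding c_def grid_point_def shift_BM_def by (simp only:)
    have nz: "shift_BM n kap i \<noteq> 0" for kap i
      using BM.nonzero BM_parameters by (simp add: shift_BM_def)
    have "binomial_BM n lam mu = binom n c lam mu"
      unfolding binomial_BM_def
      by (rule laurent_family.interpolation_binomial_eq_binom[OF laurent_family_X_inv dist _ _ assms(2)])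
         (simp_all add: c nz)
    moreover have "0 \<notin> pos_BM" by (simp add: pos_BM_def)
    ultimately show ?thesis
      using type_B_positivity[OF B assms(2,3)] extra_vanishing[OF B assms(2,3)] pos_cone3_subset
      by (cases "contains n lam mu") auto
  qed
qed

end
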